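(* Consider the two-tier massive MIMO heterogeneous network described in the context and a typical user associated with an MBS. Let $R_s$ be the targeted secrecy rate. Let $R_{\mathrm M}=\log_2\!\big(1+(\mathbb E\{\mathrm{SINR}_{\mathrm M}^{-1}\})^{-1}\big)$ be the lower bound on the ergodic rate of the macrocell user, and let $\mathrm{SINR}^{\mathrm M}_{e^*}$ be the receive SINR at the most malicious eavesdropper. Then the secrecy outage probability of this typical user is upper bounded by $$P^{\mathrm M}_{out}(R_s)=\Pr\{R_{\mathrm M}-\log_2(1+\mathrm{SINR}^{\mathrm M}_{e^*})\le R_s\}=1-\mathbb F_{\mathrm{SINR}^{\mathrm M}_{e^*}}\!\left(2^{R_{\mathrm M}-R_s}-1\right),$$ where the CDF $\mathbb F_{\mathrm{SINR}^{\mathrm M}_{e^*}}$ of $\mathrm{SINR}^{\mathrm M}_{e^*}$ is, for $\gamma\ge 0$, $$\mathbb F_{\mathrm{SINR}^{\mathrm M}_{e^*}}(\gamma)=\exp\Big\{-2\pi\lambda_{\mathrm E}\int_0^\infty \exp\{-E(x)\}\,(\gamma+1)^{-(S-1)}\,x\,dx\Big\},$$ with $$E(x)=\frac{\gamma S\delta^2x^{\alpha_1}}{\beta P_{\mathrm M}}+2\pi\lambda_{\mathrm M}\sum_{k=1}^{S}\binom{S}{k}\frac{(\gamma x^{\alpha_1})^{2/\alpha_1}\,\Gamma(k-\tfrac{2}{\alpha_1})\,\Gamma(-k+\tfrac{2}{\alpha_1}+S)}{\alpha_1\Gamma(S)}+\frac{2\pi^2\lambda_{\mathrm P}}{\alpha_2}\left(\frac{\gamma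 S x^{\alpha_1}P_{\mathrm P}}{P_{\mathrm M}}\right)^{2/\alpha_2}\csc\!\left(\frac{2\pi}{\alpha_2}\right).$$
   Context: Network: in the plane, macrocell base stations (MBSs), picocell base stations (PBSs) and eavesdroppers are located according to independent homogeneous Poisson point processes $\Phi_{\mathrm M},\Phi_{\mathrm P},\Phi_{\mathrm E}$ with densities $\lambda_{\mathrm M},\lambda_{\mathrm P},\lambda_{\mathrm E}$. Each MBS has $N$ antennas, uses zero-forcing beamforming with equal power assignment, and serves $S$ single-antenna users simultaneously ($N\gg S\ge1$); each PBS is single-antenna and serves one single-antenna user. Transmit powers are $P_{\mathrm M}$ (MBS) and $P_{\mathrm P}$ (PBS); the noise power is $\delta^2$; all tiers share the same bandwidth. Path loss at distance $r$ is $L(r)=\beta r^{-\alpha_1}$ for MBS links and $L(r)=\beta r^{-\alpha_2}$ for PBS links, with $\alpha_1,\alpha_2>2$ and $\beta>0$. All fading gains are mutually independent (i.i.d. quasi-static Rayleigh fading). $\Gamma(k,1)$ as a distribution denotes the Gamma law with shape $k$ and unit scale (read as the constant $0$ when $k=0$). User association: the typical user at the origin is associated with the base station giving the maximum average received power, which is $(N-S+1)\frac{P_{\mathrm M}}{S}\beta r^{-\alpha_1}$ for an MBS at distance $r$ and $P_{\mathrm P}\beta r^{-\alpha_2}$ for a PBS at distance $r$. SINR of the macrocell user: conditional on the typical user being associated with MBS $B_{o,\mathrm M}$ at (random) distance $|X_{o,\mathrm M}|$, $$\mathrm{SINR}_{\mathrm M}=\frac{\frac{P_{\mathrm M}}{S}h_{o,\mathrm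 M}\,\beta|X_{o,\mathrm M}|^{-\alpha_1}}{I_1+\delta^2},\qquad I_1=\sum_{\ell\in\Phi_{\mathrm M}\setminus B_{o,\mathrm M}}\frac{P_{\mathrm M}}{S}h_{\ell,\mathrm M}\,\beta|X_{\ell,\mathrm M}|^{-\alpha_1}+\sum_{j\in\Phi_{\mathrm P}}P_{\mathrm P}h_{j,\mathrm P}\,\beta|X_{j,\mathrm P}|^{-\alpha_2},$$ with $h_{o,\mathrm M}\sim\Gamma(N-S+1,1)$, $h_{\ell,\mathrm M}\sim\Gamma(S,1)$, $h_{j,\mathrm P}\sim\exp(1)$, and $|X_{\ell,\mathrm M}|,|X_{j,\mathrm P}|$ the distances from the user to MBS $\ell$ and PBS $j$. The ergodic rate of the macrocell user is $\mathbb E\{\log_2(1+\mathrm{SINR}_{\mathrm M})\}$ (expectation conditional on MBS association), which is lower bounded by $\log_2(1+(\mathbb E\{\mathrm{SINR}_{\mathrm M}^{-1}\})^{-1})$. Eavesdropping: eavesdroppers are passive and non-colluding, so only the one with the largest receive SINR matters. When the MBS $o$ transmits to its intended user, $$\mathrm{SINR}^{\mathrm M}_{e^*}=\max_{e\in\Phi_{\mathrm E}}\frac{\frac{P_{\mathrm M}}{S}h_{o,e}L(|X_{o,e}|)}{I_A+I_{\mathrm M,e}+I_{\mathrm S,e}+\delta^2},$$ where $h_{o,e}\sim\exp(1)$, $|X_{o,e}|$ is the distance between eavesdropper $e$ and the targeted MBS, $I_A=\frac{P_{\mathrm M}}{S}h_eL(|X_{o,e}|)$ with $h_e\sim\Gamma(S-1,1)$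 is the intra-cell interference, $I_{\mathrm M,e}=\sum_{\ell\in\Phi_{\mathrm M}\setminus o}\frac{P_{\mathrm M}}{S}h_{\ell,e}L(|X_{\ell,e}|)$ with $h_{\ell,e}\sim\Gamma(S,1)$, and $I_{\mathrm S,e}=\sum_{j\in\Phi_{\mathrm P}}P_{\mathrm P}h_{j,\mathrm P,e}L(|X_{j,\mathrm P,e}|)$ with $h_{j,\mathrm P,e}\sim\exp(1)$; $|X_{\ell,e}|$ and $|X_{j,\mathrm P,e}|$ are the distances from the eavesdropper to MBS $\ell$ and PBS $j$. Secrecy outage is declared when the secrecy rate (the user's ergodic rate minus $\log_2(1+\mathrm{SINR}^{\mathrm M}_{e^*})$) is less than the targeted secrecy rate $R_s$.
   Formalization: Each eavesdropper's interfering MBSs and PBSs are taken as fresh Poisson processes (densities λ_M, λ_P), independent across eavesdroppers and of the user's network; with shared Φ_M, Φ_P the stated CDF is false (strict Jensen; association also thins interferers). *)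

theory Defs
  imports "HOL-Probability.Probability"
begin

text \<open>
  A point process in the plane is given by an enumeration \<open>X 0, X 1, \<dots>\<close> of its (almost surely
  infinitely many) points, so that marks such as fading gains can be attached to point numbers.
\<close>

definition point_count :: "(nat \<Rightarrow> 'a \<Rightarrow> real^2) \<Rightarrow> (real^2) set \<Rightarrow> 'a \<Rightarrow> nat" where
  "point_count X B \<omega> = card {i. X i \<omega> \<in> B}"

text \<open>
  Finiteness is demanded separately because \<open>card\<close> of an infinite set is \<open>0\<close>. The Poisson weights
  are written out since \<open>poisson_pmf\<close> does not cover rate \<open>0\<close>, that is, null sets \<open>B\<close>.
\<close>

definition homogeneous_ppp :: "'a measure \<Rightarrow> real \<Rightarrow> (nat \<Rightarrow> 'a \<Rightarrow> real^2) \<Rightarrow> bool" where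
  "homogeneous_ppp M lam X \<longleftrightarrow>
     (\<forall>i. X i \<in> borel_measurable M) \<and>
     (\<forall>B. B \<in> sets borel \<and> bounded B \<longrightarrow>
        (AE \<omega> in M. finite {i. X i \<omega> \<in> B}) \<and>
        (\<forall>n. measure M {\<omega> \<in> space M. point_count X B \<omega> = n}
              = (lam * measure lborel B) ^ n / fact n * exp (- (lam * measure lborel B)))) \<and>
     (\<forall>(J :: nat set) B. finite J \<and> disjoint_family_on B J
          \<and> (\<forall>j\<in>J. B j \<in> sets borel \<and> bounded (B j)) \<longrightarrow>
        prob_space.indep_vars M (\<lambda>_. count_space UNIV) (\<lambda>j. point_count X (B j)) J)"

definition gamma_law :: "nat \<Rightarrow> real measure" where
  "gamma_law k = (if k = 0 then return borel 0
                  else density lborel (\<lambda>x. ennreal (erlang_density (k - 1) 1 x)))"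

definition exp_law :: "real measure" where
  "exp_law = density lborel (\<lambda>x. ennreal (exponential_density 1 x))"

text \<open>\<open>exp (- t)\<close> for \<open>t \<in> [0, \<infinity>]\<close>, with \<open>exp (- \<infinity>) = 0\<close>.\<close>

definition exp_neg :: "ennreal \<Rightarrow> real" where
  "exp_neg t = (if t = \<infinity> then 0 else exp (- enn2real t))"

text \<open>
  \<open>MBS_at k\<close> and \<open>PBS_at k\<close> are the macrocell base stations other than the targeted one and the
  picocell base stations that interfere at eavesdropper \<open>k\<close>. For each \<open>k\<close> they are
  Poisson processes with the densities of the two tiers (the other MBSs form a homogeneous process
  of unchanged density by Slivnyak's theorem), but the interference fields experienced by different
  eavesdroppers are independent realisations. This independence is what makes the product over
  the eavesdroppers computable by the generating functional of their process alone; if all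
  eavesdroppers shared one realisation, the closed form of the distribution function would by
  Jensen's inequality only be a (strict) lower bound.
\<close>

datatype tier = MBS | PBS | Eve | MBS_at nat | PBS_at nat

text \<open>
  Fading gains: the first three constructors are the links to the typical user (from the serving
  MBS, an interfering MBS, a PBS); the others have as first argument the number of the receiving
  eavesdropper (intended signal of the targeted MBS, its intra-cell interference, another MBS,
  a PBS).
\<close>

datatype link =
    User_serving | User_MBS nat | User_PBS nat
  | Eve_signal nat | Eve_intra nat | Eve_MBS nat nat | Eve_PBS nat nat

fun tier_density :: "real \<Rightarrow> real \<Rightarrow> real \<Rightarrow> tier \<Rightarrow> real" where
  "tier_density lam_M lam_P lam_E MBS = lam_M"
| "tier_density lam_M lam_P lam_E PBS = lam_P"
| "tier_density lam_M lam_P lam_E Eve = lam_E"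
| "tier_density lam_M lam_P lam_E (MBS_at k) = lam_M"
| "tier_density lam_M lam_P lam_E (PBS_at k) = lam_P"

fun gain_law :: "nat \<Rightarrow> nat \<Rightarrow> link \<Rightarrow> real measure" where
  "gain_law N S User_serving = gamma_law (N - S + 1)"
| "gain_law N S (User_MBS l) = gamma_law S"
| "gain_law N S (User_PBS j) = exp_law"
| "gain_law N S (Eve_signal k) = exp_law"
| "gain_law N S (Eve_intra k) = gamma_law (S - 1)"
| "gain_law N S (Eve_MBS k l) = gamma_law S"
| "gain_law N S (Eve_PBS k j) = exp_law"

locale massive_mimo_hetnet = prob_space \<Omega> for \<Omega> :: "'a measure" +
  fixes X :: "tier \<Rightarrow> nat \<Rightarrow> 'a \<Rightarrow> real^2"
    and h :: "link \<Rightarrow> 'a \<Rightarrow> real"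
    and N S :: nat
    and P_M P_P \<beta> \<alpha>\<^sub>1 \<alpha>\<^sub>2 \<delta> lam_M lam_P lam_E :: real
  assumes antennas: "1 \<le> S" "S < N"
    and params_pos: "0 < P_M" "0 < P_P" "0 < \<beta>" "0 < \<delta>" "0 < lam_M" "0 < lam_P" "0 < lam_E"
    and path_loss_exponents: "2 < \<alpha>\<^sub>1" "2 < \<alpha>\<^sub>2"
    and locations: "\<And>t. homogeneous_ppp \<Omega> (tier_density lam_M lam_P lam_E t) (X t)"
    and gains_measurable: "\<And>l. h l \<in> borel_measurable \<Omega>"
    and gains: "\<And>l. distr \<Omega> borel (h l) = gain_law N S l"
    and independence:
      "indep_sets (case_sum
         (\<lambda>t. sets (vimage_algebra (space \<Omega>) (\<lambda>\<omega> i. X t i \<omega>) (Pi\<^sub>M UNIV (\<lambda>_. borel))))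
         (\<lambda>l. sets (vimage_algebra (space \<Omega>) (h l) borel))) UNIV"
begin

definition loss_M :: "real \<Rightarrow> real" where
  "loss_M r = \<beta> * r powr (- \<alpha>\<^sub>1)"

definition loss_P :: "real \<Rightarrow> real" where
  "loss_P r = \<beta> * r powr (- \<alpha>\<^sub>2)"

definition mean_power_M :: "nat \<Rightarrow> 'a \<Rightarrow> real" where
  "mean_power_M i \<omega> = real (N - S + 1) * (P_M / real S) * loss_M (norm (X MBS i \<omega>))"

definition mean_power_P :: "nat \<Rightarrow> 'a \<Rightarrow> real" where
  "mean_power_P j \<omega> = P_P * loss_P (norm (X PBS j \<omega>))"

text \<open>The event that the typical user, located at the origin, is associated with an MBS.\<close>

definition mbs_association :: "'a set" where
  "mbs_association = {\<omega> \<in> space \<Omega>. \<exists>i. (\<forall>l. mean_power_M l \<omega> \<le> mean_power_M i \<omega>)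
                                     \<and> (\<forall>j. mean_power_P j \<omega> \<le> mean_power_M i \<omega>)}"

definition cond_space :: "'a measure" where
  "cond_space = uniform_measure \<Omega> mbs_association"

text \<open>The maximiser is almost surely unique; \<open>LEAST\<close> merely picks it measurably.\<close>

definition serving :: "'a \<Rightarrow> nat" where
  "serving \<omega> = (LEAST i. \<forall>l. mean_power_M l \<omega> \<le> mean_power_M i \<omega>)"

definition user_interference :: "'a \<Rightarrow> real" where
  "user_interference \<omega> =
     (\<Sum>l. if l = serving \<omega> then 0
          else P_M / real S * h (User_MBS l) \<omega> * loss_M (norm (X MBS l \<omega>)))
     + (\<Sum>j. P_P * h (User_PBS j) \<omega> * loss_P (norm (X PBS j \<omega>)))"

definition SINR_M :: "'a \<Rightarrow> real" where
  "SINR_M \<omega> = P_M / real S * h User_serving \<omega> * loss_M (norm (X MBS (serving \<omega>) \<omega>))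
                / (user_interference \<omega> + \<delta>\<^sup>2)"

definition ergodic_rate :: real where
  "ergodic_rate = (\<integral>\<omega>. log 2 (1 + SINR_M \<omega>) \<partial>cond_space)"

definition R_M :: real where
  "R_M = log 2 (1 + inverse (\<integral>\<omega>. inverse (SINR_M \<omega>) \<partial>cond_space))"

definition eve_loss :: "nat \<Rightarrow> 'a \<Rightarrow> real" where
  "eve_loss k \<omega> = loss_M (dist (X Eve k \<omega>) (X MBS (serving \<omega>) \<omega>))"

definition SINR_eve :: "nat \<Rightarrow> 'a \<Rightarrow> real" where
  "SINR_eve k \<omega> = P_M / real S * h (Eve_signal k) \<omega> * eve_loss k \<omega>
     / (P_M / real S * h (Eve_intra k) \<omega> * eve_loss k \<omega>
        + (\<Sum>l. P_M / real S * h (Eve_MBS k l) \<omega> * loss_M (dist (X Eve k \<omega>) (X (MBS_at k) l \<omega>)))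
        + (\<Sum>j. P_P * h (Eve_PBS k j) \<omega> * loss_P (dist (X Eve k \<omega>) (X (PBS_at k) j \<omega>)))
        + \<delta>\<^sup>2)"

text \<open>The supremum is almost surely a maximum.\<close>

definition SINR_max :: "'a \<Rightarrow> real" where
  "SINR_max \<omega> = (SUP k. SINR_eve k \<omega>)"

end

end

(*
  Given the position of the serving station, the eavesdroppers form an independent Poisson process
  with independent, identically distributed marks, so the probability that no SINR exceeds gamma is
  the generating functional of that process at the conditional distribution function of a single
  SINR. As the desired signal of an eavesdropper is exponential, the complement of this distribution
  function is a product of Laplace transforms: of the noise, of a Gamma variable (intra-cell
  interference), and of two Poisson shot-noise fields. The latter are again generating functionals,
  evaluated by polar coordinates and the Beta integral. The resulting distribution function vanishes
  at 0 and is continuous from the left, so the events Z >= gamma and Z > gamma have equal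
  probability; finally R_M is at most the ergodic rate by Jensen's inequality for ln (1 + 1/y),
  whose integrability rests on the void probabilities of small discs.
*)

theory Submission
  imports Defs "HOL-Real_Asymp.Real_Asymp"
begin

section \<open>Radial integrals in the plane\<close>

lemma nn_integral_powr_exp:
  fixes p t :: real
  assumes "p > 0" "t > 0"
  shows "(\<integral>\<^sup>+u\<in>{0..}. ennreal (u powr (p - 1) * exp (- (t * u))) \<partial>lborel)
           = ennreal (Gamma p * t powr (- p))"
proof -
  have "ennreal (Gamma p) = (\<integral>\<^sup>+u. ennreal (indicator {0..} u * u powr (p - 1) / exp u) \<partial>lborel)"
    using assms by (simp add: Gamma_conv_nn_integral_real)
  also have "\<dots> = ennreal t * (\<integral>\<^sup>+u. ennreal (indicator {0..} (t * u) * (t * u) powr (p - 1) / exp (t * u)) \<partial>lborel)"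
    using assms by (subst nn_integral_real_affine[where c = t and t = 0]) auto
  also have "(\<integral>\<^sup>+u. ennreal (indicator {0..} (t * u) * (t * u) powr (p - 1) / exp (t * u)) \<partial>lborel)
     = (\<integral>\<^sup>+u. ennreal (t powr (p - 1)) * (ennreal (u powr (p - 1) * exp (- (t * u))) * indicator {0..} u) \<partial>lborel)"
    using assms
    by (intro nn_integral_cong)
       (auto simp: indicator_def powr_mult exp_minus field_simps zero_le_mult_iff simp flip: ennreal_mult)
  also have "\<dots> = ennreal (t powr (p - 1)) * (\<integral>\<^sup>+u\<in>{0..}. ennreal (u powr (p - 1) * exp (- (t * u))) \<partial>lborel)"
    by (rule nn_integral_cmult) simp
  finally have *: "ennreal (Gamma p) = ennreal t * (ennreal (t powr (p - 1)) *
      (\<integral>\<^sup>+u\<in>{0..}. ennreal (u powr (p - 1) * exp (- (t * u))) \<partial>lborel))" .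
  have "ennreal (Gamma p * t powr (- p)) = ennreal (t powr (- p)) * ennreal (Gamma p)"
    using assms Gamma_real_pos[of p] by (simp add: ennreal_mult' mult_ac)
  also have "\<dots> = ennreal (t powr (- p) * t * t powr (p - 1)) * (\<integral>\<^sup>+u\<in>{0..}. ennreal (u powr (p - 1) * exp (- (t * u))) \<partial>lborel)"
    unfolding * using assms by (simp add: ennreal_mult' mult_ac)
  also have "t powr (- p) * t * t powr (p - 1) = 1"
    using assms by (simp add: powr_minus powr_diff field_simps)
  finally show ?thesis by simp
qed

lemma nn_integral_powr_div_powr:
  fixes q s c :: real
  assumes "0 < q" "q < s" "0 < c"
  shows "(\<integral>\<^sup>+w\<in>{0..}. ennreal (w powr (q - 1) * (w + c) powr (- s)) \<partial>lborel)
           = ennreal (Gamma q * Gamma (s - q) / Gamma s * c powr (q - s))"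
proof -
  have Gs: "Gamma s > 0" "Gamma q > 0" "Gamma (s - q) > 0" using assms Gamma_real_pos by auto
  \<comment> \<open>Write \<open>(w + c)\<^sup>-\<^sup>s\<close> as a Gamma integral and exchange the order of integration.\<close>
  have inner: "ennreal (w powr (q - 1) * (w + c) powr (- s)) * indicator {0..} w
      = ennreal (1 / Gamma s) *
        (\<integral>\<^sup>+t. ennreal (w powr (q - 1) * (t powr (s - 1) * exp (- ((w + c) * t)))) * indicator {0..} t * indicator {0..} w \<partial>lborel)"
    for w :: real
  proof (cases "w \<ge> 0")
    case True
    have "(\<integral>\<^sup>+t. ennreal (w powr (q - 1) * (t powr (s - 1) * exp (- ((w + c) * t)))) * indicator {0..} t * indicator {0..} w \<partial>lborel)
        = (\<integral>\<^sup>+t. ennreal (w powr (q - 1)) * (ennreal (t powr (s - 1) * exp (- ((w + c) * t))) * indicator {0..} t) \<partial>lborel)"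
      using True by (intro nn_integral_cong) (auto simp: ennreal_mult' indicator_def)
    also have "\<dots> = ennreal (w powr (q - 1)) * ennreal (Gamma s * (w + c) powr (- s))"
      using True assms by (subst nn_integral_cmult) (auto simp: nn_integral_powr_exp)
    finally show ?thesis
      using True Gs by (simp flip: ennreal_mult)
  qed simp
  have "(\<integral>\<^sup>+w\<in>{0..}. ennreal (w powr (q - 1) * (w + c) powr (- s)) \<partial>lborel)
      = ennreal (1 / Gamma s) * (\<integral>\<^sup>+w. \<integral>\<^sup>+t. ennreal (w powr (q - 1) * (t powr (s - 1) * exp (- ((w + c) * t)))) * indicator {0..} t * indicator {0..} w \<partial>lborel \<partial>lborel)"
    unfolding inner by (rule nn_integral_cmult) simp
  also have "(\<integral>\<^sup>+w. \<integral>\<^sup>+t. ennreal (w powr (q - 1) * (t powr (s - 1) * exp (- ((w + c) * t)))) * indicator {0..} t * indicator {0..} w \<partial>lborel \<partial>lborel)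
    = (\<integral>\<^sup>+t. \<integral>\<^sup>+w. ennreal (w powr (q - 1) * (t powr (s - 1) * exp (- ((w + c) * t)))) * indicator {0..} t * indicator {0..} w \<partial>lborel \<partial>lborel)"
    by (rule lborel_pair.Fubini') measurable
  also have "\<dots> = (\<integral>\<^sup>+t. ennreal (Gamma q) * (ennreal (t powr ((s - q) - 1) * exp (- (c * t))) * indicator {0..} t) \<partial>lborel)"
  proof (rule nn_integral_cong_AE)
    show "AE t in lborel. (\<integral>\<^sup>+w. ennreal (w powr (q - 1) * (t powr (s - 1) * exp (- ((w + c) * t)))) * indicator {0..} t * indicator {0..} w \<partial>lborel)
        = ennreal (Gamma q) * (ennreal (t powr ((s - q) - 1) * exp (- (c * t))) * indicator {0..} t)"
      using AE_lborel_singleton[of "0 :: real"]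
    proof eventually_elim
      case (elim t)
      then consider "t < 0" | "t > 0" by linarith
      then show ?case
      proof cases
        case 2
        have "(\<integral>\<^sup>+w. ennreal (w powr (q - 1) * (t powr (s - 1) * exp (- ((w + c) * t)))) * indicator {0..} t * indicator {0..} w \<partial>lborel)
          = (\<integral>\<^sup>+w. ennreal (t powr (s - 1) * exp (- (c * t))) * (ennreal (w powr (q - 1) * exp (- (t * w))) * indicator {0..} w) \<partial>lborel)"
        proof (intro nn_integral_cong)
          fix w :: real
          have "exp (- ((w + c) * t)) = exp (- (c * t)) * exp (- (t * w))"
            by (simp add: algebra_simps flip: exp_add)
          then show "ennreal (w powr (q - 1) * (t powr (s - 1) * exp (- ((w + c) * t)))) * indicator {0..} t * indicator {0..} w
            = ennreal (t powr (s - 1) * exp (- (c * t))) * (ennreal (w powr (q - 1) * exp (- (t * w))) * indicator {0..} w)"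
            using 2 by (simp add: indicator_def mult_ac flip: ennreal_mult)
        qed
        also have "\<dots> = ennreal (t powr (s - 1) * exp (- (c * t))) * ennreal (Gamma q * t powr (- q))"
          using 2 assms by (subst nn_integral_cmult) (auto simp: nn_integral_powr_exp)
        also have "\<dots> = ennreal (Gamma q) * ennreal (t powr ((s - q) - 1) * exp (- (c * t)))"
          using 2 Gs by (simp add: mult_ac algebra_simps flip: ennreal_mult powr_add)
        finally show ?thesis using 2 by simp
      qed simp
    qed
  qed
  also have "\<dots> = ennreal (Gamma q) * ennreal (Gamma (s - q) * c powr (- (s - q)))"
    using assms by (subst nn_integral_cmult) (auto simp: nn_integral_powr_exp)
  finally show ?thesis
    using Gs by (simp add: mult_ac flip: ennreal_mult)
qed

lemma nn_integral_norm_powr_plane: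
  fixes G :: "real \<Rightarrow> ennreal" and a :: real
  assumes a: "a > 0" and [measurable]: "G \<in> borel_measurable borel"
  shows "(\<integral>\<^sup>+y. G (norm (y :: real^2) powr a) \<partial>lborel)
           = (\<integral>\<^sup>+w\<in>{0..}. G w * ennreal (2 * pi / a * w powr (2 / a - 1)) \<partial>lborel)"
proof -
  define D where "D = density lborel (\<lambda>w. ennreal (2 * pi / a * w powr (2 / a - 1)) * indicator {0..} w)"
  have "distr lborel borel (\<lambda>y :: real^2. norm y powr a) = D"
  proof (rule measure_eqI_generator_eq[where E = "range (\<lambda>t. {..t})" and \<Omega> = UNIV and A = "\<lambda>i. {..real i}"])
    fix Y :: "real set" assume "Y \<in> range (\<lambda>t. {..t})"
    then obtain t where Y: "Y = {..t}" by auto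
    show "emeasure (distr lborel borel (\<lambda>y :: real^2. norm y powr a)) Y = emeasure D Y"
    proof (cases "t \<ge> 0")
      case True
      have *: "(norm y powr a \<le> t) = (norm y \<le> t powr (1 / a))" for y :: "real^2"
      proof
        assume "norm y powr a \<le> t"
        then have "(norm y powr a) powr (1 / a) \<le> t powr (1 / a)"
          using a by (intro powr_mono2) auto
        then show "norm y \<le> t powr (1 / a)" using a by (simp add: powr_powr)
      next
        assume "norm y \<le> t powr (1 / a)"
        then have "norm y powr a \<le> (t powr (1 / a)) powr a"
          using a by (intro powr_mono2) auto
        then show "norm y powr a \<le> t" using a True by (simp add: powr_powr)
      qed
      have "emeasure (distr lborel borel (\<lambda>y :: real^2. norm y powr a)) Y
          = emeasure lborel (cball (0 :: real^2) (t powr (1 / a)))"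
        unfolding Y by (subst emeasure_distr) (auto intro!: arg_cong[where f = "emeasure lborel"] simp: *)
      also have "\<dots> = ennreal (pi * t powr (2 / a))"
        by (subst emeasure_cball)
           (simp_all add: eval_unit_ball_vol powr_powr power2_eq_square flip: powr_add powr_realpow)
      finally have L: "emeasure (distr lborel borel (\<lambda>y :: real^2. norm y powr a)) Y = ennreal (pi * t powr (2 / a))" .
      have "((\<lambda>w. 2 * pi / a * w powr (2 / a - 1)) has_integral (2 * pi / a * (t powr (2 / a - 1 + 1) / (2 / a - 1 + 1)))) {0..t}"
        using a True by (intro has_integral_mult_right has_integral_powr_from_0) auto
      then have "(\<integral>\<^sup>+w. ennreal (2 * pi / a * w powr (2 / a - 1)) * indicator {0..t} w \<partial>lborel) = ennreal (pi * t powr (2 / a))"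
        using a by (subst nn_integral_has_integral_lebesgue') (auto simp: field_simps)
      moreover have "emeasure D Y = (\<integral>\<^sup>+w. ennreal (2 * pi / a * w powr (2 / a - 1)) * indicator {0..t} w \<partial>lborel)"
        unfolding D_def Y by (subst emeasure_density) (auto intro!: nn_integral_cong simp: indicator_def)
      ultimately show ?thesis using L by simp
    next
      case False
      then have "{y :: real^2. norm y powr a \<le> t} = {}"
        by (auto simp: not_le intro: less_le_trans[OF _ powr_ge_zero])
      then have L: "emeasure (distr lborel borel (\<lambda>y :: real^2. norm y powr a)) Y = emeasure lborel ({} :: (real^2) set)"
        unfolding Y
        by (subst emeasure_distr) (auto intro!: arg_cong[where f = "emeasure lborel"] simp: vimage_def)
      have "emeasure D Y = (\<integral>\<^sup>+w. ennreal (2 * pi / a * w powr (2 / a - 1)) * indicator {0..} w * indicator Y w \<partial>lborel)"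
        unfolding D_def Y by (rule emeasure_density) auto
      also have "\<dots> = (\<integral>\<^sup>+(w::real). 0 \<partial>lborel)"
        unfolding Y using False by (intro nn_integral_cong) (auto split: split_indicator)
      finally have "emeasure D Y = 0" by simp
      with L show ?thesis by simp
    qed
  next
    fix i :: nat
    have *: "{y :: real^2. norm y powr a \<le> real i} \<subseteq> cball 0 (real i powr (1 / a))"
    proof
      fix y :: "real^2" assume "y \<in> {y. norm y powr a \<le> real i}"
      then have "(norm y powr a) powr (1 / a) \<le> real i powr (1 / a)"
        using a by (intro powr_mono2) auto
      then show "y \<in> cball 0 (real i powr (1 / a))" using a by (simp add: powr_powr)
    qed
    have "emeasure (distr lborel borel (\<lambda>y :: real^2. norm y powr a)) {..real i}
       \<le> emeasure lborel (cball (0 :: real^2) (real i powr (1 / a)))"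
      using * by (subst emeasure_distr) (auto intro!: emeasure_mono simp: vimage_def)
    also have "\<dots> < \<infinity>" by (subst emeasure_cball) auto
    finally show "emeasure (distr lborel borel (\<lambda>y :: real^2. norm y powr a)) {..real i} \<noteq> \<infinity>" by simp
  next
    show "(\<Union>i. {..real i}) = UNIV"
      using real_arch_simple by auto
  qed (auto simp: Int_stable_def D_def borel_eq_atMost)
  then have "(\<integral>\<^sup>+w. G w \<partial>D) = (\<integral>\<^sup>+w. G w \<partial>distr lborel borel (\<lambda>y :: real^2. norm y powr a))"
    by simp
  also have "\<dots> = (\<integral>\<^sup>+y. G (norm (y :: real^2) powr a) \<partial>lborel)"
    by (subst nn_integral_distr) auto
  finally show ?thesis
    unfolding D_def by (subst (asm) nn_integral_density) (auto simp: mult_ac)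
qed

lemma one_minus_inverse_power_expand:
  fixes w c :: real
  assumes "0 < w" "0 < c"
  shows "1 - inverse ((1 + c / w) ^ n)
           = (\<Sum>k=1..n. real (n choose k) * c ^ k * w ^ (n - k) / (w + c) ^ n)"
proof -
  have "(c + w) ^ n = (\<Sum>k\<le>n. real (n choose k) * c ^ k * w ^ (n - k))"
    by (rule binomial_ring)
  also have "{..n} = insert 0 {1..n}" by auto
  finally have "(w + c) ^ n - w ^ n = (\<Sum>k=1..n. real (n choose k) * c ^ k * w ^ (n - k))"
    by (simp add: add.commute)
  moreover have "1 - inverse ((1 + c / w) ^ n) = ((w + c) ^ n - w ^ n) / (w + c) ^ n"
  proof -
    have "1 + c / w = (w + c) / w" using assms by (simp add: field_simps)
    then show ?thesis using assms by (simp add: power_divide diff_divide_distrib)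
  qed
  ultimately show ?thesis by (simp add: sum_divide_distrib)
qed

text \<open>
  Up to the density, minus the logarithm of the Laplace transform of the interference of a Poisson
  process with path loss exponent \<open>\<alpha>\<close> and gains of law \<open>\<Gamma>(n, 1)\<close>.
\<close>

definition ppp_laplace_exponent :: "nat \<Rightarrow> real \<Rightarrow> real \<Rightarrow> real" where
  "ppp_laplace_exponent n \<alpha> c = 2 * pi * (\<Sum>k=1..n. real (n choose k) *
     (c powr (2 / \<alpha>) * Gamma (real k - 2 / \<alpha>) * Gamma (- real k + 2 / \<alpha> + real n) / (\<alpha> * Gamma (real n))))"

lemma nn_integral_plane_gamma_laplace:
  fixes \<alpha> c :: real
  assumes \<alpha>: "\<alpha> > 2" and c: "c \<ge> 0" and n: "n \<ge> 1"
  shows "(\<integral>\<^sup>+y. ennreal (1 - inverse ((1 + c * norm (y :: real^2) powr (- \<alpha>)) ^ n)) \<partial>lborel)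
           = ennreal (ppp_laplace_exponent n \<alpha> c)"
proof (cases "c = 0")
  case True
  then show ?thesis by (simp add: ppp_laplace_exponent_def)
next
  case False
  then have c: "c > 0" using c by simp
  \<comment> \<open>In the variable \<open>w = \<parallel>y\<parallel>\<^sup>\<alpha>\<close>, the binomial theorem leaves a sum of Beta integrals.\<close>
  have \<alpha>1: "2 / \<alpha> < 1" "2 / \<alpha> > 0" using \<alpha> by auto
  define d where "d k w = real (n choose k) * c ^ k * w ^ (n - k) / (w + c) ^ n" for k and w :: real
  define C where "C k = real (n choose k) * c ^ k * (2 * pi / \<alpha>)" for k
  have C0: "C k \<ge> 0" for k using c \<alpha> by (simp add: C_def)
  have "(\<integral>\<^sup>+y. ennreal (1 - inverse ((1 + c * norm (y :: real^2) powr (- \<alpha>)) ^ n)) \<partial>lborel)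
      = (\<integral>\<^sup>+w\<in>{0..}. ennreal (1 - inverse ((1 + c / w) ^ n)) * ennreal (2 * pi / \<alpha> * w powr (2 / \<alpha> - 1)) \<partial>lborel)"
    using \<alpha> by (subst nn_integral_norm_powr_plane[symmetric]) (auto simp: powr_minus divide_inverse)
  also have "\<dots> = (\<integral>\<^sup>+w. (\<Sum>k=1..n. ennreal (C k) * (ennreal (w powr ((real n - real k + 2 / \<alpha>) - 1) * (w + c) powr (- real n)) * indicator {0..} w)) \<partial>lborel)"
  proof (rule nn_integral_cong_AE)
    show "AE w in lborel. ennreal (1 - inverse ((1 + c / w) ^ n)) * ennreal (2 * pi / \<alpha> * w powr (2 / \<alpha> - 1)) * indicator {0..} w
        = (\<Sum>k=1..n. ennreal (C k) * (ennreal (w powr ((real n - real k + 2 / \<alpha>) - 1) * (w + c) powr (- real n)) * indicator {0..} w))"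
      using AE_lborel_singleton[of "0 :: real"]
    proof eventually_elim
      case (elim w)
      then consider "w < 0" | "w > 0" by linarith
      then show ?case
      proof cases
        case 2
        have "ennreal (1 - inverse ((1 + c / w) ^ n)) * ennreal (2 * pi / \<alpha> * w powr (2 / \<alpha> - 1))
           = ennreal ((1 - inverse ((1 + c / w) ^ n)) * (2 * pi / \<alpha> * w powr (2 / \<alpha> - 1)))"
          using 2 \<alpha> by (intro ennreal_mult''[symmetric]) auto
        also have "(1 - inverse ((1 + c / w) ^ n)) * (2 * pi / \<alpha> * w powr (2 / \<alpha> - 1)) =
            (\<Sum>k=1..n. C k * (w powr ((real n - real k + 2 / \<alpha>) - 1) * (w + c) powr (- real n)))"
          unfolding one_minus_inverse_power_expand[OF 2 c] sum_distrib_right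
        proof (intro sum.cong refl)
          fix k assume k: "k \<in> {1..n}"
          have "w powr ((real n - real k + 2 / \<alpha>) - 1) = w powr (real (n - k) + (2 / \<alpha> - 1))"
            using k by (simp add: of_nat_diff algebra_simps)
          also have "\<dots> = w ^ (n - k) * w powr (2 / \<alpha> - 1)"
            using 2 by (simp add: powr_add powr_realpow)
          finally have e: "w powr ((real n - real k + 2 / \<alpha>) - 1) = w ^ (n - k) * w powr (2 / \<alpha> - 1)" .
          have "(w + c) powr (- real n) = inverse ((w + c) ^ n)"
            using 2 c by (simp add: powr_minus powr_realpow)
          then show "real (n choose k) * c ^ k * w ^ (n - k) / (w + c) ^ n * (2 * pi / \<alpha> * w powr (2 / \<alpha> - 1))
             = C k * (w powr ((real n - real k + 2 / \<alpha>) - 1) * (w + c) powr (- real n))"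
            unfolding e C_def by (simp add: divide_inverse mult_ac)
        qed
        finally show ?thesis
          using 2 C0 by (simp add: ennreal_mult flip: sum_ennreal)
      qed simp
    qed
  qed
  also have "\<dots> = (\<Sum>k=1..n. ennreal (C k) * ennreal (Gamma (real n - real k + 2 / \<alpha>) * Gamma (real k - 2 / \<alpha>) / Gamma (real n) * c powr (2 / \<alpha> - real k)))"
    (is "_ = (\<Sum>k=1..n. ?t k)")
  proof (subst nn_integral_sum, simp, intro sum.cong refl)
    fix k assume k: "k \<in> {1..n}"
    then have k1: "real k \<le> real n" "1 \<le> real k" by (auto simp del: of_nat_le_iff simp: of_nat_mono)
    have "(\<integral>\<^sup>+w. ennreal (C k) * (ennreal (w powr ((real n - real k + 2 / \<alpha>) - 1) * (w + c) powr (- real n)) * indicator {0..} w) \<partial>lborel)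
       = ennreal (C k) * ennreal (Gamma (real n - real k + 2 / \<alpha>) * Gamma (real n - (real n - real k + 2 / \<alpha>)) / Gamma (real n) * c powr ((real n - real k + 2 / \<alpha>) - real n))"
    proof (subst nn_integral_cmult)
      have "0 < real n - real k + 2 / \<alpha>" "real n - real k + 2 / \<alpha> < real n"
        using k1 \<alpha>1 by linarith+
      then show "ennreal (C k) * (\<integral>\<^sup>+w\<in>{0..}. ennreal (w powr ((real n - real k + 2 / \<alpha>) - 1) * (w + c) powr (- real n)) \<partial>lborel) = ennreal (C k) * ennreal (Gamma (real n - real k + 2 / \<alpha>) * Gamma (real n - (real n - real k + 2 / \<alpha>)) / Gamma (real n) * c powr ((real n - real k + 2 / \<alpha>) - real n))"
        using c by (subst nn_integral_powr_div_powr) auto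
    qed simp
    then show "(\<integral>\<^sup>+w. ennreal (C k) * (ennreal (w powr ((real n - real k + 2 / \<alpha>) - 1) * (w + c) powr (- real n)) * indicator {0..} w) \<partial>lborel) = ?t k"
      by (simp add: algebra_simps)
  qed
  also have "\<dots> = ennreal (\<Sum>k=1..n. 2 * pi * (real (n choose k) *
     (c powr (2 / \<alpha>) * Gamma (real k - 2 / \<alpha>) * Gamma (- real k + 2 / \<alpha> + real n) / (\<alpha> * Gamma (real n)))))"
  proof (subst sum_ennreal[symmetric])
    have G: "Gamma (real n) > 0" using n by (intro Gamma_real_pos) auto
    { fix k assume k: "k \<in> {1..n}"
      then have k1: "real k \<le> real n" "1 \<le> real k" by (auto simp del: of_nat_le_iff simp: of_nat_mono)
      have "Gamma (real k - 2 / \<alpha>) > 0" "Gamma (- real k + 2 / \<alpha> + real n) > 0"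
        using k1 \<alpha>1 by (intro Gamma_real_pos; linarith)+
      note k1 this }
    note kk = this
    show "0 \<le> 2 * pi * (real (n choose k) * (c powr (2 / \<alpha>) * Gamma (real k - 2 / \<alpha>) * Gamma (- real k + 2 / \<alpha> + real n) / (\<alpha> * Gamma (real n))))"
      if "k \<in> {1..n}" for k using kk[OF that] G \<alpha> by (auto intro!: mult_nonneg_nonneg divide_nonneg_nonneg)
    show "(\<Sum>k=1..n. ?t k) = (\<Sum>k=1..n. ennreal (2 * pi * (real (n choose k) *
     (c powr (2 / \<alpha>) * Gamma (real k - 2 / \<alpha>) * Gamma (- real k + 2 / \<alpha> + real n) / (\<alpha> * Gamma (real n))))))"
    proof (intro sum.cong refl)
      fix k assume k: "k \<in> {1..n}"
      have "?t k = ennreal (C k * (Gamma (real n - real k + 2 / \<alpha>) * Gamma (real k - 2 / \<alpha>) / Gamma (real n) * c powr (2 / \<alpha> - real k)))"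
        using C0 by (intro ennreal_mult'[symmetric])
      also have "C k * (Gamma (real n - real k + 2 / \<alpha>) * Gamma (real k - 2 / \<alpha>) / Gamma (real n) * c powr (2 / \<alpha> - real k))
         = 2 * pi * (real (n choose k) * (c powr (2 / \<alpha>) * Gamma (real k - 2 / \<alpha>) * Gamma (- real k + 2 / \<alpha> + real n) / (\<alpha> * Gamma (real n))))"
      proof -
        have e: "c powr (2 / \<alpha> - real k) = c powr (2 / \<alpha>) / c ^ k" "- real k + 2 / \<alpha> + real n = real n - real k + 2 / \<alpha>"
          using c by (simp_all add: powr_diff powr_realpow)
        show ?thesis
          unfolding e using c \<alpha> G unfolding C_def by (simp add: field_simps)
      qed
      finally show "?t k = ennreal (2 * pi * (real (n choose k) *
          (c powr (2 / \<alpha>) * Gamma (real k - 2 / \<alpha>) * Gamma (- real k + 2 / \<alpha> + real n) / (\<alpha> * Gamma (real n)))))" .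
    qed
  qed
  finally show ?thesis by (simp add: ppp_laplace_exponent_def sum_distrib_left)
qed

lemma ppp_laplace_exponent_nonneg:
  assumes "\<alpha> > 2" "n \<ge> 1"
  shows "0 \<le> ppp_laplace_exponent n \<alpha> c"
  unfolding ppp_laplace_exponent_def
proof (intro mult_nonneg_nonneg sum_nonneg divide_nonneg_nonneg)
  fix k assume "k \<in> {1..n}"
  then have k: "real k \<le> real n" "1 \<le> real k" by (auto simp del: of_nat_le_iff simp: of_nat_mono)
  moreover have "2 / \<alpha> < 1" "2 / \<alpha> > 0" using assms by auto
  ultimately have "real k - 2 / \<alpha> > 0" "- real k + 2 / \<alpha> + real n > 0" by linarith+
  then show "0 \<le> Gamma (real k - 2 / \<alpha>)" "0 \<le> Gamma (- real k + 2 / \<alpha> + real n)"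
    using Gamma_real_pos less_imp_le by blast+
qed (use assms Gamma_real_pos[of "real n"] in auto)

lemma ppp_laplace_exponent_1:
  assumes "\<alpha> > 2"
  shows "ppp_laplace_exponent 1 \<alpha> c = 2 * pi\<^sup>2 / \<alpha> * c powr (2 / \<alpha>) * (1 / sin (2 * pi / \<alpha>))"
proof -
  have "complex_of_real (Gamma (2 / \<alpha>) * Gamma (1 - 2 / \<alpha>)) = of_real (pi / sin (pi * (2 / \<alpha>)))"
    using Gamma_reflection_complex[of "of_real (2 / \<alpha>)"]
    by (simp flip: Gamma_complex_of_real sin_of_real)
  then have "Gamma (1 - 2 / \<alpha>) * Gamma (2 / \<alpha>) = pi / sin (pi * (2 / \<alpha>))"
    unfolding of_real_eq_iff by (simp add: mult.commute)
  then have "ppp_laplace_exponent 1 \<alpha> c = 2 * pi * (c powr (2 / \<alpha>) * (pi / sin (pi * (2 / \<alpha>))) / \<alpha>)"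
    by (simp add: ppp_laplace_exponent_def mult.assoc)
  then show ?thesis by (simp add: power2_eq_square mult_ac)
qed

lemma ppp_laplace_exponent_scale:
  "ppp_laplace_exponent n \<alpha> c = c powr (2 / \<alpha>) * ppp_laplace_exponent n \<alpha> 1"
  by (simp add: ppp_laplace_exponent_def sum_distrib_left mult_ac)

lemma ppp_laplace_exponent_tendsto_0:
  assumes "\<alpha> > 0" "c \<ge> 0"
  shows "(\<lambda>n. ppp_laplace_exponent m \<alpha> (c / real (Suc n))) \<longlonglongrightarrow> 0"
proof -
  have "(\<lambda>n. c / real (Suc n)) \<longlonglongrightarrow> 0" by real_asymp
  then have "(\<lambda>n. (c / real (Suc n)) powr (2 / \<alpha>)) \<longlonglongrightarrow> 0"
    using assms by (intro tendsto_zero_powrI[where b = "2 / \<alpha>"]) auto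
  then show ?thesis
    unfolding ppp_laplace_exponent_scale[of m \<alpha> "c / _"] by (rule tendsto_mult_left_zero)
qed

section \<open>The generating functional of a Poisson process\<close>

lemma exp_neg_nonneg [simp]: "0 \<le> exp_neg t"
  by (simp add: exp_neg_def)

lemma exp_neg_le_1 [simp]: "exp_neg t \<le> 1"
  by (simp add: exp_neg_def)

lemma exp_neg_ennreal [simp]: "0 \<le> x \<Longrightarrow> exp_neg (ennreal x) = exp (- x)"
  by (simp add: exp_neg_def)

lemma exp_neg_antimono: "s \<le> t \<Longrightarrow> exp_neg t \<le> exp_neg s"
  by (auto simp: exp_neg_def enn2real_mono less_top top_unique)

lemma tendsto_exp_neg:
  assumes "(a \<longlongrightarrow> L) F"
  shows "((\<lambda>i. exp_neg (a i)) \<longlongrightarrow> exp_neg L) F"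
proof (cases "L = \<infinity>")
  case False
  then have L: "L < top" by (simp add: less_top)
  have ev: "eventually (\<lambda>i. a i < top) F"
    using assms L by (rule order_tendstoD)
  have "((\<lambda>i. exp (- enn2real (a i))) \<longlongrightarrow> exp (- enn2real L)) F"
    using assms L by (intro tendsto_intros) (auto intro: tendsto_enn2real)
  then show ?thesis
    using False ev by (simp add: exp_neg_def) (erule Lim_transform_eventually, auto elim: eventually_mono)
next
  case True
  show ?thesis
  proof (rule tendstoI)
    fix e :: real assume e: "e > 0"
    define K where "K = max 0 (- ln e) + 1"
    have "eventually (\<lambda>i. a i > ennreal K) F"
      using assms True by (intro order_tendstoD(1)[OF assms]) auto
    then show "eventually (\<lambda>i. dist (exp_neg (a i)) (exp_neg L) < e) F"
    proof eventually_elim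
      case (elim i)
      show ?case
      proof (cases "a i = \<infinity>")
        case True
        then show ?thesis using \<open>L = \<infinity>\<close> e by (simp add: exp_neg_def)
      next
        case False
        then have "K < enn2real (a i)"
          using elim by (cases "a i") (auto simp: K_def ennreal_less_iff simp del: ennreal_plus)
        then have "exp (- enn2real (a i)) < exp (ln e)"
          by (simp add: K_def)
        then show ?thesis using e False True by (simp add: exp_neg_def dist_real_def)
      qed
    qed
  qed
qed

context prob_space begin

lemma expectation_power_poisson:
  fixes Y :: "'a \<Rightarrow> nat" and \<mu> z :: real
  assumes [measurable]: "Y \<in> measurable M (count_space UNIV)"
    and Y: "\<And>n. prob {\<omega> \<in> space M. Y \<omega> = n} = \<mu> ^ n / fact n * exp (- \<mu>)"
    and "0 \<le> \<mu>" "0 \<le> z" "z \<le> 1"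
  shows "expectation (\<lambda>\<omega>. z ^ Y \<omega>) = exp (- (\<mu> * (1 - z)))"
proof -
  have "(\<integral>\<^sup>+\<omega>. ennreal (z ^ Y \<omega>) \<partial>M) = (\<integral>\<^sup>+\<omega>. (\<Sum>n. ennreal (z ^ n) * indicator {\<omega> \<in> space M. Y \<omega> = n} \<omega>) \<partial>M)"
  proof (intro nn_integral_cong)
    fix \<omega> assume \<omega>: "\<omega> \<in> space M"
    have "(\<lambda>n. ennreal (z ^ n) * indicator {\<omega> \<in> space M. Y \<omega> = n} \<omega>) sums
        (\<Sum>n\<in>{Y \<omega>}. ennreal (z ^ n) * indicator {\<omega> \<in> space M. Y \<omega> = n} \<omega>)"
      by (intro sums_finite) auto
    then show "ennreal (z ^ Y \<omega>) = (\<Sum>n. ennreal (z ^ n) * indicator {\<omega> \<in> space M. Y \<omega> = n} \<omega>)"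
      using \<omega> by (auto simp: sums_iff)
  qed
  also have "\<dots> = (\<Sum>n. ennreal (z ^ n) * emeasure M {\<omega> \<in> space M. Y \<omega> = n})"
    by (subst nn_integral_suminf) (auto simp: nn_integral_cmult)
  also have "\<dots> = (\<Sum>n. ennreal ((\<mu> * z) ^ n / fact n * exp (- \<mu>)))"
    using assms by (intro suminf_cong) (auto simp: emeasure_eq_measure Y power_mult_distrib field_simps simp flip: ennreal_mult)
  also have "\<dots> = ennreal (\<Sum>n. (\<mu> * z) ^ n / fact n * exp (- \<mu>))"
    using assms summable_exp[of "\<mu> * z"]
    by (intro suminf_ennreal2 summable_mult2) (auto simp: divide_inverse mult_ac)
  also have "(\<Sum>n. (\<mu> * z) ^ n / fact n * exp (- \<mu>)) = exp (\<mu> * z) * exp (- \<mu>)"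
    using summable_exp[of "\<mu> * z"]
    by (subst suminf_mult2[symmetric]) (auto simp: exp_def divide_inverse mult_ac)
  also have "\<dots> = exp (- (\<mu> * (1 - z)))" by (simp add: algebra_simps flip: exp_add)
  finally show ?thesis
    using assms by (subst integral_eq_nn_integral) auto
qed

lemma ppp_pgf_partition:
  fixes X :: "nat \<Rightarrow> 'a \<Rightarrow> real^2" and J :: "nat set"
  assumes X: "homogeneous_ppp M lam X" and lam: "0 \<le> lam" and J: "finite J"
    and B: "disjoint_family_on B J" "\<And>j. j \<in> J \<Longrightarrow> B j \<in> sets borel" "\<And>j. j \<in> J \<Longrightarrow> bounded (B j)"
    and c: "\<And>j. j \<in> J \<Longrightarrow> 0 \<le> c j" "\<And>j. j \<in> J \<Longrightarrow> c j \<le> 1"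
  shows "(\<lambda>n. expectation (\<lambda>\<omega>. \<Prod>k<n. \<Prod>j\<in>J. 1 - c j * indicator (B j) (X k \<omega>)))
           \<longlonglongrightarrow> exp (- (lam * (\<Sum>j\<in>J. c j * measure lborel (B j))))"
proof -
  have [measurable]: "X i \<in> borel_measurable M" for i
    using X by (simp add: homogeneous_ppp_def)
  have [measurable]: "j \<in> J \<Longrightarrow> B j \<in> sets borel" for j by (rule B)
  have fin: "AE \<omega> in M. finite {i. X i \<omega> \<in> B j}" if "j \<in> J" for j
    using X B(2,3)[OF that] by (simp add: homogeneous_ppp_def)
  have pois: "prob {\<omega> \<in> space M. point_count X (B j) \<omega> = n}
      = (lam * measure lborel (B j)) ^ n / fact n * exp (- (lam * measure lborel (B j)))" if "j \<in> J" for j n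
    using X B(2,3)[OF that] by (simp add: homogeneous_ppp_def)
  have ind: "indep_vars (\<lambda>_. count_space UNIV) (\<lambda>j. point_count X (B j)) J"
    using X J B by (simp add: homogeneous_ppp_def)
  have rv: "point_count X (B j) \<in> measurable M (count_space UNIV)" if "j \<in> J" for j
    using ind that by (simp add: indep_vars_def)
  have "(\<lambda>n. expectation (\<lambda>\<omega>. \<Prod>k<n. \<Prod>j\<in>J. 1 - c j * indicator (B j) (X k \<omega>)))
           \<longlonglongrightarrow> expectation (\<lambda>\<omega>. \<Prod>j\<in>J. (1 - c j) ^ point_count X (B j) \<omega>)"
  proof (rule integral_dominated_convergence[where w = "\<lambda>_. 1"])
    show "(\<lambda>\<omega>. \<Prod>j\<in>J. (1 - c j) ^ point_count X (B j) \<omega>) \<in> borel_measurable M"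
      using rv by (intro borel_measurable_prod) (auto intro: measurable_compose)
    have "AE \<omega> in M. \<forall>j\<in>J. finite {i. X i \<omega> \<in> B j}"
      using J fin by (simp add: AE_finite_all)
    then show "AE \<omega> in M. (\<lambda>n. \<Prod>k<n. \<Prod>j\<in>J. 1 - c j * indicator (B j) (X k \<omega>))
        \<longlonglongrightarrow> (\<Prod>j\<in>J. (1 - c j) ^ point_count X (B j) \<omega>)"
    proof eventually_elim
      case (elim \<omega>)
      have "(\<lambda>n. \<Prod>j\<in>J. \<Prod>k<n. 1 - c j * indicator (B j) (X k \<omega>))
        \<longlonglongrightarrow> (\<Prod>j\<in>J. (1 - c j) ^ point_count X (B j) \<omega>)"
      proof (intro tendsto_prod)
        fix j assume "j \<in> J"
        then have f: "finite {i. X i \<omega> \<in> B j}" using elim by auto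
        then obtain m where m: "{i. X i \<omega> \<in> B j} \<subseteq> {..<m}"
          using finite_nat_iff_bounded by blast
        have "(\<Prod>k<n. 1 - c j * indicator (B j) (X k \<omega>)) = (1 - c j) ^ point_count X (B j) \<omega>" if "n \<ge> m" for n
        proof -
          have "(\<Prod>k<n. 1 - c j * indicator (B j) (X k \<omega>)) = (\<Prod>k\<in>{i. X i \<omega> \<in> B j}. 1 - c j * indicator (B j) (X k \<omega>))"
            using m that by (intro prod.mono_neutral_right) auto
          also have "\<dots> = (\<Prod>k\<in>{i. X i \<omega> \<in> B j}. 1 - c j)"
            by (intro prod.cong) auto
          finally show ?thesis by (simp add: point_count_def)
        qed
        then show "(\<lambda>n. \<Prod>k<n. 1 - c j * indicator (B j) (X k \<omega>)) \<longlonglongrightarrow> (1 - c j) ^ point_count X (B j) \<omega>"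
          by (intro tendsto_eventually eventually_sequentiallyI)
      qed
      then show ?case by (subst prod.swap)
    qed
    show "AE \<omega> in M. norm (\<Prod>k<n. \<Prod>j\<in>J. 1 - c j * indicator (B j) (X k \<omega>)) \<le> 1" for n
      using c by (intro AE_I2) (auto simp: abs_prod intro!: prod_le_1 prod_nonneg split: split_indicator)
  qed (auto simp: borel_measurable_prod)
  also have "expectation (\<lambda>\<omega>. \<Prod>j\<in>J. (1 - c j) ^ point_count X (B j) \<omega>)
     = (\<Prod>j\<in>J. expectation (\<lambda>\<omega>. (1 - c j) ^ point_count X (B j) \<omega>))"
  proof (rule indep_vars_lebesgue_integral[OF J])
    have "indep_vars (\<lambda>_. borel) (\<lambda>j. (\<lambda>n. (1 - c j) ^ n) \<circ> point_count X (B j)) J"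
      using ind by (rule indep_vars_compose) auto
    then show "indep_vars (\<lambda>_. borel) (\<lambda>j \<omega>. (1 - c j) ^ point_count X (B j) \<omega>) J"
      by (simp add: comp_def)
    show "integrable M (\<lambda>\<omega>. (1 - c j) ^ point_count X (B j) \<omega>)" if "j \<in> J" for j
    proof (rule integrable_const_bound[where B = 1])
      show "AE \<omega> in M. norm ((1 - c j) ^ point_count X (B j) \<omega>) \<le> 1"
        using c[OF that] by (intro AE_I2) (auto simp: power_abs intro!: power_le_one)
      show "(\<lambda>\<omega>. (1 - c j) ^ point_count X (B j) \<omega>) \<in> borel_measurable M"
        using rv[OF that] by (auto intro: measurable_compose)
    qed
  qed
  also have "\<dots> = (\<Prod>j\<in>J. exp (- (lam * measure lborel (B j) * (1 - (1 - c j)))))"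
    using c lam rv by (intro prod.cong refl expectation_power_poisson pois) auto
  also have "\<dots> = exp (- (lam * (\<Sum>j\<in>J. c j * measure lborel (B j))))"
    using J by (simp add: mult_ac sum_distrib_left flip: exp_sum sum_negf)
  finally show ?thesis .
qed

lemma ppp_pgf_simple:
  fixes X :: "nat \<Rightarrow> 'a \<Rightarrow> real^2"
  assumes X: "homogeneous_ppp M lam X" and lam: "0 \<le> lam"
    and u[measurable]: "u \<in> borel_measurable borel" and fin: "finite (range u)"
    and b: "bounded {x. u x \<noteq> 0}" and u01: "\<And>x. 0 \<le> u x" "\<And>x. u x \<le> 1"
  shows "(\<lambda>n. \<integral>\<^sup>+\<omega>. (\<Prod>k<n. ennreal (1 - u (X k \<omega>))) \<partial>M)
           \<longlonglongrightarrow> ennreal (exp_neg (ennreal lam * (\<integral>\<^sup>+x. ennreal (u x) \<partial>lborel)))"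
proof -
  have [measurable]: "X i \<in> borel_measurable M" for i
    using X by (simp add: homogeneous_ppp_def)
  obtain e and m :: nat where e: "range u - {0} = e ` {..<m}" "inj_on e {..<m}"
    using finite_imp_nat_seg_image_inj_on[of "range u - {0}"] fin by (auto simp: lessThan_def)
  define B where "B j = u -` {e j}" for j
  have [measurable]: "B j \<in> sets borel" for j
    unfolding B_def using measurable_sets[OF u, of "{e j}"] by simp
  have ej: "e j \<in> range u - {0}" if "j < m" for j using e(1) that by auto
  have e01: "0 \<le> e j" "e j \<le> 1" if "j < m" for j
    using ej[OF that] u01 by auto
  have bB: "bounded (B j)" if "j < m" for j
    using ej[OF that] by (intro bounded_subset[OF b]) (auto simp: B_def)
  have disj: "disjoint_family_on B {..<m}"
    using e(2) by (auto simp: disjoint_family_on_def B_def inj_on_def)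
  have val: "\<exists>!j. j < m \<and> x \<in> B j" if "u x \<noteq> 0" for x
  proof -
    have "u x \<in> e ` {..<m}" using that e(1) by auto
    then show ?thesis using e(2) by (auto simp: B_def inj_on_def)
  qed
  have prod_eq: "(\<Prod>j<m. 1 - e j * indicator (B j) x) = 1 - u x"
    and sum_eq: "(\<Sum>j<m. e j * indicator (B j) x) = u x" for x
  proof -
    have "(\<Prod>j<m. 1 - e j * indicator (B j) x) = 1 - u x \<and> (\<Sum>j<m. e j * indicator (B j) x) = u x"
    proof (cases "u x = 0")
      case True
      then have "x \<notin> B j" if "j < m" for j using ej[OF that] by (auto simp: B_def)
      then show ?thesis using True by simp
    next
      case False
      then obtain i where i: "i < m" "x \<in> B i" "\<And>j. j < m \<Longrightarrow> x \<in> B j \<Longrightarrow> j = i"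
        using val[OF False] by blast
      have v: "e j * indicator (B j) x = (if j = i then u x else 0)" if "j < m" for j
      proof (cases "j = i")
        case True
        then show ?thesis using i(2) by (simp add: B_def)
      next
        case False
        then have "x \<notin> B j" using i(3)[OF that] by blast
        then show ?thesis using False by simp
      qed
      have "(\<Prod>j<m. 1 - e j * indicator (B j) x) = (\<Prod>j<m. if j = i then 1 - u x else 1)"
        using v by (intro prod.cong refl) auto
      moreover have "(\<Sum>j<m. e j * indicator (B j) x) = (\<Sum>j<m. if j = i then u x else 0)"
        using v by (intro sum.cong refl) auto
      ultimately show ?thesis using i(1) by simp
    qed
    then show "(\<Prod>j<m. 1 - e j * indicator (B j) x) = 1 - u x" "(\<Sum>j<m. e j * indicator (B j) x) = u x"
      by auto
  qed
  have "(\<lambda>n. expectation (\<lambda>\<omega>. \<Prod>k<n. \<Prod>j<m. 1 - e j * indicator (B j) (X k \<omega>)))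
           \<longlonglongrightarrow> exp (- (lam * (\<Sum>j<m. e j * measure lborel (B j))))"
    using X lam disj bB e01 by (intro ppp_pgf_partition) auto
  then have "(\<lambda>n. ennreal (expectation (\<lambda>\<omega>. \<Prod>k<n. 1 - u (X k \<omega>))))
           \<longlonglongrightarrow> ennreal (exp (- (lam * (\<Sum>j<m. e j * measure lborel (B j)))))"
    unfolding prod_eq by (rule tendsto_ennrealI)
  also have "(\<lambda>n. ennreal (expectation (\<lambda>\<omega>. \<Prod>k<n. 1 - u (X k \<omega>)))) = (\<lambda>n. \<integral>\<^sup>+\<omega>. (\<Prod>k<n. ennreal (1 - u (X k \<omega>))) \<partial>M)"
  proof
    fix n
    have "(\<integral>\<^sup>+\<omega>. ennreal (\<Prod>k<n. 1 - u (X k \<omega>)) \<partial>M) = ennreal (expectation (\<lambda>\<omega>. \<Prod>k<n. 1 - u (X k \<omega>)))"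
    proof (rule nn_integral_eq_integral)
      show "integrable M (\<lambda>\<omega>. \<Prod>k<n. 1 - u (X k \<omega>))"
        using u01 by (intro integrable_const_bound[where B = 1]) (auto simp: abs_prod intro!: prod_le_1)
    qed (use u01 in \<open>auto intro!: prod_nonneg\<close>)
    then show "ennreal (expectation (\<lambda>\<omega>. \<Prod>k<n. 1 - u (X k \<omega>))) = (\<integral>\<^sup>+\<omega>. (\<Prod>k<n. ennreal (1 - u (X k \<omega>))) \<partial>M)"
      using u01 by (simp add: prod_ennreal)
  qed
  also have "exp (- (lam * (\<Sum>j<m. e j * measure lborel (B j)))) = exp_neg (ennreal lam * (\<integral>\<^sup>+x. ennreal (u x) \<partial>lborel))"
  proof -
    have "(\<integral>\<^sup>+x. ennreal (u x) \<partial>lborel) = (\<integral>\<^sup>+x. (\<Sum>j<m. ennreal (e j) * indicator (B j) x) \<partial>lborel)"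
    proof (intro nn_integral_cong)
      fix x
      have "ennreal (u x) = ennreal (\<Sum>j<m. e j * indicator (B j) x)" by (simp add: sum_eq)
      also have "\<dots> = (\<Sum>j<m. ennreal (e j * indicator (B j) x))"
        using e01 by (subst sum_ennreal) auto
      also have "\<dots> = (\<Sum>j<m. ennreal (e j) * indicator (B j) x)"
        by (intro sum.cong refl) (auto split: split_indicator)
      finally show "ennreal (u x) = (\<Sum>j<m. ennreal (e j) * indicator (B j) x)" .
    qed
    also have "\<dots> = (\<Sum>j<m. ennreal (e j) * emeasure lborel (B j))"
      by (subst nn_integral_sum) (auto simp: nn_integral_cmult)
    also have "\<dots> = (\<Sum>j<m. ennreal (e j * measure lborel (B j)))"
    proof (intro sum.cong refl)
      fix j assume "j \<in> {..<m}"
      then have "emeasure lborel (B j) \<noteq> \<top>" "0 \<le> e j"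
        using emeasure_bounded_finite[OF bB, of j] e01[of j] by auto
      then show "ennreal (e j) * emeasure lborel (B j) = ennreal (e j * measure lborel (B j))"
        by (simp add: emeasure_eq_ennreal_measure ennreal_mult')
    qed
    also have "\<dots> = ennreal (\<Sum>j<m. e j * measure lborel (B j))"
      using e01 by (subst sum_ennreal) auto
    finally have "(\<integral>\<^sup>+x. ennreal (u x) \<partial>lborel) = ennreal (\<Sum>j<m. e j * measure lborel (B j))" .
    moreover have "(\<Sum>j<m. e j * measure lborel (B j)) \<ge> 0"
      using e01 by (intro sum_nonneg) auto
    ultimately show ?thesis using lam by (simp flip: ennreal_mult)
  qed
  finally show ?thesis .
qed

theorem ppp_pgf:
  fixes X :: "nat \<Rightarrow> 'a \<Rightarrow> real^2"
  assumes X: "homogeneous_ppp M lam X" and lam: "0 \<le> lam"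
    and f[measurable]: "f \<in> borel_measurable borel" and f01: "\<And>x. 0 \<le> f x" "\<And>x. f x \<le> 1"
  shows "(\<lambda>n. \<integral>\<^sup>+\<omega>. (\<Prod>k<n. ennreal (1 - f (X k \<omega>))) \<partial>M)
           \<longlonglongrightarrow> ennreal (exp_neg (ennreal lam * (\<integral>\<^sup>+x. ennreal (f x) \<partial>lborel)))"
proof -
  have [measurable]: "X i \<in> borel_measurable M" for i
    using X by (simp add: homogeneous_ppp_def)
  have "(\<lambda>x. ennreal (f x)) \<in> borel_measurable borel" by measurable
  from borel_measurable_implies_simple_function_sequence'[OF this]
  obtain U where U: "\<And>i. simple_function borel (U i)" "incseq U" "\<And>i x. U i x < top" "\<And>x. (SUP i. U i x) = ennreal (f x)"
    by blast
  define u where "u i x = enn2real (U i x) * indicator (cball 0 (real i)) x" for i and x :: "real^2"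
  have [measurable]: "U i \<in> borel_measurable borel" for i
    using U(1) by (rule borel_measurable_simple_function)
  have um[measurable]: "u i \<in> borel_measurable borel" for i
    unfolding u_def by (intro borel_measurable_times borel_measurable_enn2real borel_measurable_indicator) auto
  have Ui: "U i x \<le> ennreal (f x)" for i x
    unfolding U(4)[symmetric] by (rule SUP_upper) simp
  have Uif: "enn2real (U i x) \<le> f x" for i x
    using Ui[of i x] f01 by (simp add: enn2real_leI)
  have u0: "0 \<le> u i x" for i x by (simp add: u_def)
  have uf: "u i x \<le> f x" for i x using Uif[of i x] f01 by (auto simp: u_def split: split_indicator)
  have uinc: "u i x \<le> u j x" if "i \<le> j" for i j x
  proof -
    have "U i x \<le> U j x" using U(2) that by (auto simp: incseq_def le_fun_def)
    then have "enn2real (U i x) \<le> enn2real (U j x)" using U(3) by (intro enn2real_mono) auto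
    then show ?thesis using that by (auto simp: u_def split: split_indicator)
  qed
  have ulim: "(\<lambda>i. u i x) \<longlonglongrightarrow> f x" for x
  proof -
    have "incseq (\<lambda>i. U i x)" using U(2) by (auto simp: incseq_def le_fun_def)
    then have "(\<lambda>i. U i x) \<longlonglongrightarrow> ennreal (f x)" unfolding U(4)[symmetric] by (rule LIMSEQ_SUP)
    then have "(\<lambda>i. enn2real (U i x)) \<longlonglongrightarrow> f x"
      using f01 by (intro tendsto_enn2real) auto
    moreover obtain m :: nat where "norm x \<le> real m" using real_arch_simple by blast
    then have "eventually (\<lambda>i. enn2real (U i x) = u i x) sequentially"
      by (intro eventually_sequentiallyI[of m]) (auto simp: u_def)
    ultimately show ?thesis by (rule Lim_transform_eventually)
  qed
  have urange: "finite (range (u i))" for i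
  proof -
    have "finite (range (U i))" using U(1)[of i] by (simp add: simple_function_def)
    then have "finite (insert 0 (enn2real ` range (U i)))" by simp
    then show ?thesis by (rule finite_subset[rotated]) (auto simp: u_def indicator_def)
  qed
  have ubdd: "bounded {x. u i x \<noteq> 0}" for i
    by (rule bounded_subset[OF bounded_cball[of 0 "real i"]]) (auto simp: u_def indicator_def)
  have step: "(\<lambda>n. \<integral>\<^sup>+\<omega>. (\<Prod>k<n. ennreal (1 - u i (X k \<omega>))) \<partial>M)
           \<longlonglongrightarrow> ennreal (exp_neg (ennreal lam * (\<integral>\<^sup>+x. ennreal (u i x) \<partial>lborel)))" for i
    by (intro ppp_pgf_simple X lam um urange ubdd u0 order_trans[OF uf f01(2)])
  have dec: "decseq (\<lambda>n. \<integral>\<^sup>+\<omega>. (\<Prod>k<n. ennreal (1 - g (X k \<omega>))) \<partial>M)" if "\<And>x. 0 \<le> g x" for g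
  proof (intro decseq_SucI nn_integral_mono)
    fix n :: nat and \<omega>
    have "(\<Prod>k<n. ennreal (1 - g (X k \<omega>))) * ennreal (1 - g (X n \<omega>)) \<le> (\<Prod>k<n. ennreal (1 - g (X k \<omega>))) * 1"
      using that by (intro mult_left_mono) auto
    then show "(\<Prod>k<Suc n. ennreal (1 - g (X k \<omega>))) \<le> (\<Prod>k<n. ennreal (1 - g (X k \<omega>)))"
      by (simp add: mult.commute)
  qed
  have "(INF n. \<integral>\<^sup>+\<omega>. (\<Prod>k<n. ennreal (1 - f (X k \<omega>))) \<partial>M)
      = (INF n. INF i. \<integral>\<^sup>+\<omega>. (\<Prod>k<n. ennreal (1 - u i (X k \<omega>))) \<partial>M)"
  proof (intro INF_cong refl)
    fix n :: nat
    have dec': "decseq (\<lambda>i. \<Prod>k<n. ennreal (1 - u i (x k)))" for x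
      using uinc order_trans[OF uf f01(2)]
      by (auto simp: decseq_def prod_ennreal intro!: ennreal_leI prod_mono)
    have "(\<Prod>k<n. ennreal (1 - f (x k))) = (INF i. \<Prod>k<n. ennreal (1 - u i (x k)))" for x
    proof (rule LIMSEQ_unique)
      show "(\<lambda>i. \<Prod>k<n. ennreal (1 - u i (x k))) \<longlonglongrightarrow> (INF i. \<Prod>k<n. ennreal (1 - u i (x k)))"
        by (rule LIMSEQ_INF[OF dec'])
      have "(\<lambda>i. ennreal (\<Prod>k<n. 1 - u i (x k))) \<longlonglongrightarrow> ennreal (\<Prod>k<n. 1 - f (x k))"
        by (intro tendsto_ennrealI tendsto_prod tendsto_intros ulim)
      then show "(\<lambda>i. \<Prod>k<n. ennreal (1 - u i (x k))) \<longlonglongrightarrow> (\<Prod>k<n. ennreal (1 - f (x k)))"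
        using order_trans[OF uf f01(2)] f01 by (simp add: prod_ennreal)
    qed
    then have "(\<integral>\<^sup>+\<omega>. (\<Prod>k<n. ennreal (1 - f (X k \<omega>))) \<partial>M) = (\<integral>\<^sup>+\<omega>. (INF i. \<Prod>k<n. ennreal (1 - u i (X k \<omega>))) \<partial>M)"
      by simp
    also have "\<dots> = (INF i. \<integral>\<^sup>+\<omega>. (\<Prod>k<n. ennreal (1 - u i (X k \<omega>))) \<partial>M)"
    proof (rule nn_integral_monotone_convergence_INF_decseq[where i = 0])
      show "decseq (\<lambda>i \<omega>. \<Prod>k<n. ennreal (1 - u i (X k \<omega>)))"
        by (intro antimonoI le_funI decseqD[OF dec'])
      have "(\<integral>\<^sup>+\<omega>. (\<Prod>k<n. ennreal (1 - u 0 (X k \<omega>))) \<partial>M) \<le> (\<integral>\<^sup>+\<omega>. 1 \<partial>M)"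
        using u0 order_trans[OF uf f01(2)]
        by (intro nn_integral_mono) (auto simp: prod_ennreal intro!: prod_le_1)
      then show "(\<integral>\<^sup>+\<omega>. (\<Prod>k<n. ennreal (1 - u 0 (X k \<omega>))) \<partial>M) < \<infinity>"
        by (simp add: emeasure_space_1) (simp add: le_less_trans[OF _ ennreal_one_less_top])
    qed measurable
    finally show "(\<integral>\<^sup>+\<omega>. (\<Prod>k<n. ennreal (1 - f (X k \<omega>))) \<partial>M) = (INF i. \<integral>\<^sup>+\<omega>. (\<Prod>k<n. ennreal (1 - u i (X k \<omega>))) \<partial>M)" .
  qed
  also have "\<dots> = (INF i. INF n. \<integral>\<^sup>+\<omega>. (\<Prod>k<n. ennreal (1 - u i (X k \<omega>))) \<partial>M)"
    by (rule INF_commute)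
  also have "\<dots> = (INF i. ennreal (exp_neg (ennreal lam * (\<integral>\<^sup>+x. ennreal (u i x) \<partial>lborel))))"
    using u0 by (intro INF_cong refl LIMSEQ_unique[OF LIMSEQ_INF step] dec)
  also have "\<dots> = ennreal (exp_neg (ennreal lam * (\<integral>\<^sup>+x. ennreal (f x) \<partial>lborel)))"
  proof (rule LIMSEQ_unique[OF LIMSEQ_INF])
    have mono: "(\<integral>\<^sup>+x. ennreal (u i x) \<partial>lborel) \<le> (\<integral>\<^sup>+x. ennreal (u j x) \<partial>lborel)" if "i \<le> j" for i j
      using uinc that by (intro nn_integral_mono ennreal_leI) auto
    then show "decseq (\<lambda>i. ennreal (exp_neg (ennreal lam * (\<integral>\<^sup>+x. ennreal (u i x) \<partial>lborel))))"
      by (auto simp: decseq_def intro!: ennreal_leI exp_neg_antimono mult_left_mono)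
    have "(\<lambda>i. \<integral>\<^sup>+x. ennreal (u i x) \<partial>lborel) \<longlonglongrightarrow> (\<integral>\<^sup>+x. ennreal (f x) \<partial>lborel)"
    proof (rule nn_integral_LIMSEQ)
      show "incseq (\<lambda>i x. ennreal (u i x))"
        using uinc by (auto simp: incseq_def le_fun_def intro!: ennreal_leI)
      show "(\<lambda>i. ennreal (u i x)) \<longlonglongrightarrow> ennreal (f x)" for x
        using ulim by (rule tendsto_ennrealI)
    qed auto
    then show "(\<lambda>i. ennreal (exp_neg (ennreal lam * (\<integral>\<^sup>+x. ennreal (u i x) \<partial>lborel))))
        \<longlonglongrightarrow> ennreal (exp_neg (ennreal lam * (\<integral>\<^sup>+x. ennreal (f x) \<partial>lborel)))"
      by (intro tendsto_ennrealI tendsto_exp_neg ennreal_tendsto_cmult) auto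
  qed
  finally show ?thesis
    using LIMSEQ_INF[OF dec[of f]] f01 by simp
qed

section \<open>Independence and marks\<close>

lemma nn_integral_resample:
  fixes W :: "'i \<Rightarrow> 'a \<Rightarrow> 'b"
  assumes ind: "indep_vars M' W UNIV" and f[measurable]: "f \<in> borel_measurable (Pi\<^sub>M UNIV M')"
  shows "(\<integral>\<^sup>+\<omega>. f (\<lambda>i. W i \<omega>) \<partial>M) = (\<integral>\<^sup>+\<omega>. \<integral>\<^sup>+\<omega>'. f (\<lambda>i. if i \<in> K then W i \<omega>' else W i \<omega>) \<partial>M \<partial>M)"
proof -
  let ?U = "\<lambda>\<omega>. restrict (\<lambda>i. W i \<omega>) (- K)" and ?V = "\<lambda>\<omega>. restrict (\<lambda>i. W i \<omega>) K"
  let ?A = "Pi\<^sub>M (- K) M'" and ?B = "Pi\<^sub>M K M'"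
  have "indep_var ?A ?U ?B ?V"
    using ind by (rule indep_var_restrict) auto
  then have UV[measurable]: "?U \<in> measurable M ?A" "?V \<in> measurable M ?B"
    and eq: "distr M ?A ?U \<Otimes>\<^sub>M distr M ?B ?V = distr M (?A \<Otimes>\<^sub>M ?B) (\<lambda>x. (?U x, ?V x))"
    unfolding indep_var_distribution_eq by auto
  have mg[measurable]: "merge (- K) K \<in> measurable (?A \<Otimes>\<^sub>M ?B) (Pi\<^sub>M UNIV M')"
    using measurable_merge[of "- K" K M'] by (simp add: Compl_partition2)
  interpret V: prob_space "distr M ?B ?V" by (rule prob_space_distr) simp
  have *: "merge (- K) K (?U \<omega>, ?V \<omega>') = (\<lambda>i. if i \<in> K then W i \<omega>' else W i \<omega>)" for \<omega> \<omega>'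
    by (auto simp: merge_def)
  have "(\<integral>\<^sup>+\<omega>. f (\<lambda>i. W i \<omega>) \<partial>M) = (\<integral>\<^sup>+\<omega>. f (merge (- K) K (?U \<omega>, ?V \<omega>)) \<partial>M)"
    unfolding * by simp
  also have "\<dots> = (\<integral>\<^sup>+z. f (merge (- K) K z) \<partial>distr M (?A \<Otimes>\<^sub>M ?B) (\<lambda>x. (?U x, ?V x)))"
    by (subst nn_integral_distr) auto
  also have "\<dots> = (\<integral>\<^sup>+x. \<integral>\<^sup>+y. f (merge (- K) K (x, y)) \<partial>distr M ?B ?V \<partial>distr M ?A ?U)"
    unfolding eq[symmetric] by (subst V.nn_integral_fst[symmetric]) auto
  also have "\<dots> = (\<integral>\<^sup>+\<omega>. \<integral>\<^sup>+y. f (merge (- K) K (?U \<omega>, y)) \<partial>distr M ?B ?V \<partial>M)"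
    by (subst nn_integral_distr) auto
  also have "\<dots> = (\<integral>\<^sup>+\<omega>. \<integral>\<^sup>+\<omega>'. f (merge (- K) K (?U \<omega>, ?V \<omega>')) \<partial>M \<partial>M)"
  proof (intro nn_integral_cong nn_integral_distr UV)
    fix \<omega> assume "\<omega> \<in> space M"
    then have "?U \<omega> \<in> space ?A" by (rule measurable_space[OF UV(1)])
    then have "(\<lambda>y. merge (- K) K (?U \<omega>, y)) \<in> measurable ?B (Pi\<^sub>M UNIV M')"
      by (intro measurable_compose[OF _ mg] measurable_Pair measurable_const) auto
    then show "(\<lambda>y. f (merge (- K) K (?U \<omega>, y))) \<in> borel_measurable (distr M ?B ?V)"
      by (simp add: measurable_compose[OF _ f])
  qed
  finally show ?thesis unfolding * .
qed

lemma nn_integral_indep_mult: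
  fixes W :: "'i \<Rightarrow> 'a \<Rightarrow> 'b"
  assumes ind: "indep_vars M' W UNIV"
    and [measurable]: "f \<in> borel_measurable (Pi\<^sub>M UNIV M')" "g \<in> borel_measurable (Pi\<^sub>M UNIV M')"
    and f: "\<And>w w'. (\<And>i. i \<in> K \<Longrightarrow> w i = w' i) \<Longrightarrow> f w = f w'"
    and g: "\<And>w w'. (\<And>i. i \<notin> K \<Longrightarrow> w i = w' i) \<Longrightarrow> g w = g w'"
  shows "(\<integral>\<^sup>+\<omega>. f (\<lambda>i. W i \<omega>) * g (\<lambda>i. W i \<omega>) \<partial>M)
           = (\<integral>\<^sup>+\<omega>. f (\<lambda>i. W i \<omega>) \<partial>M) * (\<integral>\<^sup>+\<omega>. g (\<lambda>i. W i \<omega>) \<partial>M)"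
proof -
  have [measurable]: "W i \<in> measurable M (M' i)" for i
    using ind by (simp add: indep_vars_def)
  have [measurable]: "(\<lambda>\<omega> i. W i \<omega>) \<in> measurable M (Pi\<^sub>M UNIV M')"
    by (rule measurable_PiM_single') (auto intro: measurable_space)
  have "(\<integral>\<^sup>+\<omega>. f (\<lambda>i. W i \<omega>) * g (\<lambda>i. W i \<omega>) \<partial>M)
      = (\<integral>\<^sup>+\<omega>. \<integral>\<^sup>+\<omega>'. f (\<lambda>i. if i \<in> K then W i \<omega>' else W i \<omega>) * g (\<lambda>i. if i \<in> K then W i \<omega>' else W i \<omega>) \<partial>M \<partial>M)"
    by (rule nn_integral_resample[OF ind]) measurable
  also have "\<dots> = (\<integral>\<^sup>+\<omega>. \<integral>\<^sup>+\<omega>'. f (\<lambda>i. W i \<omega>') * g (\<lambda>i. W i \<omega>) \<partial>M \<partial>M)"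
    by (intro nn_integral_cong arg_cong2[where f = "(*)"] f g) auto
  also have "\<dots> = (\<integral>\<^sup>+\<omega>. (\<integral>\<^sup>+\<omega>'. f (\<lambda>i. W i \<omega>') \<partial>M) * g (\<lambda>i. W i \<omega>) \<partial>M)"
    by (intro nn_integral_cong nn_integral_multc) measurable
  also have "\<dots> = (\<integral>\<^sup>+\<omega>. f (\<lambda>i. W i \<omega>) \<partial>M) * (\<integral>\<^sup>+\<omega>. g (\<lambda>i. W i \<omega>) \<partial>M)"
    by (rule nn_integral_cmult) measurable
  finally show ?thesis .
qed

lemma nn_integral_prod_marks:
  fixes W :: "'i \<Rightarrow> 'a \<Rightarrow> 'b" and f :: "nat \<Rightarrow> 'c \<Rightarrow> ('i \<Rightarrow> 'b) \<Rightarrow> ennreal"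
  assumes ind: "indep_vars M' W UNIV"
    and [measurable]: "\<phi> \<in> borel_measurable (M' T)" "\<And>k. c k \<in> measurable (M' T) N"
    and f_meas[measurable]: "\<And>k. case_prod (f k) \<in> borel_measurable (N \<Otimes>\<^sub>M Pi\<^sub>M UNIV M')"
    and G: "disjoint_family G" "\<And>k. T \<notin> G k"
    and f: "\<And>k x w w'. (\<And>i. i \<in> G k \<Longrightarrow> w i = w' i) \<Longrightarrow> f k x w = f k x w'"
    and v: "\<And>k x. x \<in> space N \<Longrightarrow> (\<integral>\<^sup>+\<omega>. f k x (\<lambda>i. W i \<omega>) \<partial>M) = v x"
  shows "(\<integral>\<^sup>+\<omega>. \<phi> (W T \<omega>) * (\<Prod>k<n. f k (c k (W T \<omega>)) (\<lambda>i. W i \<omega>)) \<partial>M)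
           = (\<integral>\<^sup>+\<omega>. \<phi> (W T \<omega>) * (\<Prod>k<n. v (c k (W T \<omega>))) \<partial>M)"
proof -
  have [measurable]: "W i \<in> measurable M (M' i)" for i
    using ind by (simp add: indep_vars_def)
  have [measurable]: "(\<lambda>\<omega> i. W i \<omega>) \<in> measurable M (Pi\<^sub>M UNIV M')"
    by (rule measurable_PiM_single') (auto intro: measurable_space)
  have "(\<lambda>x. \<integral>\<^sup>+\<omega>. f 0 x (\<lambda>i. W i \<omega>) \<partial>M) \<in> borel_measurable N"
    by measurable
  then have [measurable]: "v \<in> borel_measurable N"
    by (rule measurable_cong[THEN iffD1, rotated]) (rule v)
  show ?thesis
    using \<open>\<phi> \<in> borel_measurable (M' T)\<close>
  proof (induction n arbitrary: \<phi>)
    case (Suc n)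
    note [measurable] = \<open>\<phi> \<in> borel_measurable (M' T)\<close>
    have Gn: "i \<notin> G n" if "i \<in> G k" "k < n" for i k
      using G(1) that by (metis disjoint_family_onD disjoint_iff UNIV_I less_irrefl)
    let ?mix = "\<lambda>\<omega> \<omega>' i. if i \<in> G n then W i \<omega>' else W i \<omega>"
    have "(\<integral>\<^sup>+\<omega>. \<phi> (W T \<omega>) * (\<Prod>k<Suc n. f k (c k (W T \<omega>)) (\<lambda>i. W i \<omega>)) \<partial>M)
       = (\<integral>\<^sup>+\<omega>. \<integral>\<^sup>+\<omega>'. \<phi> (?mix \<omega> \<omega>' T) * (\<Prod>k<Suc n. f k (c k (?mix \<omega> \<omega>' T)) (?mix \<omega> \<omega>')) \<partial>M \<partial>M)"
      by (rule nn_integral_resample[OF ind, of "\<lambda>w. \<phi> (w T) * (\<Prod>k<Suc n. f k (c k (w T)) w)" "G n"]) measurable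
    also have "\<dots> = (\<integral>\<^sup>+\<omega>. \<integral>\<^sup>+\<omega>'. \<phi> (W T \<omega>) * (\<Prod>k<n. f k (c k (W T \<omega>)) (\<lambda>i. W i \<omega>)) * f n (c n (W T \<omega>)) (\<lambda>i. W i \<omega>') \<partial>M \<partial>M)"
    proof (intro nn_integral_cong)
      fix \<omega> \<omega>'
      have "f k x (?mix \<omega> \<omega>') = f k x (\<lambda>i. W i \<omega>)" if "k < n" for k x
        using Gn that by (intro f) auto
      moreover have "f n x (?mix \<omega> \<omega>') = f n x (\<lambda>i. W i \<omega>')" for x
        by (intro f) auto
      ultimately show "\<phi> (?mix \<omega> \<omega>' T) * (\<Prod>k<Suc n. f k (c k (?mix \<omega> \<omega>' T)) (?mix \<omega> \<omega>'))
         = \<phi> (W T \<omega>) * (\<Prod>k<n. f k (c k (W T \<omega>)) (\<lambda>i. W i \<omega>)) * f n (c n (W T \<omega>)) (\<lambda>i. W i \<omega>')"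
        using G(2) by (simp add: mult.assoc)
    qed
    also have "\<dots> = (\<integral>\<^sup>+\<omega>. \<phi> (W T \<omega>) * (\<Prod>k<n. f k (c k (W T \<omega>)) (\<lambda>i. W i \<omega>)) * v (c n (W T \<omega>)) \<partial>M)"
    proof (intro nn_integral_cong)
      fix \<omega> assume \<omega>: "\<omega> \<in> space M"
      have sp: "c n (W T \<omega>) \<in> space N" using \<omega> by (auto intro: measurable_space)
      have "(\<lambda>\<omega>'. f n (c n (W T \<omega>)) (\<lambda>i. W i \<omega>')) \<in> borel_measurable M"
        using sp by measurable
      then have "(\<integral>\<^sup>+\<omega>'. \<phi> (W T \<omega>) * (\<Prod>k<n. f k (c k (W T \<omega>)) (\<lambda>i. W i \<omega>)) * f n (c n (W T \<omega>)) (\<lambda>i. W i \<omega>') \<partial>M)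
         = \<phi> (W T \<omega>) * (\<Prod>k<n. f k (c k (W T \<omega>)) (\<lambda>i. W i \<omega>)) * (\<integral>\<^sup>+\<omega>'. f n (c n (W T \<omega>)) (\<lambda>i. W i \<omega>') \<partial>M)"
        by (rule nn_integral_cmult)
      then show "(\<integral>\<^sup>+\<omega>'. \<phi> (W T \<omega>) * (\<Prod>k<n. f k (c k (W T \<omega>)) (\<lambda>i. W i \<omega>)) * f n (c n (W T \<omega>)) (\<lambda>i. W i \<omega>') \<partial>M)
         = \<phi> (W T \<omega>) * (\<Prod>k<n. f k (c k (W T \<omega>)) (\<lambda>i. W i \<omega>)) * v (c n (W T \<omega>))"
        using v[OF sp] by simp
    qed
    also have "\<dots> = (\<integral>\<^sup>+\<omega>. (\<phi> (W T \<omega>) * v (c n (W T \<omega>))) * (\<Prod>k<n. f k (c k (W T \<omega>)) (\<lambda>i. W i \<omega>)) \<partial>M)"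
      by (simp add: mult_ac)
    also have "\<dots> = (\<integral>\<^sup>+\<omega>. (\<phi> (W T \<omega>) * v (c n (W T \<omega>))) * (\<Prod>k<n. v (c k (W T \<omega>))) \<partial>M)"
      by (rule Suc.IH) measurable
    finally show ?case by (simp add: mult_ac)
  qed simp
qed

end

lemma nn_integral_exp_gamma_law:
  assumes "0 \<le> u"
  shows "(\<integral>\<^sup>+x. ennreal (exp (- (u * x))) \<partial>gamma_law m) = ennreal (inverse ((1 + u) ^ m))"
proof (cases "m = 0")
  case True
  then show ?thesis by (simp add: gamma_law_def nn_integral_return)
next
  case False
  then obtain k where m: "m = Suc k" by (cases m) auto
  have eq: "ennreal (erlang_density k 1 x) * ennreal (exp (- (u * x)))
      = ennreal (inverse ((1 + u) ^ m)) * ennreal (erlang_density k (1 + u) x * x ^ 0)" for x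
  proof (cases "x < 0")
    case False
    have "exp (- (1 + u) * x) = exp (- x) * exp (- (u * x))"
      by (simp add: algebra_simps flip: exp_add)
    then have "erlang_density k 1 x * exp (- (u * x)) = inverse ((1 + u) ^ m) * (erlang_density k (1 + u) x * x ^ 0)"
      using False assms by (simp add: erlang_density_def m del: power_Suc)
    then show ?thesis
      using False assms by (simp add: erlang_density_nonneg flip: ennreal_mult)
  qed (simp add: erlang_density_def)
  have "(\<integral>\<^sup>+x. ennreal (exp (- (u * x))) \<partial>gamma_law m)
      = (\<integral>\<^sup>+x. ennreal (inverse ((1 + u) ^ m)) * ennreal (erlang_density k (1 + u) x * x ^ 0) \<partial>lborel)"
    unfolding eq[symmetric] by (simp add: gamma_law_def m nn_integral_density)
  also have "\<dots> = ennreal (inverse ((1 + u) ^ m)) * ennreal (fact (k + 0) / (fact k * (1 + u) ^ 0))"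
    using assms by (subst nn_integral_cmult, simp, subst nn_integral_erlang_ith_moment) auto
  finally show ?thesis by simp
qed

lemma exp_law_eq_gamma_law: "exp_law = gamma_law 1"
  by (simp add: exp_law_def gamma_law_def)

lemma emeasure_exp_law_greater:
  assumes "0 \<le> c"
  shows "emeasure exp_law {c<..} = ennreal (exp (- c))"
proof -
  interpret prob_space exp_law
    unfolding exp_law_def by (rule prob_space_exponential_density) simp
  have "emeasure exp_law {..c} = ennreal (1 - exp (- c))"
    using assms unfolding exp_law_def
    by (subst emeasure_erlang_density) (auto simp: erlang_CDF_0)
  then have "prob {..c} = 1 - exp (- c)"
    using assms by (simp add: emeasure_eq_measure)
  moreover have "{c<..} = space exp_law - {..c}"
    by (auto simp: exp_law_def)
  moreover have "{..c} \<in> events" by (simp add: exp_law_def)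
  ultimately show ?thesis by (simp add: emeasure_eq_measure prob_compl)
qed

section \<open>Interference fields\<close>

lemma prod_exp_tendsto_exp_neg:
  fixes a :: "nat \<Rightarrow> real"
  assumes "\<And>l. 0 \<le> a l"
  shows "(\<lambda>n. \<Prod>l<n. ennreal (exp (- a l))) \<longlonglongrightarrow> ennreal (exp_neg (\<Sum>l. ennreal (a l)))"
proof -
  have "(\<lambda>n. exp_neg (\<Sum>l<n. ennreal (a l))) \<longlonglongrightarrow> exp_neg (\<Sum>l. ennreal (a l))"
    by (intro tendsto_exp_neg summable_LIMSEQ summableI)
  moreover have "(\<Prod>l<n. ennreal (exp (- a l))) = ennreal (exp_neg (\<Sum>l<n. ennreal (a l)))" for n
  proof -
    have "(\<Prod>l<n. ennreal (exp (- a l))) = ennreal (exp (- (\<Sum>l<n. a l)))"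
      by (simp add: prod_ennreal exp_sum flip: sum_negf)
    also have "exp (- (\<Sum>l<n. a l)) = exp_neg (ennreal (\<Sum>l<n. a l))"
      using assms by (simp add: sum_nonneg)
    also have "ennreal (\<Sum>l<n. a l) = (\<Sum>l<n. ennreal (a l))"
      using assms by (subst sum_ennreal) auto
    finally show ?thesis .
  qed
  ultimately show ?thesis by (simp add: tendsto_ennrealI)
qed

text \<open>
  All the randomness of the network, indexed by tiers and links. The library notion of independent
  variables needs one common value type, so a real gain is stored as a constant sequence of
  multiples of the first unit vector.
\<close>

type_synonym config = "tier + link \<Rightarrow> nat \<Rightarrow> real^2"

definition config_space :: "config measure" where
  "config_space = Pi\<^sub>M UNIV (\<lambda>_. Pi\<^sub>M UNIV (\<lambda>_. borel))"

definition site :: "tier \<Rightarrow> nat \<Rightarrow> config \<Rightarrow> real^2" where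
  "site t k w = w (Inl t) k"

definition gain :: "link \<Rightarrow> config \<Rightarrow> real" where
  "gain l w = w (Inr l) 0 $ 1"

lemma measurable_config_component: "(\<lambda>w. w i k) \<in> borel_measurable config_space"
  unfolding config_space_def
  by (rule measurable_compose[OF measurable_component_singleton[of i] measurable_component_singleton]) auto

lemma measurable_site[measurable]: "site t k \<in> borel_measurable config_space"
  unfolding site_def[abs_def] by (rule measurable_config_component)

lemma measurable_gain[measurable]: "gain l \<in> borel_measurable config_space"
  unfolding gain_def[abs_def]
  by (rule measurable_compose[OF measurable_config_component]) simp

lemma AE_gamma_law_nonneg: "AE x in gamma_law m. 0 \<le> x"
proof (cases "m = 0")
  case False
  then have "gamma_law m = density lborel (\<lambda>x. ennreal (erlang_density (m - 1) 1 x))"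
    by (simp add: gamma_law_def)
  then show ?thesis
    by (simp only:) (subst AE_density, auto simp: erlang_density_def)
next
  case True
  then have "gamma_law m = return borel 0" by (simp add: gamma_law_def)
  then show ?thesis by (simp only:) (subst AE_return, auto)
qed

context massive_mimo_hetnet begin

definition coords :: "tier + link \<Rightarrow> 'a \<Rightarrow> nat \<Rightarrow> real^2" where
  "coords i \<omega> = (case i of Inl t \<Rightarrow> (\<lambda>k. X t k \<omega>) | Inr l \<Rightarrow> (\<lambda>_. h l \<omega> *\<^sub>R axis 1 1))"

definition config :: "'a \<Rightarrow> config" where
  "config \<omega> = (\<lambda>i. coords i \<omega>)"

lemma site_config [simp]: "site t k (config \<omega>) = X t k \<omega>"
  by (simp add: site_def config_def coords_def)

lemma gain_config [simp]: "gain l (config \<omega>) = h l \<omega>"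
  by (simp add: gain_def config_def coords_def axis_def)

lemma X_measurable [measurable]: "X t k \<in> borel_measurable \<Omega>"
  using locations[of t] by (simp add: homogeneous_ppp_def)

lemmas [measurable] = gains_measurable

lemma indep_coords: "indep_vars (\<lambda>_. Pi\<^sub>M UNIV (\<lambda>_. borel)) coords UNIV"
  unfolding indep_vars_def2
proof (intro conjI ballI)
  show rv: "coords i \<in> measurable \<Omega> (Pi\<^sub>M UNIV (\<lambda>_. borel))" for i
    unfolding coords_def[abs_def] by (cases i) (auto intro!: measurable_PiM_single')
  show "indep_sets (\<lambda>i. {coords i -` A \<inter> space \<Omega> |A. A \<in> sets (Pi\<^sub>M UNIV (\<lambda>_. borel))}) UNIV"
  proof (rule indep_sets_mono_sets[OF independence], safe)
    fix i :: "tier + link" and A :: "(nat \<Rightarrow> real^2) set"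
    assume A: "A \<in> sets (Pi\<^sub>M UNIV (\<lambda>_. borel))"
    show "coords i -` A \<inter> space \<Omega> \<in> case_sum
         (\<lambda>t. sets (vimage_algebra (space \<Omega>) (\<lambda>\<omega> i. X t i \<omega>) (Pi\<^sub>M UNIV (\<lambda>_. borel))))
         (\<lambda>l. sets (vimage_algebra (space \<Omega>) (h l) borel)) i"
    proof (cases i)
      case (Inl t)
      then have "coords i = (\<lambda>\<omega> k. X t k \<omega>)" by (simp add: coords_def[abs_def])
      with A Inl show ?thesis by (auto intro: in_vimage_algebra)
    next
      case (Inr l)
      define G :: "real \<Rightarrow> nat \<Rightarrow> real^2" where "G x = (\<lambda>_. x *\<^sub>R axis 1 1)" for x
      have G: "G \<in> measurable borel (Pi\<^sub>M UNIV (\<lambda>_. borel))"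
        unfolding G_def[abs_def] by (rule measurable_PiM_single') auto
      have "G -` A \<in> sets borel" by (rule measurable_sets_borel[OF G A])
      then have "h l -` (G -` A) \<inter> space \<Omega> \<in> sets (vimage_algebra (space \<Omega>) (h l) borel)"
        by (rule in_vimage_algebra)
      moreover have "coords i -` A \<inter> space \<Omega> = h l -` (G -` A) \<inter> space \<Omega>"
        using Inr by (auto simp: coords_def G_def)
      ultimately show ?thesis using Inr by simp
    qed
  qed
qed

lemma measurable_config [measurable]: "config \<in> measurable \<Omega> config_space"
  unfolding config_space_def config_def[abs_def]
proof (rule measurable_PiM_single')
  show "coords i \<in> measurable \<Omega> (Pi\<^sub>M UNIV (\<lambda>_. borel))" for i
    using indep_coords unfolding indep_vars_def by blast
qed (simp add: space_PiM PiE_UNIV_domain)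

lemma nn_integral_config_resample:
  assumes "f \<in> borel_measurable config_space"
  shows "(\<integral>\<^sup>+\<omega>. f (config \<omega>) \<partial>\<Omega>)
    = (\<integral>\<^sup>+\<omega>. \<integral>\<^sup>+\<omega>'. f (\<lambda>i. if i \<in> K then config \<omega>' i else config \<omega> i) \<partial>\<Omega> \<partial>\<Omega>)"
  using assms unfolding config_def config_space_def by (rule nn_integral_resample[OF indep_coords])

lemma nn_integral_config_indep_mult:
  assumes "f \<in> borel_measurable config_space" "g \<in> borel_measurable config_space"
    and "\<And>w w'. (\<And>i. i \<in> K \<Longrightarrow> w i = w' i) \<Longrightarrow> f w = f w'"
    and "\<And>w w'. (\<And>i. i \<notin> K \<Longrightarrow> w i = w' i) \<Longrightarrow> g w = g w'"
  shows "(\<integral>\<^sup>+\<omega>. f (config \<omega>) * g (config \<omega>) \<partial>\<Omega>) = (\<integral>\<^sup>+\<omega>. f (config \<omega>) \<partial>\<Omega>) * (\<integral>\<^sup>+\<omega>. g (config \<omega>) \<partial>\<Omega>)"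
  using nn_integral_indep_mult[OF indep_coords assms[unfolded config_space_def]] unfolding config_def by blast

lemma AE_gain_nonneg: "AE \<omega> in \<Omega>. 0 \<le> h l \<omega>"
proof -
  have "AE x in gain_law N S l. 0 \<le> x"
    by (cases l) (simp_all only: gain_law.simps AE_gamma_law_nonneg exp_law_eq_gamma_law)
  then have "AE x in distr \<Omega> borel (h l). 0 \<le> x" unfolding gains .
  then show ?thesis by (subst (asm) AE_distr_iff) auto
qed

lemma nn_integral_gain:
  assumes "f \<in> borel_measurable borel"
  shows "(\<integral>\<^sup>+\<omega>. f (h l \<omega>) \<partial>\<Omega>) = (\<integral>\<^sup>+x. f x \<partial>gain_law N S l)"
  using assms by (subst gains[symmetric], subst nn_integral_distr) auto

lemma tier_density_pos: "0 < tier_density lam_M lam_P lam_E t"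
  using params_pos by (cases t) auto

lemma nn_integral_marked_ppp_tendsto:
  assumes f[measurable]: "\<And>k. case_prod (f k) \<in> borel_measurable (borel \<Otimes>\<^sub>M config_space)"
    and G: "disjoint_family G" "\<And>k. Inl t \<notin> G k"
    and dep: "\<And>k x w w'. (\<And>i. i \<in> G k \<Longrightarrow> w i = w' i) \<Longrightarrow> f k x w = f k x w'"
    and v: "\<And>k x. (\<integral>\<^sup>+\<omega>. f k x (config \<omega>) \<partial>\<Omega>) = ennreal (1 - v x)"
    and [measurable]: "v \<in> borel_measurable borel" and v01: "\<And>x. 0 \<le> v x" "\<And>x. v x \<le> 1"
  shows "(\<lambda>n. \<integral>\<^sup>+\<omega>. (\<Prod>k<n. f k (X t k \<omega>) (config \<omega>)) \<partial>\<Omega>)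
     \<longlonglongrightarrow> ennreal (exp_neg (ennreal (tier_density lam_M lam_P lam_E t) * (\<integral>\<^sup>+x. ennreal (v x) \<partial>lborel)))"
proof -
  have *: "coords (Inl t) \<omega> k = X t k \<omega>" for k \<omega> by (simp add: coords_def)
  have "(\<integral>\<^sup>+\<omega>. 1 * (\<Prod>k<n. f k (coords (Inl t) \<omega> k) (config \<omega>)) \<partial>\<Omega>)
      = (\<integral>\<^sup>+\<omega>. 1 * (\<Prod>k<n. ennreal (1 - v (coords (Inl t) \<omega> k))) \<partial>\<Omega>)" for n
    unfolding config_def
  proof (rule nn_integral_prod_marks[OF indep_coords, where \<phi> = "\<lambda>_. 1" and T = "Inl t" and c = "\<lambda>k p. p k" and N = borel and G = G and f = f and v = "\<lambda>x. ennreal (1 - v x)"])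
    show "case_prod (f k) \<in> borel_measurable (borel \<Otimes>\<^sub>M Pi\<^sub>M UNIV (\<lambda>_. Pi\<^sub>M UNIV (\<lambda>_. borel)))" for k
      using f unfolding config_space_def .
  qed (fact G v[unfolded config_def] | rule dep, simp | simp)+
  then have eq: "(\<integral>\<^sup>+\<omega>. (\<Prod>k<n. f k (X t k \<omega>) (config \<omega>)) \<partial>\<Omega>) = (\<integral>\<^sup>+\<omega>. (\<Prod>k<n. ennreal (1 - v (X t k \<omega>))) \<partial>\<Omega>)" for n
    unfolding * by simp
  show ?thesis
    unfolding eq by (rule ppp_pgf[OF locations less_imp_le[OF tier_density_pos] \<open>v \<in> borel_measurable borel\<close> v01])
qed

lemma interference_transform:
  fixes g :: "nat \<Rightarrow> link" and t :: tier and z :: "real^2" and \<alpha> c :: real and m :: nat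
  assumes g: "inj g" and law: "\<And>l. gain_law N S (g l) = gamma_law m" and m: "1 \<le> m"
    and \<alpha>: "2 < \<alpha>" and c: "0 \<le> c"
  shows "(\<integral>\<^sup>+\<omega>. ennreal (exp_neg (\<Sum>l. ennreal (c * h (g l) \<omega> * dist z (X t l \<omega>) powr (- \<alpha>)))) \<partial>\<Omega>)
    = ennreal (exp (- (tier_density lam_M lam_P lam_E t * ppp_laplace_exponent m \<alpha> c)))"
proof (rule LIMSEQ_unique)
  let ?a = "\<lambda>l \<omega>. c * h (g l) \<omega> * dist z (X t l \<omega>) powr (- \<alpha>)"
  define f where "f l x w = ennreal (exp (- (c * gain (g l) w * dist z x powr (- \<alpha>))))" for l and x :: "real^2" and w
  define v where "v x = 1 - inverse ((1 + c * dist z x powr (- \<alpha>)) ^ m)" for x :: "real^2"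
  have one_le: "1 \<le> (1 + c * dist z x powr (- \<alpha>)) ^ m" for x
    using c by (intro one_le_power) auto
  have v01: "0 \<le> v x" "v x \<le> 1" for x
    using one_le[of x] by (auto simp: v_def inverse_le_1_iff intro: order_trans[OF zero_le_one])
  have f_int: "(\<integral>\<^sup>+\<omega>. f l x (config \<omega>) \<partial>\<Omega>) = ennreal (1 - v x)" for l x
  proof -
    have "(\<integral>\<^sup>+\<omega>. f l x (config \<omega>) \<partial>\<Omega>) = (\<integral>\<^sup>+\<omega>. ennreal (exp (- ((c * dist z x powr (- \<alpha>)) * h (g l) \<omega>))) \<partial>\<Omega>)"
      by (simp add: f_def mult_ac)
    also have "\<dots> = (\<integral>\<^sup>+y. ennreal (exp (- ((c * dist z x powr (- \<alpha>)) * y))) \<partial>gamma_law m)"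
      unfolding law[of l, symmetric] by (rule nn_integral_gain) simp
    also have "\<dots> = ennreal (1 - v x)"
      using c by (subst nn_integral_exp_gamma_law) (auto simp: v_def)
    finally show ?thesis .
  qed
  have f_meas: "case_prod (f l) \<in> borel_measurable (borel \<Otimes>\<^sub>M config_space)" for l
    unfolding f_def by measurable
  have disj: "disjoint_family (\<lambda>k. {Inr (g k) :: tier + link})"
    using g by (auto simp: disjoint_family_on_def inj_def)
  have f_dep: "f k x w = f k x w'" if "\<And>i. i \<in> {Inr (g k)} \<Longrightarrow> w i = w' i" for k x w w'
    using that by (simp add: f_def gain_def)
  have v_meas: "v \<in> borel_measurable borel"
    unfolding v_def by measurable
  have "(\<lambda>n. \<integral>\<^sup>+\<omega>. (\<Prod>k<n. f k (X t k \<omega>) (config \<omega>)) \<partial>\<Omega>)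
     \<longlonglongrightarrow> ennreal (exp_neg (ennreal (tier_density lam_M lam_P lam_E t) * (\<integral>\<^sup>+x. ennreal (v x) \<partial>lborel)))"
    by (rule nn_integral_marked_ppp_tendsto[OF f_meas disj _ f_dep f_int v_meas v01]) auto
  also have "(\<integral>\<^sup>+x. ennreal (v x) \<partial>lborel) = (\<integral>\<^sup>+x. ennreal (v x) \<partial>distr lborel borel ((+) z))"
    by (simp add: lborel_distr_plus)
  also have "\<dots> = (\<integral>\<^sup>+y. ennreal (1 - inverse ((1 + c * norm (y :: real^2) powr (- \<alpha>)) ^ m)) \<partial>lborel)"
    by (subst nn_integral_distr) (auto simp: v_def dist_norm)
  also have "\<dots> = ennreal (ppp_laplace_exponent m \<alpha> c)"
    by (rule nn_integral_plane_gamma_laplace[OF \<alpha> c m])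
  also have "exp_neg (ennreal (tier_density lam_M lam_P lam_E t) * ennreal (ppp_laplace_exponent m \<alpha> c))
      = exp (- (tier_density lam_M lam_P lam_E t * ppp_laplace_exponent m \<alpha> c))"
    using tier_density_pos[of t] ppp_laplace_exponent_nonneg[OF \<alpha> m] by (simp flip: ennreal_mult)
  finally show "(\<lambda>n. \<integral>\<^sup>+\<omega>. (\<Prod>l<n. ennreal (exp (- ?a l \<omega>))) \<partial>\<Omega>)
     \<longlonglongrightarrow> ennreal (exp (- (tier_density lam_M lam_P lam_E t * ppp_laplace_exponent m \<alpha> c)))"
    by (simp add: f_def)
  have nonneg: "AE \<omega> in \<Omega>. \<forall>l. 0 \<le> h (g l) \<omega>"
    by (simp add: AE_all_countable AE_gain_nonneg)
  show "(\<lambda>n. \<integral>\<^sup>+\<omega>. (\<Prod>l<n. ennreal (exp (- ?a l \<omega>))) \<partial>\<Omega>)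
     \<longlonglongrightarrow> (\<integral>\<^sup>+\<omega>. ennreal (exp_neg (\<Sum>l. ennreal (?a l \<omega>))) \<partial>\<Omega>)"
  proof (rule nn_integral_dominated_convergence[where w = "\<lambda>_. 1"])
    show "AE \<omega> in \<Omega>. (\<lambda>n. \<Prod>l<n. ennreal (exp (- ?a l \<omega>))) \<longlonglongrightarrow> ennreal (exp_neg (\<Sum>l. ennreal (?a l \<omega>)))"
      using nonneg by eventually_elim (use c in \<open>auto intro!: prod_exp_tendsto_exp_neg\<close>)
    show "AE \<omega> in \<Omega>. (\<Prod>l<n. ennreal (exp (- ?a l \<omega>))) \<le> 1" for n
      using nonneg by eventually_elim (use c in \<open>auto simp: prod_ennreal intro!: prod_le_1\<close>)
    show "(\<lambda>\<omega>. ennreal (exp_neg (\<Sum>l. ennreal (?a l \<omega>)))) \<in> borel_measurable \<Omega>"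
      unfolding exp_neg_def by measurable
  qed (auto simp: emeasure_space_1)
qed

text \<open>
  The Laplace transform tends to \<open>1\<close> at \<open>0\<close>, which forces the interference to be almost surely
  finite; no moment bound is available, as the mean is infinite.
\<close>

lemma AE_interference_summable:
  fixes g :: "nat \<Rightarrow> link" and t :: tier and z :: "real^2" and \<alpha> c :: real and m :: nat
  assumes g: "inj g" and law: "\<And>l. gain_law N S (g l) = gamma_law m" and m: "1 \<le> m"
    and \<alpha>: "2 < \<alpha>" and c: "0 \<le> c"
  shows "AE \<omega> in \<Omega>. (\<forall>l. 0 \<le> c * h (g l) \<omega> * dist z (X t l \<omega>) powr (- \<alpha>))
            \<and> summable (\<lambda>l. c * h (g l) \<omega> * dist z (X t l \<omega>) powr (- \<alpha>))"
proof -
  let ?a = "\<lambda>c l \<omega>. c * h (g l) \<omega> * dist z (X t l \<omega>) powr (- \<alpha>)"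
  let ?A = "{\<omega> \<in> space \<Omega>. (\<Sum>l. ennreal (?a c l \<omega>)) \<noteq> \<infinity>}"
  have A[measurable]: "?A \<in> sets \<Omega>" by measurable
  have "ennreal (exp (- (tier_density lam_M lam_P lam_E t * ppp_laplace_exponent m \<alpha> (c / real (Suc j))))) \<le> emeasure \<Omega> ?A" for j
  proof -
    have s: "(\<Sum>l. ennreal (?a (c / real (Suc j)) l \<omega>)) = ennreal (1 / real (Suc j)) * (\<Sum>l. ennreal (?a c l \<omega>))" for \<omega>
    proof -
      have "ennreal (?a (c / real (Suc j)) l \<omega>) = ennreal (1 / real (Suc j)) * ennreal (?a c l \<omega>)" for l
        by (subst ennreal_mult'[symmetric]) auto
      then show ?thesis by (simp only: ennreal_suminf_cmult)
    qed
    have "ennreal (exp (- (tier_density lam_M lam_P lam_E t * ppp_laplace_exponent m \<alpha> (c / real (Suc j)))))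
       = (\<integral>\<^sup>+\<omega>. ennreal (exp_neg (\<Sum>l. ennreal (?a (c / real (Suc j)) l \<omega>))) \<partial>\<Omega>)"
      using c by (intro interference_transform[symmetric] g law m \<alpha>) auto
    also have "\<dots> \<le> (\<integral>\<^sup>+\<omega>. indicator ?A \<omega> \<partial>\<Omega>)"
    proof (intro nn_integral_mono)
      fix \<omega> assume "\<omega> \<in> space \<Omega>"
      then show "ennreal (exp_neg (\<Sum>l. ennreal (?a (c / real (Suc j)) l \<omega>))) \<le> indicator ?A \<omega>"
        unfolding s by (auto simp: indicator_def ennreal_mult_top exp_neg_def[of \<top>])
    qed
    finally show ?thesis by simp
  qed
  moreover have "(\<lambda>j. ennreal (exp (- (tier_density lam_M lam_P lam_E t * ppp_laplace_exponent m \<alpha> (c / real (Suc j))))))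
      \<longlonglongrightarrow> ennreal (exp (- (tier_density lam_M lam_P lam_E t * 0)))"
    using \<alpha> c by (intro tendsto_ennrealI tendsto_intros ppp_laplace_exponent_tendsto_0) auto
  ultimately have "ennreal (exp (- (tier_density lam_M lam_P lam_E t * 0))) \<le> emeasure \<Omega> ?A"
    by (intro LIMSEQ_le_const2) auto
  then have "prob ?A = 1"
    by (intro antisym) (auto simp: emeasure_eq_measure)
  then have "AE \<omega> in \<Omega>. \<omega> \<in> ?A" by (simp add: prob_eq_1)
  moreover have "AE \<omega> in \<Omega>. \<forall>l. 0 \<le> h (g l) \<omega>"
    by (simp add: AE_all_countable AE_gain_nonneg)
  ultimately show ?thesis
  proof eventually_elim
    case (elim \<omega>)
    then have "\<forall>l. 0 \<le> ?a c l \<omega>" using c by simp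
    moreover from this have "summable (\<lambda>l. ?a c l \<omega>)"
      using elim by (intro summable_suminf_not_top) auto
    ultimately show ?case by simp
  qed
qed

lemma interference_laplace:
  fixes g :: "nat \<Rightarrow> link" and t :: tier and z :: "real^2" and \<alpha> c :: real and m :: nat
  assumes g: "inj g" and law: "\<And>l. gain_law N S (g l) = gamma_law m" and m: "1 \<le> m"
    and \<alpha>: "2 < \<alpha>" and c: "0 \<le> c"
  shows "(\<integral>\<^sup>+\<omega>. ennreal (exp (- (\<Sum>l. c * h (g l) \<omega> * dist z (X t l \<omega>) powr (- \<alpha>)))) \<partial>\<Omega>)
    = ennreal (exp (- (tier_density lam_M lam_P lam_E t * ppp_laplace_exponent m \<alpha> c)))"
proof -
  let ?a = "\<lambda>l \<omega>. c * h (g l) \<omega> * dist z (X t l \<omega>) powr (- \<alpha>)"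
  have "AE \<omega> in \<Omega>. ennreal (exp (- (\<Sum>l. ?a l \<omega>))) = ennreal (exp_neg (\<Sum>l. ennreal (?a l \<omega>)))"
    using AE_interference_summable[where z = z and t = t, OF assms]
  proof eventually_elim
    case (elim \<omega>)
    then have "(\<Sum>l. ennreal (?a l \<omega>)) = ennreal (\<Sum>l. ?a l \<omega>)" "0 \<le> (\<Sum>l. ?a l \<omega>)"
      by (auto intro: suminf_ennreal2 suminf_nonneg)
    then show ?case by simp
  qed
  then show ?thesis
    using interference_transform[where z = z and t = t, OF assms] by (subst nn_integral_cong_AE) auto
qed

section \<open>The strongest eavesdropper\<close>

definition eve_sinr :: "nat \<Rightarrow> real^2 \<Rightarrow> real^2 \<Rightarrow> config \<Rightarrow> real" where
  "eve_sinr k x b w = P_M / real S * gain (Eve_signal k) w * loss_M (dist x b)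
     / (P_M / real S * gain (Eve_intra k) w * loss_M (dist x b)
        + (\<Sum>l. P_M / real S * gain (Eve_MBS k l) w * loss_M (dist x (site (MBS_at k) l w)))
        + (\<Sum>j. P_P * gain (Eve_PBS k j) w * loss_P (dist x (site (PBS_at k) j w)))
        + \<delta>\<^sup>2)"

lemma SINR_eve_eq: "SINR_eve k \<omega> = eve_sinr k (X Eve k \<omega>) (X MBS (serving \<omega>) \<omega>) (config \<omega>)"
  by (simp add: SINR_eve_def eve_sinr_def eve_loss_def)

lemma measurable_loss [measurable]: "loss_M \<in> borel_measurable borel" "loss_P \<in> borel_measurable borel"
  unfolding loss_M_def[abs_def] loss_P_def[abs_def] by measurable

lemma measurable_eve_sinr [measurable (raw)]:
  assumes [measurable]: "x \<in> borel_measurable M'" "b \<in> borel_measurable M'" "w \<in> measurable M' config_space"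
  shows "(\<lambda>p. eve_sinr k (x p) (b p) (w p)) \<in> borel_measurable M'"
  unfolding eve_sinr_def by measurable

definition eve_exponent :: "real \<Rightarrow> real \<Rightarrow> real" where
  "eve_exponent \<gamma> r = \<gamma> * real S * \<delta>\<^sup>2 * r powr \<alpha>\<^sub>1 / (\<beta> * P_M)
     + lam_M * ppp_laplace_exponent S \<alpha>\<^sub>1 (\<gamma> * r powr \<alpha>\<^sub>1)
     + lam_P * ppp_laplace_exponent 1 \<alpha>\<^sub>2 (\<gamma> * real S * r powr \<alpha>\<^sub>1 * P_P / P_M)"

definition eve_ccdf :: "real \<Rightarrow> real \<Rightarrow> real" where
  "eve_ccdf \<gamma> r = exp (- eve_exponent \<gamma> r) * (\<gamma> + 1) powr (- (real S - 1))"

lemma AE_eve_interference: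
  "AE \<omega> in \<Omega>. let I = (\<lambda>l. P_M / real S * h (Eve_MBS k l) \<omega> * loss_M (dist x (X (MBS_at k) l \<omega>)));
      J = (\<lambda>j. P_P * h (Eve_PBS k j) \<omega> * loss_P (dist x (X (PBS_at k) j \<omega>)))
     in summable I \<and> 0 \<le> suminf I \<and> summable J \<and> 0 \<le> suminf J"
proof -
  have "AE \<omega> in \<Omega>. (\<forall>l. 0 \<le> P_M / real S * \<beta> * h (Eve_MBS k l) \<omega> * dist x (X (MBS_at k) l \<omega>) powr (- \<alpha>\<^sub>1))
            \<and> summable (\<lambda>l. P_M / real S * \<beta> * h (Eve_MBS k l) \<omega> * dist x (X (MBS_at k) l \<omega>) powr (- \<alpha>\<^sub>1))"
    using antennas params_pos path_loss_exponents
    by (intro AE_interference_summable[where m = S]) (auto simp: inj_def)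
  moreover have "AE \<omega> in \<Omega>. (\<forall>l. 0 \<le> P_P * \<beta> * h (Eve_PBS k l) \<omega> * dist x (X (PBS_at k) l \<omega>) powr (- \<alpha>\<^sub>2))
            \<and> summable (\<lambda>l. P_P * \<beta> * h (Eve_PBS k l) \<omega> * dist x (X (PBS_at k) l \<omega>) powr (- \<alpha>\<^sub>2))"
    using antennas params_pos path_loss_exponents
    by (intro AE_interference_summable[where m = 1]) (auto simp: inj_def exp_law_eq_gamma_law)
  ultimately show ?thesis
  proof eventually_elim
    case (elim \<omega>)
    have "P_M / real S * h (Eve_MBS k l) \<omega> * loss_M (dist x (X (MBS_at k) l \<omega>))
        = P_M / real S * \<beta> * h (Eve_MBS k l) \<omega> * dist x (X (MBS_at k) l \<omega>) powr (- \<alpha>\<^sub>1)" for l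
      by (simp add: loss_M_def)
    moreover have "P_P * h (Eve_PBS k l) \<omega> * loss_P (dist x (X (PBS_at k) l \<omega>))
        = P_P * \<beta> * h (Eve_PBS k l) \<omega> * dist x (X (PBS_at k) l \<omega>) powr (- \<alpha>\<^sub>2)" for l
      by (simp add: loss_P_def)
    ultimately show ?case using elim by (simp only: Let_def suminf_nonneg simp_thms)
  qed
qed

lemma eve_ccdf_at:
  assumes \<gamma>: "0 \<le> \<gamma>" and xb: "x \<noteq> b"
  shows "(\<integral>\<^sup>+\<omega>. indicator {w. \<gamma> < eve_sinr k x b w} (config \<omega>) \<partial>\<Omega>) = ennreal (eve_ccdf \<gamma> (dist x b))"
proof -
  define r where "r = dist x b"
  define c\<^sub>1 where "c\<^sub>1 = \<gamma> * r powr \<alpha>\<^sub>1"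
  define c\<^sub>2 where "c\<^sub>2 = \<gamma> * real S * r powr \<alpha>\<^sub>1 * P_P / P_M"
  define s where "s = \<gamma> * real S * r powr \<alpha>\<^sub>1 / (\<beta> * P_M)"
  define J\<^sub>1 where "J\<^sub>1 w = (\<Sum>l. c\<^sub>1 * gain (Eve_MBS k l) w * dist x (site (MBS_at k) l w) powr (- \<alpha>\<^sub>1))" for w
  define J\<^sub>2 where "J\<^sub>2 w = (\<Sum>l. c\<^sub>2 * gain (Eve_PBS k l) w * dist x (site (PBS_at k) l w) powr (- \<alpha>\<^sub>2))" for w
  define C where "C w = \<gamma> * gain (Eve_intra k) w + J\<^sub>1 w + J\<^sub>2 w + s * \<delta>\<^sup>2" for w
  have [measurable]: "J\<^sub>1 \<in> borel_measurable config_space" "J\<^sub>2 \<in> borel_measurable config_space"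
    unfolding J\<^sub>1_def J\<^sub>2_def by measurable
  have [measurable]: "C \<in> borel_measurable config_space"
    unfolding C_def by measurable
  have r: "r > 0" using xb by (simp add: r_def)
  have S: "real S > 0" using antennas by simp
  have nn: "c\<^sub>1 \<ge> 0" "c\<^sub>2 \<ge> 0" "s \<ge> 0"
    using \<gamma> params_pos S by (auto simp: c\<^sub>1_def c\<^sub>2_def s_def)
  \<comment> \<open>The event says that the exponential signal gain exceeds an independent threshold \<open>C\<close>, so its
    probability is the expectation of \<open>exp (- C)\<close>, which factorises.\<close>
  have equiv: "AE \<omega> in \<Omega>. (\<gamma> < eve_sinr k x b (config \<omega>) \<longleftrightarrow> C (config \<omega>) < h (Eve_signal k) \<omega>) \<and> 0 \<le> C (config \<omega>)"
    using AE_eve_interference[of k x] AE_gain_nonneg[of "Eve_intra k"]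
  proof eventually_elim
    case (elim \<omega>)
    let ?I = "\<lambda>l. P_M / real S * h (Eve_MBS k l) \<omega> * loss_M (dist x (X (MBS_at k) l \<omega>))"
    let ?J = "\<lambda>j. P_P * h (Eve_PBS k j) \<omega> * loss_P (dist x (X (PBS_at k) j \<omega>))"
    let ?L = "P_M / real S * loss_M r"
    have IJ: "summable ?I" "0 \<le> suminf ?I" "summable ?J" "0 \<le> suminf ?J" and h0: "0 \<le> h (Eve_intra k) \<omega>"
      using elim by (auto simp: Let_def)
    have L: "?L > 0" using params_pos S r by (simp add: loss_M_def)
    have sL: "s = \<gamma> / ?L"
      using params_pos S r by (simp add: s_def loss_M_def powr_minus field_simps)
    have "s * ?I l = c\<^sub>1 * h (Eve_MBS k l) \<omega> * dist x (X (MBS_at k) l \<omega>) powr (- \<alpha>\<^sub>1)" for l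
      using params_pos S by (simp add: s_def c\<^sub>1_def loss_M_def)
    then have "J\<^sub>1 (config \<omega>) = (\<Sum>l. s * ?I l)"
      unfolding J\<^sub>1_def site_config gain_config by (simp only:)
    then have J1: "J\<^sub>1 (config \<omega>) = s * suminf ?I"
      unfolding suminf_mult[OF IJ(1)] .
    have "s * ?J l = c\<^sub>2 * h (Eve_PBS k l) \<omega> * dist x (X (PBS_at k) l \<omega>) powr (- \<alpha>\<^sub>2)" for l
      using params_pos S by (simp add: s_def c\<^sub>2_def loss_P_def)
    then have "J\<^sub>2 (config \<omega>) = (\<Sum>l. s * ?J l)"
      unfolding J\<^sub>2_def site_config gain_config by (simp only:)
    then have J2: "J\<^sub>2 (config \<omega>) = s * suminf ?J"
      unfolding suminf_mult[OF IJ(3)] .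
    define D where "D = P_M / real S * h (Eve_intra k) \<omega> * loss_M r + suminf ?I + suminf ?J + \<delta>\<^sup>2"
    have D: "D > 0"
      using params_pos IJ h0 S unfolding D_def by (intro add_nonneg_pos add_nonneg_nonneg) (auto simp: loss_M_def)
    have CD: "C (config \<omega>) = \<gamma> * D / ?L"
    proof -
      have "\<gamma> * i + \<gamma> / (p * q) * A + \<gamma> / (p * q) * B + \<gamma> / (p * q) * d = \<gamma> * (p * i * q + A + B + d) / (p * q)"
        if "p * q > 0" for p q i A B d :: real
      proof -
        have "p \<noteq> 0" "q \<noteq> 0" using that by auto
        then show ?thesis by (simp add: field_simps)
      qed
      from this[OF L] show ?thesis
        unfolding C_def J1 J2 sL D_def gain_config .
    qed
    have "\<gamma> < eve_sinr k x b (config \<omega>) \<longleftrightarrow> \<gamma> < h (Eve_signal k) \<omega> * ?L / D"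
      by (simp add: eve_sinr_def D_def r_def mult_ac)
    also have "\<dots> \<longleftrightarrow> \<gamma> * D / ?L < h (Eve_signal k) \<omega>"
      using L D by (simp only: pos_less_divide_eq pos_divide_less_eq)
    finally have "\<gamma> < eve_sinr k x b (config \<omega>) \<longleftrightarrow> C (config \<omega>) < h (Eve_signal k) \<omega>"
      unfolding CD .
    moreover have "0 \<le> C (config \<omega>)"
      unfolding CD using \<gamma> D L by (intro divide_nonneg_pos mult_nonneg_nonneg less_imp_le[OF D])
    ultimately show ?case ..
  qed
  have J1_dep: "J\<^sub>1 w = J\<^sub>1 w'"
    if "w (Inl (MBS_at k)) = w' (Inl (MBS_at k))" "\<And>l. w (Inr (Eve_MBS k l)) = w' (Inr (Eve_MBS k l))" for w w'
    using that by (simp add: J\<^sub>1_def gain_def site_def)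
  have J2_dep: "J\<^sub>2 w = J\<^sub>2 w'"
    if "w (Inl (PBS_at k)) = w' (Inl (PBS_at k))" "\<And>l. w (Inr (Eve_PBS k l)) = w' (Inr (Eve_PBS k l))" for w w'
    using that by (simp add: J\<^sub>2_def gain_def site_def)
  have C_dep: "C w = C w'" if "\<And>i. i \<noteq> Inr (Eve_signal k) \<Longrightarrow> w i = w' i" for w w'
  proof -
    have "J\<^sub>1 w = J\<^sub>1 w'" "J\<^sub>2 w = J\<^sub>2 w'" by (intro J1_dep J2_dep that; simp)+
    moreover have "w (Inr (Eve_intra k)) = w' (Inr (Eve_intra k))" by (intro that) simp
    ultimately show ?thesis by (simp add: C_def gain_def)
  qed
  have "(\<integral>\<^sup>+\<omega>. indicator {w. \<gamma> < eve_sinr k x b w} (config \<omega>) \<partial>\<Omega>)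
      = (\<integral>\<^sup>+\<omega>. indicator {w. C w < gain (Eve_signal k) w} (config \<omega>) \<partial>\<Omega>)"
    using equiv by (intro nn_integral_cong_AE) (auto simp: indicator_def elim: eventually_mono)
  also have "\<dots> = (\<integral>\<^sup>+\<omega>. \<integral>\<^sup>+\<omega>'. indicator {w. C w < gain (Eve_signal k) w}
       (\<lambda>i. if i \<in> {Inr (Eve_signal k)} then config \<omega>' i else config \<omega> i) \<partial>\<Omega> \<partial>\<Omega>)"
    by (rule nn_integral_config_resample) measurable
  also have "\<dots> = (\<integral>\<^sup>+\<omega>. \<integral>\<^sup>+\<omega>'. indicator {C (config \<omega>)<..} (h (Eve_signal k) \<omega>') \<partial>\<Omega> \<partial>\<Omega>)"
  proof (intro nn_integral_cong)
    fix \<omega> \<omega>'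
    let ?w = "\<lambda>i. if i \<in> {Inr (Eve_signal k)} then config \<omega>' i else config \<omega> i"
    have "C ?w = C (config \<omega>)" by (rule C_dep) simp
    moreover have "gain (Eve_signal k) ?w = gain (Eve_signal k) (config \<omega>')"
      by (simp add: gain_def del: gain_config)
    then have "gain (Eve_signal k) ?w = h (Eve_signal k) \<omega>'"
      by (simp only: gain_config)
    ultimately show "(indicator {w. C w < gain (Eve_signal k) w} ?w :: ennreal) = indicator {C (config \<omega>)<..} (h (Eve_signal k) \<omega>')"
      by (simp add: indicator_def)
  qed
  also have "\<dots> = (\<integral>\<^sup>+\<omega>. emeasure exp_law {C (config \<omega>)<..} \<partial>\<Omega>)"
    by (intro nn_integral_cong, subst nn_integral_gain) (auto simp: exp_law_def)
  also have "\<dots> = (\<integral>\<^sup>+\<omega>. ennreal (exp (- C (config \<omega>))) \<partial>\<Omega>)"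
    using equiv by (intro nn_integral_cong_AE) (auto simp: emeasure_exp_law_greater elim: eventually_mono)
  also have "\<dots> = (\<integral>\<^sup>+\<omega>. ennreal (exp (- (s * \<delta>\<^sup>2))) * (ennreal (exp (- (\<gamma> * gain (Eve_intra k) (config \<omega>))))
      * (ennreal (exp (- J\<^sub>1 (config \<omega>))) * ennreal (exp (- J\<^sub>2 (config \<omega>))))) \<partial>\<Omega>)"
  proof (intro nn_integral_cong)
    fix \<omega>
    have "exp (- C (config \<omega>)) = exp (- (s * \<delta>\<^sup>2)) * (exp (- (\<gamma> * gain (Eve_intra k) (config \<omega>)))
        * (exp (- J\<^sub>1 (config \<omega>)) * exp (- J\<^sub>2 (config \<omega>))))"
      unfolding exp_add[symmetric] C_def by (rule arg_cong[where f = exp]) linarith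
    then show "ennreal (exp (- C (config \<omega>))) = ennreal (exp (- (s * \<delta>\<^sup>2))) * (ennreal (exp (- (\<gamma> * gain (Eve_intra k) (config \<omega>))))
        * (ennreal (exp (- J\<^sub>1 (config \<omega>))) * ennreal (exp (- J\<^sub>2 (config \<omega>)))))"
      by (simp only: ennreal_mult exp_ge_zero mult_nonneg_nonneg)
  qed
  also have "\<dots> = ennreal (exp (- (s * \<delta>\<^sup>2))) * (\<integral>\<^sup>+\<omega>. ennreal (exp (- (\<gamma> * gain (Eve_intra k) (config \<omega>))))
      * (ennreal (exp (- J\<^sub>1 (config \<omega>))) * ennreal (exp (- J\<^sub>2 (config \<omega>)))) \<partial>\<Omega>)"
    by (rule nn_integral_cmult) measurable
  also have "(\<integral>\<^sup>+\<omega>. ennreal (exp (- (\<gamma> * gain (Eve_intra k) (config \<omega>))))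
      * (ennreal (exp (- J\<^sub>1 (config \<omega>))) * ennreal (exp (- J\<^sub>2 (config \<omega>)))) \<partial>\<Omega>)
     = (\<integral>\<^sup>+\<omega>. ennreal (exp (- (\<gamma> * gain (Eve_intra k) (config \<omega>)))) \<partial>\<Omega>)
      * (\<integral>\<^sup>+\<omega>. ennreal (exp (- J\<^sub>1 (config \<omega>))) * ennreal (exp (- J\<^sub>2 (config \<omega>))) \<partial>\<Omega>)"
  proof (rule nn_integral_config_indep_mult[where K = "{Inr (Eve_intra k)}"
        and f = "\<lambda>w. ennreal (exp (- (\<gamma> * gain (Eve_intra k) w)))"
        and g = "\<lambda>w. ennreal (exp (- J\<^sub>1 w)) * ennreal (exp (- J\<^sub>2 w))"])
    show "ennreal (exp (- (\<gamma> * gain (Eve_intra k) w))) = ennreal (exp (- (\<gamma> * gain (Eve_intra k) w')))"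
      if "\<And>i. i \<in> {Inr (Eve_intra k)} \<Longrightarrow> w i = w' i" for w w'
      using that[of "Inr (Eve_intra k)"] by (simp add: gain_def)
    show "ennreal (exp (- J\<^sub>1 w)) * ennreal (exp (- J\<^sub>2 w)) = ennreal (exp (- J\<^sub>1 w')) * ennreal (exp (- J\<^sub>2 w'))"
      if "\<And>i. i \<notin> {Inr (Eve_intra k)} \<Longrightarrow> w i = w' i" for w w'
    proof -
      have "J\<^sub>1 w = J\<^sub>1 w'" "J\<^sub>2 w = J\<^sub>2 w'" by (intro J1_dep J2_dep that; simp)+
      then show ?thesis by (simp only:)
    qed
  qed measurable
  also have "(\<integral>\<^sup>+\<omega>. ennreal (exp (- J\<^sub>1 (config \<omega>))) * ennreal (exp (- J\<^sub>2 (config \<omega>))) \<partial>\<Omega>)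
     = (\<integral>\<^sup>+\<omega>. ennreal (exp (- J\<^sub>1 (config \<omega>))) \<partial>\<Omega>) * (\<integral>\<^sup>+\<omega>. ennreal (exp (- J\<^sub>2 (config \<omega>))) \<partial>\<Omega>)"
  proof (rule nn_integral_config_indep_mult[where K = "insert (Inl (MBS_at k)) (range (\<lambda>l. Inr (Eve_MBS k l)))"
        and f = "\<lambda>w. ennreal (exp (- J\<^sub>1 w))" and g = "\<lambda>w. ennreal (exp (- J\<^sub>2 w))"])
    show "ennreal (exp (- J\<^sub>1 w)) = ennreal (exp (- J\<^sub>1 w'))"
      if "\<And>i. i \<in> insert (Inl (MBS_at k)) (range (\<lambda>l. Inr (Eve_MBS k l))) \<Longrightarrow> w i = w' i" for w w'
    proof -
      have "J\<^sub>1 w = J\<^sub>1 w'" by (intro J1_dep that) auto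
      then show ?thesis by (simp only:)
    qed
    show "ennreal (exp (- J\<^sub>2 w)) = ennreal (exp (- J\<^sub>2 w'))"
      if "\<And>i. i \<notin> insert (Inl (MBS_at k)) (range (\<lambda>l. Inr (Eve_MBS k l))) \<Longrightarrow> w i = w' i" for w w'
    proof -
      have "J\<^sub>2 w = J\<^sub>2 w'" by (intro J2_dep that) auto
      then show ?thesis by (simp only:)
    qed
  qed measurable
  also have "(\<integral>\<^sup>+\<omega>. ennreal (exp (- (\<gamma> * gain (Eve_intra k) (config \<omega>)))) \<partial>\<Omega>) = ennreal (inverse ((1 + \<gamma>) ^ (S - 1)))"
    using \<gamma> by (simp add: nn_integral_gain[where f = "\<lambda>y. ennreal (exp (- (\<gamma> * y)))"] nn_integral_exp_gamma_law)
  also have "(\<integral>\<^sup>+\<omega>. ennreal (exp (- J\<^sub>1 (config \<omega>))) \<partial>\<Omega>) = ennreal (exp (- (lam_M * ppp_laplace_exponent S \<alpha>\<^sub>1 c\<^sub>1)))"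
    unfolding J\<^sub>1_def site_config gain_config using nn antennas path_loss_exponents
    by (subst interference_laplace[where m = S]) (auto simp: inj_def)
  also have "(\<integral>\<^sup>+\<omega>. ennreal (exp (- J\<^sub>2 (config \<omega>))) \<partial>\<Omega>) = ennreal (exp (- (lam_P * ppp_laplace_exponent 1 \<alpha>\<^sub>2 c\<^sub>2)))"
    unfolding J\<^sub>2_def site_config gain_config using nn antennas path_loss_exponents
    by (subst interference_laplace[where m = 1]) (auto simp: inj_def exp_law_eq_gamma_law)
  also have "ennreal (exp (- (s * \<delta>\<^sup>2))) * (ennreal (inverse ((1 + \<gamma>) ^ (S - 1))) *
      (ennreal (exp (- (lam_M * ppp_laplace_exponent S \<alpha>\<^sub>1 c\<^sub>1))) * ennreal (exp (- (lam_P * ppp_laplace_exponent 1 \<alpha>\<^sub>2 c\<^sub>2)))))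
     = ennreal (exp (- (s * \<delta>\<^sup>2)) * (inverse ((1 + \<gamma>) ^ (S - 1)) *
      (exp (- (lam_M * ppp_laplace_exponent S \<alpha>\<^sub>1 c\<^sub>1)) * exp (- (lam_P * ppp_laplace_exponent 1 \<alpha>\<^sub>2 c\<^sub>2)))))"
    using \<gamma> by (simp add: ennreal_mult)
  also have "exp (- (s * \<delta>\<^sup>2)) * (inverse ((1 + \<gamma>) ^ (S - 1)) *
      (exp (- (lam_M * ppp_laplace_exponent S \<alpha>\<^sub>1 c\<^sub>1)) * exp (- (lam_P * ppp_laplace_exponent 1 \<alpha>\<^sub>2 c\<^sub>2)))) = eve_ccdf \<gamma> r"
  proof -
    have "real S - 1 = real (S - 1)" using antennas by (simp add: of_nat_diff)
    then have "(\<gamma> + 1) powr (- (real S - 1)) = inverse ((\<gamma> + 1) powr real (S - 1))"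
      by (simp only: powr_minus)
    also have "\<dots> = inverse ((1 + \<gamma>) ^ (S - 1))"
      using \<gamma> by (subst powr_realpow) (auto simp: add.commute)
    finally have "(\<gamma> + 1) powr (- (real S - 1)) = inverse ((1 + \<gamma>) ^ (S - 1))" .
    moreover have "exp (- eve_exponent \<gamma> r) = exp (- (s * \<delta>\<^sup>2)) * (exp (- (lam_M * ppp_laplace_exponent S \<alpha>\<^sub>1 c\<^sub>1)) * exp (- (lam_P * ppp_laplace_exponent 1 \<alpha>\<^sub>2 c\<^sub>2)))"
      by (simp add: eve_exponent_def s_def c\<^sub>1_def c\<^sub>2_def algebra_simps flip: exp_add)
    ultimately show ?thesis by (simp add: eve_ccdf_def)
  qed
  finally show ?thesis by (simp add: r_def)
qed

lemma eve_exponent_nonneg: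
  assumes "0 \<le> \<gamma>"
  shows "0 \<le> eve_exponent \<gamma> r"
  unfolding eve_exponent_def using assms params_pos antennas path_loss_exponents
  by (intro add_nonneg_nonneg mult_nonneg_nonneg divide_nonneg_nonneg ppp_laplace_exponent_nonneg) auto

lemma eve_ccdf_bounds:
  assumes "0 \<le> \<gamma>"
  shows "0 \<le> eve_ccdf \<gamma> r" "eve_ccdf \<gamma> r \<le> 1"
proof -
  have "(\<gamma> + 1) powr (- (real S - 1)) \<le> 1"
    using assms antennas powr_mono[of "- (real S - 1)" 0 "\<gamma> + 1"] by simp
  then show "eve_ccdf \<gamma> r \<le> 1"
    unfolding eve_ccdf_def using eve_exponent_nonneg[OF assms] by (intro mult_le_one) auto
qed (simp add: eve_ccdf_def)

lemma measurable_eve_ccdf [measurable]: "eve_ccdf \<gamma> \<in> borel_measurable borel"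
  unfolding eve_ccdf_def[abs_def] eve_exponent_def ppp_laplace_exponent_def by measurable

lemma nn_integral_eve_ccdf:
  fixes b :: "real^2"
  assumes \<gamma>: "0 \<le> \<gamma>"
  shows "(\<integral>\<^sup>+x. ennreal (eve_ccdf \<gamma> (dist x b)) \<partial>lborel)
    = ennreal (2 * pi) * (\<integral>\<^sup>+r\<in>{0..}. ennreal (eve_ccdf \<gamma> r * r) \<partial>lborel)" (is "_ = _ * ?I")
proof -
  have "(\<integral>\<^sup>+x. ennreal (eve_ccdf \<gamma> (dist x b)) \<partial>lborel) = (\<integral>\<^sup>+x. ennreal (eve_ccdf \<gamma> (dist x b)) \<partial>distr lborel borel ((+) b))"
    by (simp add: lborel_distr_plus)
  also have "\<dots> = (\<integral>\<^sup>+y. ennreal (eve_ccdf \<gamma> (norm (y :: real^2) powr 1)) \<partial>lborel)"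
    by (subst nn_integral_distr) (auto simp: dist_norm)
  also have "\<dots> = (\<integral>\<^sup>+r\<in>{0..}. ennreal (eve_ccdf \<gamma> r) * ennreal (2 * pi / 1 * r powr (2 / 1 - 1)) \<partial>lborel)"
    by (rule nn_integral_norm_powr_plane) auto
  also have "\<dots> = (\<integral>\<^sup>+r. ennreal (2 * pi) * (ennreal (eve_ccdf \<gamma> r * r) * indicator {0..} r) \<partial>lborel)"
    using eve_ccdf_bounds[OF \<gamma>]
    by (intro nn_integral_cong) (auto simp: indicator_def mult_ac simp flip: ennreal_mult)
  also have "\<dots> = ennreal (2 * pi) * ?I"
    by (rule nn_integral_cmult) measurable
  finally show ?thesis .
qed

definition eve_cdf :: "real \<Rightarrow> real" where
  "eve_cdf \<gamma> = exp_neg (ennreal (2 * pi * lam_E) * (\<integral>\<^sup>+r\<in>{0..}. ennreal (eve_ccdf \<gamma> r * r) \<partial>lborel))"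

lemma eve_cdf_at:
  assumes \<gamma>: "0 \<le> \<gamma>"
  shows "(\<integral>\<^sup>+\<omega>. indicator {w. \<forall>k. eve_sinr k (site Eve k w) b w \<le> \<gamma>} (config \<omega>) \<partial>\<Omega>) = ennreal (eve_cdf \<gamma>)"
proof (rule LIMSEQ_unique)
  define f :: "nat \<Rightarrow> real^2 \<Rightarrow> config \<Rightarrow> ennreal" where "f k x w = indicator {w. eve_sinr k x b w \<le> \<gamma>} w" for k x w
  define v where "v x = (if x = b then 0 else eve_ccdf \<gamma> (dist x b))" for x
  define G :: "nat \<Rightarrow> (tier + link) set" where
    "G k = {Inl (MBS_at k), Inl (PBS_at k), Inr (Eve_signal k), Inr (Eve_intra k)}
       \<union> range (\<lambda>l. Inr (Eve_MBS k l)) \<union> range (\<lambda>l. Inr (Eve_PBS k l))" for k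
  have f_meas: "case_prod (f k) \<in> borel_measurable (borel \<Otimes>\<^sub>M config_space)" for k
    unfolding f_def by measurable
  have G_disj: "disjoint_family G"
    by (auto simp: disjoint_family_on_def G_def)
  have G_Eve: "Inl Eve \<notin> G k" for k by (auto simp: G_def)
  have f_dep: "f k x w = f k x w'" if "\<And>i. i \<in> G k \<Longrightarrow> w i = w' i" for k x w w'
    using that by (simp add: f_def indicator_def eve_sinr_def site_def gain_def G_def)
  have f_int: "(\<integral>\<^sup>+\<omega>. f k x (config \<omega>) \<partial>\<Omega>) = ennreal (1 - v x)" for k x
  proof (cases "x = b")
    case True
    then have "f k x w = 1" for w
      using \<gamma> by (simp add: f_def eve_sinr_def loss_M_def)
    then show ?thesis using True by (simp add: v_def emeasure_space_1)
  next
    case False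
    have "(\<integral>\<^sup>+\<omega>. f k x (config \<omega>) \<partial>\<Omega>) + ennreal (v x)
       = (\<integral>\<^sup>+\<omega>. f k x (config \<omega>) + indicator {w. \<gamma> < eve_sinr k x b w} (config \<omega>) \<partial>\<Omega>)"
      using eve_ccdf_at[OF \<gamma> False, of k] False
      by (subst nn_integral_add) (auto simp: v_def f_def)
    also have "\<dots> = (\<integral>\<^sup>+\<omega>. 1 \<partial>\<Omega>)"
      by (intro nn_integral_cong) (auto simp: f_def indicator_def)
    finally have "(\<integral>\<^sup>+\<omega>. f k x (config \<omega>) \<partial>\<Omega>) + ennreal (v x) = 1"
      by (simp add: emeasure_space_1)
    then have "(\<integral>\<^sup>+\<omega>. f k x (config \<omega>) \<partial>\<Omega>) = 1 - ennreal (v x)"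
      by (metis ennreal_add_diff_cancel_right ennreal_neq_top)
    then show ?thesis
      using eve_ccdf_bounds[OF \<gamma>] by (simp add: v_def flip: ennreal_1 ennreal_minus)
  qed
  have v_meas: "v \<in> borel_measurable borel" unfolding v_def by measurable
  have v01: "0 \<le> v x" "v x \<le> 1" for x
    using eve_ccdf_bounds[OF \<gamma>] by (auto simp: v_def)
  have "(\<lambda>n. \<integral>\<^sup>+\<omega>. (\<Prod>k<n. f k (X Eve k \<omega>) (config \<omega>)) \<partial>\<Omega>)
     \<longlonglongrightarrow> ennreal (exp_neg (ennreal (tier_density lam_M lam_P lam_E Eve) * (\<integral>\<^sup>+x. ennreal (v x) \<partial>lborel)))"
    by (rule nn_integral_marked_ppp_tendsto[OF f_meas G_disj G_Eve f_dep f_int v_meas v01])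
  also have "(\<integral>\<^sup>+x. ennreal (v x) \<partial>lborel) = (\<integral>\<^sup>+x. ennreal (eve_ccdf \<gamma> (dist x b)) \<partial>lborel)"
    by (intro nn_integral_cong_AE AE_I[of _ _ "{b}"]) (auto simp: v_def)
  also have "ennreal (tier_density lam_M lam_P lam_E Eve) * \<dots> = ennreal (2 * pi * lam_E) * (\<integral>\<^sup>+r\<in>{0..}. ennreal (eve_ccdf \<gamma> r * r) \<partial>lborel)"
    unfolding nn_integral_eve_ccdf[OF \<gamma>] using params_pos by (simp add: ennreal_mult' mult_ac)
  finally show "(\<lambda>n. \<integral>\<^sup>+\<omega>. (\<Prod>k<n. f k (X Eve k \<omega>) (config \<omega>)) \<partial>\<Omega>) \<longlonglongrightarrow> ennreal (eve_cdf \<gamma>)"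
    by (simp add: eve_cdf_def)
  show "(\<lambda>n. \<integral>\<^sup>+\<omega>. (\<Prod>k<n. f k (X Eve k \<omega>) (config \<omega>)) \<partial>\<Omega>)
     \<longlonglongrightarrow> (\<integral>\<^sup>+\<omega>. indicator {w. \<forall>k. eve_sinr k (site Eve k w) b w \<le> \<gamma>} (config \<omega>) \<partial>\<Omega>)"
  proof (rule nn_integral_dominated_convergence[where w = "\<lambda>_. 1"])
    show "AE \<omega> in \<Omega>. (\<lambda>n. \<Prod>k<n. f k (X Eve k \<omega>) (config \<omega>))
       \<longlonglongrightarrow> indicator {w. \<forall>k. eve_sinr k (site Eve k w) b w \<le> \<gamma>} (config \<omega>)"
    proof (rule AE_I2)
      fix \<omega>
      show "(\<lambda>n. \<Prod>k<n. f k (X Eve k \<omega>) (config \<omega>))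
       \<longlonglongrightarrow> indicator {w. \<forall>k. eve_sinr k (site Eve k w) b w \<le> \<gamma>} (config \<omega>)"
      proof (cases "\<forall>k. eve_sinr k (X Eve k \<omega>) b (config \<omega>) \<le> \<gamma>")
        case True
        then show ?thesis by (simp add: f_def)
      next
        case False
        then obtain m where "\<not> eve_sinr m (X Eve m \<omega>) b (config \<omega>) \<le> \<gamma>" by blast
        then have "f m (X Eve m \<omega>) (config \<omega>) = 0" by (simp add: f_def)
        then have "(\<Prod>k<n. f k (X Eve k \<omega>) (config \<omega>)) = 0" if "n \<ge> Suc m" for n
          using that by (intro prod_zero) auto
        then have "(\<lambda>n. \<Prod>k<n. f k (X Eve k \<omega>) (config \<omega>)) \<longlonglongrightarrow> 0"
          by (intro tendsto_eventually eventually_sequentiallyI)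
        then show ?thesis using False by simp
      qed
    qed
    show "AE \<omega> in \<Omega>. (\<Prod>k<n. f k (X Eve k \<omega>) (config \<omega>)) \<le> 1" for n
    proof (rule AE_I2)
      fix \<omega>
      show "(\<Prod>k<n. f k (X Eve k \<omega>) (config \<omega>)) \<le> 1"
        by (induction n) (auto simp: f_def indicator_def)
    qed
    show "(\<lambda>\<omega>. \<Prod>k<n. f k (X Eve k \<omega>) (config \<omega>)) \<in> borel_measurable \<Omega>" for n
      using f_meas by measurable
    show "(\<lambda>\<omega>. indicator {w. \<forall>k. eve_sinr k (site Eve k w) b w \<le> \<gamma>} (config \<omega>)) \<in> borel_measurable \<Omega>"
      by measurable
  qed (auto simp: emeasure_space_1)
qed

definition config_serving :: "config \<Rightarrow> nat" where
  "config_serving w = (LEAST i. \<forall>l. real (N - S + 1) * (P_M / real S) * loss_M (norm (site MBS l w))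
      \<le> real (N - S + 1) * (P_M / real S) * loss_M (norm (site MBS i w)))"

definition config_association :: "config set" where
  "config_association = {w. \<exists>i.
     (\<forall>l. real (N - S + 1) * (P_M / real S) * loss_M (norm (site MBS l w))
        \<le> real (N - S + 1) * (P_M / real S) * loss_M (norm (site MBS i w))) \<and>
     (\<forall>j. P_P * loss_P (norm (site PBS j w)) \<le> real (N - S + 1) * (P_M / real S) * loss_M (norm (site MBS i w)))}"

lemma measurable_pred_power_le:
  "Measurable.pred config_space (\<lambda>w. real (N - S + 1) * (P_M / real S) * loss_M (norm (site MBS l w))
      \<le> real (N - S + 1) * (P_M / real S) * loss_M (norm (site MBS i w)))"
  "Measurable.pred config_space (\<lambda>w. P_P * loss_P (norm (site PBS j w))
      \<le> real (N - S + 1) * (P_M / real S) * loss_M (norm (site MBS i w)))"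
  unfolding pred_def by (rule borel_measurable_le; measurable)+

lemma serving_eq: "serving \<omega> = config_serving (config \<omega>)"
  by (simp add: serving_def config_serving_def mean_power_M_def)

lemma mbs_association_eq: "mbs_association = {\<omega> \<in> space \<Omega>. config \<omega> \<in> config_association}"
  by (simp add: mbs_association_def config_association_def mean_power_M_def mean_power_P_def)

lemma measurable_config_serving [measurable]: "config_serving \<in> measurable config_space (count_space UNIV)"
proof -
  note [measurable] = measurable_pred_power_le
  show ?thesis
    unfolding config_serving_def[abs_def] by measurable
qed

lemma measurable_config_association [measurable]: "Measurable.pred config_space (\<lambda>w. w \<in> config_association)"
proof -
  note [measurable] = measurable_pred_power_le
  show ?thesis
    unfolding config_association_def mem_Collect_eq by measurable
qed

lemma measurable_serving [measurable]: "serving \<in> measurable \<Omega> (count_space UNIV)"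
  unfolding serving_eq[abs_def] by measurable

lemma mbs_association_sets [measurable]: "mbs_association \<in> events"
  unfolding mbs_association_eq by measurable

lemma measurable_serving_site [measurable]:
  "(\<lambda>w. site MBS (config_serving w) w) \<in> borel_measurable config_space"
  by (rule measurable_compose_countable) measurable

lemma measurable_SINR_eve [measurable]: "SINR_eve k \<in> borel_measurable \<Omega>"
proof -
  have "(\<lambda>\<omega>. eve_sinr k (X Eve k \<omega>) (site MBS (config_serving (config \<omega>)) (config \<omega>)) (config \<omega>)) \<in> borel_measurable \<Omega>"
    by (intro measurable_eve_sinr measurable_compose[OF measurable_config measurable_serving_site]) measurable
  then show ?thesis
    unfolding SINR_eve_eq[abs_def] serving_eq[abs_def] by simp
qed

lemma association_eve_cdf:
  assumes \<gamma>: "0 \<le> \<gamma>"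
  shows "prob {\<omega> \<in> mbs_association. \<forall>k. SINR_eve k \<omega> \<le> \<gamma>} = prob mbs_association * eve_cdf \<gamma>"
proof -
  \<comment> \<open>Association and the serving station depend only on the tiers kept fixed while all other
    coordinates are resampled.\<close>
  define K where "K = - {Inl MBS, Inl PBS :: tier + link}"
  define f :: "config \<Rightarrow> ennreal" where
    "f w = indicator config_association w * indicator {w. \<forall>k. eve_sinr k (site Eve k w) (site MBS (config_serving w) w) w \<le> \<gamma>} w" for w
  have f_meas: "f \<in> borel_measurable config_space"
    unfolding f_def by measurable
  have "emeasure \<Omega> {\<omega> \<in> mbs_association. \<forall>k. SINR_eve k \<omega> \<le> \<gamma>}
      = (\<integral>\<^sup>+\<omega>. indicator {\<omega> \<in> mbs_association. \<forall>k. SINR_eve k \<omega> \<le> \<gamma>} \<omega> \<partial>\<Omega>)"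
    by (rule nn_integral_indicator[symmetric]) measurable
  also have "\<dots> = (\<integral>\<^sup>+\<omega>. f (config \<omega>) \<partial>\<Omega>)"
    by (intro nn_integral_cong) (auto simp: f_def indicator_def SINR_eve_eq mbs_association_eq serving_eq)
  also have "\<dots> = (\<integral>\<^sup>+\<omega>. \<integral>\<^sup>+\<omega>'. f (\<lambda>i. if i \<in> K then config \<omega>' i else config \<omega> i) \<partial>\<Omega> \<partial>\<Omega>)"
    using f_meas by (rule nn_integral_config_resample)
  also have "\<dots> = (\<integral>\<^sup>+\<omega>. \<integral>\<^sup>+\<omega>'. indicator mbs_association \<omega> * indicator {w. \<forall>k. eve_sinr k (site Eve k w) (X MBS (serving \<omega>) \<omega>) w \<le> \<gamma>} (config \<omega>') \<partial>\<Omega> \<partial>\<Omega>)"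
  proof (intro nn_integral_cong)
    fix \<omega> \<omega>' assume \<omega>: "\<omega> \<in> space \<Omega>"
    let ?w = "\<lambda>i. if i \<in> K then config \<omega>' i else config \<omega> i"
    have "site MBS i ?w = site MBS i (config \<omega>)" "site PBS i ?w = site PBS i (config \<omega>)" for i
      by (simp_all add: site_def K_def del: site_config)
    then have base: "site MBS i ?w = X MBS i \<omega>" "site PBS i ?w = X PBS i \<omega>" for i
      by (simp_all only: site_config)
    have "eve_sinr k (site Eve k ?w) b ?w = eve_sinr k (site Eve k (config \<omega>')) b (config \<omega>')" for k b
      by (simp add: eve_sinr_def site_def gain_def K_def del: site_config gain_config)
    moreover have "config_serving ?w = serving \<omega>"
      unfolding serving_eq config_serving_def base site_config ..
    moreover have "?w \<in> config_association \<longleftrightarrow> \<omega> \<in> mbs_association"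
      unfolding mbs_association_eq config_association_def mem_Collect_eq base site_config using \<omega> by simp
    ultimately show "f ?w = indicator mbs_association \<omega> * indicator {w. \<forall>k. eve_sinr k (site Eve k w) (X MBS (serving \<omega>) \<omega>) w \<le> \<gamma>} (config \<omega>')"
      by (simp add: f_def base indicator_def)
  qed
  also have "\<dots> = (\<integral>\<^sup>+\<omega>. indicator mbs_association \<omega> * ennreal (eve_cdf \<gamma>) \<partial>\<Omega>)"
    by (intro nn_integral_cong, subst nn_integral_cmult) (auto simp: eve_cdf_at[OF \<gamma>])
  also have "\<dots> = emeasure \<Omega> mbs_association * ennreal (eve_cdf \<gamma>)"
    by (subst nn_integral_multc) auto
  finally show ?thesis
    by (simp add: emeasure_eq_measure eve_cdf_def flip: ennreal_mult)
qed

section \<open>Association with a macrocell\<close>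

lemma prob_no_points:
  assumes B: "B \<in> sets borel" "bounded B"
  shows "prob {\<omega> \<in> space \<Omega>. \<forall>i. X t i \<omega> \<notin> B} = exp (- (tier_density lam_M lam_P lam_E t * measure lborel B))"
proof -
  have ppp: "homogeneous_ppp \<Omega> (tier_density lam_M lam_P lam_E t) (X t)" by (rule locations)
  have "indep_vars (\<lambda>_. count_space UNIV) (\<lambda>j :: nat. point_count (X t) B) {0}"
    using ppp B unfolding homogeneous_ppp_def
    by (elim conjE, elim allE[where x = "{0}"], elim allE[where x = "\<lambda>_. B"]) (auto simp: disjoint_family_on_def)
  then have [measurable]: "point_count (X t) B \<in> measurable \<Omega> (count_space UNIV)"
    by (simp add: indep_vars_def)
  note [measurable] = B(1)
  have "AE \<omega> in \<Omega>. finite {i. X t i \<omega> \<in> B}"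
    using ppp B by (simp add: homogeneous_ppp_def)
  then have "prob {\<omega> \<in> space \<Omega>. \<forall>i. X t i \<omega> \<notin> B} = prob {\<omega> \<in> space \<Omega>. point_count (X t) B \<omega> = 0}"
    by (intro finite_measure_eq_AE) (auto simp: point_count_def elim!: eventually_mono)
  also have "\<dots> = exp (- (tier_density lam_M lam_P lam_E t * measure lborel B))"
    using ppp B by (simp add: homogeneous_ppp_def)
  finally show ?thesis .
qed

lemma AE_finite_points:
  assumes "B \<in> sets borel" "bounded B"
  shows "AE \<omega> in \<Omega>. finite {i. X t i \<omega> \<in> B}"
  using locations[of t] assms by (simp add: homogeneous_ppp_def)

lemma nn_integral_config_indicator:
  assumes [measurable]: "Measurable.pred config_space (\<lambda>w. w \<in> A)"
  shows "(\<integral>\<^sup>+\<omega>. indicator A (config \<omega>) \<partial>\<Omega>) = emeasure \<Omega> {\<omega> \<in> space \<Omega>. config \<omega> \<in> A}"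
proof -
  have "(\<integral>\<^sup>+\<omega>. indicator A (config \<omega>) \<partial>\<Omega>) = (\<integral>\<^sup>+\<omega>. indicator {\<omega> \<in> space \<Omega>. config \<omega> \<in> A} \<omega> \<partial>\<Omega>)"
    by (intro nn_integral_cong) (auto split: split_indicator)
  also have "\<dots> = emeasure \<Omega> {\<omega> \<in> space \<Omega>. config \<omega> \<in> A}"
    by (rule nn_integral_indicator) measurable
  finally show ?thesis .
qed

lemma AE_points_nonzero: "AE \<omega> in \<Omega>. \<forall>i. X t i \<omega> \<noteq> 0"
proof -
  have "prob {\<omega> \<in> space \<Omega>. \<forall>i. X t i \<omega> \<notin> {0}} = 1"
    by (subst prob_no_points) auto
  then have "AE \<omega> in \<Omega>. \<omega> \<in> {\<omega> \<in> space \<Omega>. \<forall>i. X t i \<omega> \<notin> {0}}"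
    by (subst (asm) prob_eq_1) auto
  then show ?thesis by (auto elim: eventually_mono)
qed

lemma prob_mbs_association_pos: "0 < prob mbs_association"
proof -
  define q where "q = real (N - S + 1) * (P_M / real S)"
  define R where "R = (P_P / q) powr (1 / \<alpha>\<^sub>2)"
  have q: "q > 0" using antennas params_pos by (simp add: q_def)
  have R: "R > 0" using q params_pos by (simp add: R_def)
  have R_powr: "P_P * R powr (- \<alpha>\<^sub>2) = q"
    using q params_pos path_loss_exponents by (simp add: R_def powr_powr powr_minus_divide)
  define A\<^sub>1 where "A\<^sub>1 = {w. \<exists>i. site MBS i w \<in> cball 0 1}"
  define A\<^sub>2 where "A\<^sub>2 = {w. \<forall>j. site PBS j w \<notin> cball 0 R}"
  have [measurable]: "Measurable.pred config_space (\<lambda>w. w \<in> A\<^sub>1)" "Measurable.pred config_space (\<lambda>w. w \<in> A\<^sub>2)"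
    unfolding A\<^sub>1_def A\<^sub>2_def mem_Collect_eq mem_cball by measurable
  have A1: "prob {\<omega> \<in> space \<Omega>. config \<omega> \<in> A\<^sub>1} > 0"
  proof -
    have "prob {\<omega> \<in> space \<Omega>. config \<omega> \<in> A\<^sub>1} = 1 - prob {\<omega> \<in> space \<Omega>. \<forall>i. X MBS i \<omega> \<notin> cball 0 1}"
      by (subst prob_compl[symmetric]) (auto simp: A\<^sub>1_def intro!: arg_cong[where f = prob])
    also have "\<dots> > 0"
      using params_pos by (subst prob_no_points) (auto simp: content_cball eval_unit_ball_vol)
    finally show ?thesis .
  qed
  have A2: "prob {\<omega> \<in> space \<Omega>. config \<omega> \<in> A\<^sub>2} > 0"
    using prob_no_points[of "cball 0 R" PBS] by (simp add: A\<^sub>2_def)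
  have "emeasure \<Omega> {\<omega> \<in> space \<Omega>. config \<omega> \<in> A\<^sub>1 \<and> config \<omega> \<in> A\<^sub>2}
      = (\<integral>\<^sup>+\<omega>. indicator {\<omega> \<in> space \<Omega>. config \<omega> \<in> A\<^sub>1 \<and> config \<omega> \<in> A\<^sub>2} \<omega> \<partial>\<Omega>)"
    by (rule nn_integral_indicator[symmetric]) measurable
  also have "\<dots> = (\<integral>\<^sup>+\<omega>. indicator A\<^sub>1 (config \<omega>) * indicator A\<^sub>2 (config \<omega>) \<partial>\<Omega>)"
    by (intro nn_integral_cong) (auto simp: indicator_def)
  also have "\<dots> = (\<integral>\<^sup>+\<omega>. indicator A\<^sub>1 (config \<omega>) \<partial>\<Omega>) * (\<integral>\<^sup>+\<omega>. indicator A\<^sub>2 (config \<omega>) \<partial>\<Omega>)"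
    by (rule nn_integral_config_indep_mult[where K = "{Inl MBS}"])
       (measurable, auto simp: A\<^sub>1_def A\<^sub>2_def site_def indicator_def)
  also have "(\<integral>\<^sup>+\<omega>. indicator A\<^sub>1 (config \<omega>) \<partial>\<Omega>) = emeasure \<Omega> {\<omega> \<in> space \<Omega>. config \<omega> \<in> A\<^sub>1}"
    by (rule nn_integral_config_indicator) measurable
  also have "(\<integral>\<^sup>+\<omega>. indicator A\<^sub>2 (config \<omega>) \<partial>\<Omega>) = emeasure \<Omega> {\<omega> \<in> space \<Omega>. config \<omega> \<in> A\<^sub>2}"
    by (rule nn_integral_config_indicator) measurable
  finally have "0 < prob {\<omega> \<in> space \<Omega>. config \<omega> \<in> A\<^sub>1 \<and> config \<omega> \<in> A\<^sub>2}"
    using A1 A2 by (simp add: emeasure_eq_measure flip: ennreal_mult)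
  also have "\<dots> \<le> prob mbs_association"
  proof (rule finite_measure_mono_AE)
    have "AE \<omega> in \<Omega>. finite {i. X MBS i \<omega> \<in> cball 0 1}"
      by (rule AE_finite_points) auto
    then show "AE \<omega> in \<Omega>. \<omega> \<in> {\<omega> \<in> space \<Omega>. config \<omega> \<in> A\<^sub>1 \<and> config \<omega> \<in> A\<^sub>2} \<longrightarrow> \<omega> \<in> mbs_association"
      using AE_points_nonzero[of MBS]
    proof eventually_elim
      case (elim \<omega>)
      show ?case
      proof
        assume "\<omega> \<in> {\<omega> \<in> space \<Omega>. config \<omega> \<in> A\<^sub>1 \<and> config \<omega> \<in> A\<^sub>2}"
        then have \<omega>: "\<omega> \<in> space \<Omega>" and ne: "{i. X MBS i \<omega> \<in> cball 0 1} \<noteq> {}" and far: "\<forall>j. \<not> norm (X PBS j \<omega>) \<le> R"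
          by (auto simp: A\<^sub>1_def A\<^sub>2_def)
        define i where "i = arg_min_on (\<lambda>i. norm (X MBS i \<omega>)) {i. X MBS i \<omega> \<in> cball 0 1}"
        have i: "norm (X MBS i \<omega>) \<le> 1"
          using arg_min_if_finite(1)[OF elim(1) ne, of "\<lambda>i. norm (X MBS i \<omega>)"] by (simp add: i_def)
        have min: "norm (X MBS i \<omega>) \<le> norm (X MBS l \<omega>)" for l
        proof (cases "X MBS l \<omega> \<in> cball 0 1")
          case True
          then show ?thesis
            using arg_min_least[OF elim(1) ne, of l "\<lambda>i. norm (X MBS i \<omega>)"] by (simp add: i_def)
        next
          case False
          then show ?thesis using i by simp
        qed
        have pos: "0 < norm (X MBS l \<omega>)" for l using elim by simp
        have "mean_power_M l \<omega> \<le> mean_power_M i \<omega>" for l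
        proof -
          have "norm (X MBS l \<omega>) powr (- \<alpha>\<^sub>1) \<le> norm (X MBS i \<omega>) powr (- \<alpha>\<^sub>1)"
            using pos[of i] min[of l] path_loss_exponents by (intro powr_mono2') auto
          then show ?thesis
            unfolding mean_power_M_def loss_M_def q_def[symmetric] using q params_pos by simp
        qed
        moreover have "mean_power_P j \<omega> \<le> mean_power_M i \<omega>" for j
        proof -
          have "P_P * norm (X PBS j \<omega>) powr (- \<alpha>\<^sub>2) \<le> P_P * R powr (- \<alpha>\<^sub>2)"
            using R spec[OF far, of j] path_loss_exponents params_pos
            by (intro mult_left_mono powr_mono2') auto
          also have "\<dots> = q * 1 powr (- \<alpha>\<^sub>1)" by (simp add: R_powr)
          also have "\<dots> \<le> q * norm (X MBS i \<omega>) powr (- \<alpha>\<^sub>1)"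
            using q pos[of i] i path_loss_exponents by (intro mult_left_mono powr_mono2') auto
          finally have "\<beta> * (P_P * norm (X PBS j \<omega>) powr (- \<alpha>\<^sub>2)) \<le> \<beta> * (q * norm (X MBS i \<omega>) powr (- \<alpha>\<^sub>1))"
            using params_pos by simp
          then show ?thesis
            unfolding mean_power_M_def mean_power_P_def loss_M_def loss_P_def q_def[symmetric]
            by (simp add: mult_ac)
        qed
        ultimately show "\<omega> \<in> mbs_association"
          using \<omega> by (auto simp: mbs_association_def)
      qed
    qed
  qed simp
  finally show ?thesis .
qed

lemma prob_space_cond_space: "prob_space cond_space"
  unfolding cond_space_def using prob_mbs_association_pos
  by (intro prob_space_uniform_measure) (auto simp: emeasure_eq_measure)

lemma space_cond_space [simp]: "space cond_space = space \<Omega>"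
  by (simp add: cond_space_def)

lemma sets_cond_space [simp, measurable_cong]: "sets cond_space = sets \<Omega>"
  by (simp add: cond_space_def)

lemma measure_cond_space:
  assumes "A \<in> events"
  shows "measure cond_space A = prob (mbs_association \<inter> A) / prob mbs_association"
  unfolding cond_space_def using prob_mbs_association_pos assms
  by (intro measure_uniform_measure) (auto simp: emeasure_eq_measure)

lemma AE_cond_space: "AE \<omega> in \<Omega>. P \<omega> \<Longrightarrow> AE \<omega> in cond_space. P \<omega>"
  unfolding cond_space_def by (intro AE_uniform_measureI) (auto elim: eventually_mono)

lemma cond_prob_all_eve_le:
  assumes "0 \<le> \<gamma>"
  shows "measure cond_space {\<omega> \<in> space \<Omega>. \<forall>k. SINR_eve k \<omega> \<le> \<gamma>} = eve_cdf \<gamma>"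
proof -
  have "mbs_association \<inter> {\<omega> \<in> space \<Omega>. \<forall>k. SINR_eve k \<omega> \<le> \<gamma>} = {\<omega> \<in> mbs_association. \<forall>k. SINR_eve k \<omega> \<le> \<gamma>}"
    using sets.sets_into_space[OF mbs_association_sets] by auto
  then show ?thesis
    using prob_mbs_association_pos by (subst measure_cond_space) (auto simp: association_eve_cdf[OF assms])
qed

lemma eve_ccdf_0 [simp]: "eve_ccdf 0 r = 1"
  by (simp add: eve_ccdf_def eve_exponent_def ppp_laplace_exponent_def)

lemma eve_cdf_0: "eve_cdf 0 = 0"
proof -
  have "of_nat n \<le> emeasure lborel {1 :: real..}" for n :: nat
  proof -
    have "emeasure lborel {1 :: real..1 + real n} \<le> emeasure lborel {1 :: real..}"
      by (intro emeasure_mono) auto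
    then show ?thesis by (simp add: ennreal_of_nat_eq_real_of_nat)
  qed
  then have "(SUP n. of_nat n :: ennreal) \<le> emeasure lborel {1 :: real..}"
    by (intro SUP_least)
  then have "\<infinity> \<le> emeasure lborel {1 :: real..}"
    by (simp add: ennreal_SUP_of_nat_eq_top)
  also have "\<dots> = (\<integral>\<^sup>+r. indicator {1 :: real..} r \<partial>lborel)" by simp
  also have "\<dots> \<le> (\<integral>\<^sup>+r\<in>{0..}. ennreal (eve_ccdf 0 r * r) \<partial>lborel)"
    by (intro nn_integral_mono) (auto simp: indicator_def)
  finally have "(\<integral>\<^sup>+r\<in>{0..}. ennreal (eve_ccdf 0 r * r) \<partial>lborel) = \<infinity>"
    by (simp add: top_unique)
  then show ?thesis
    using params_pos by (simp add: eve_cdf_def ennreal_mult_top exp_neg_def)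
qed

definition eve_noise_rate :: real where
  "eve_noise_rate = real S * \<delta>\<^sup>2 / (\<beta> * P_M)"

lemma eve_noise_rate_pos: "0 < eve_noise_rate"
  using params_pos antennas by (simp add: eve_noise_rate_def)

lemma eve_ccdf_le_noise:
  assumes "0 \<le> \<gamma>\<^sub>0" "\<gamma>\<^sub>0 \<le> \<gamma>"
  shows "eve_ccdf \<gamma> r \<le> exp (- (\<gamma>\<^sub>0 * eve_noise_rate * r powr \<alpha>\<^sub>1))"
proof -
  have "\<gamma>\<^sub>0 * eve_noise_rate * r powr \<alpha>\<^sub>1 \<le> \<gamma> * eve_noise_rate * r powr \<alpha>\<^sub>1"
    using assms eve_noise_rate_pos by (intro mult_right_mono) auto
  also have "\<dots> \<le> eve_exponent \<gamma> r"
  proof -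
    have "0 \<le> lam_M * ppp_laplace_exponent S \<alpha>\<^sub>1 (\<gamma> * r powr \<alpha>\<^sub>1)"
      "0 \<le> lam_P * ppp_laplace_exponent 1 \<alpha>\<^sub>2 (\<gamma> * real S * r powr \<alpha>\<^sub>1 * P_P / P_M)"
      using params_pos antennas path_loss_exponents
      by (auto intro!: mult_nonneg_nonneg ppp_laplace_exponent_nonneg)
    then show ?thesis
      unfolding eve_exponent_def eve_noise_rate_def by (simp add: mult_ac)
  qed
  finally have "exp (- eve_exponent \<gamma> r) \<le> exp (- (\<gamma>\<^sub>0 * eve_noise_rate * r powr \<alpha>\<^sub>1))" by simp
  moreover have "(\<gamma> + 1) powr (- (real S - 1)) \<le> 1"
    using assms antennas powr_mono[of "- (real S - 1)" 0 "\<gamma> + 1"] by simp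
  ultimately show ?thesis
    unfolding eve_ccdf_def using mult_mono[of "exp (- eve_exponent \<gamma> r)" _ "(\<gamma> + 1) powr (- (real S - 1))" 1] by simp
qed

lemma nn_integral_noise_finite:
  assumes c: "0 < c"
  shows "(\<integral>\<^sup>+r. ennreal (exp (- (c * r powr \<alpha>\<^sub>1)) * r) * indicator {0..} r \<partial>lborel) < \<infinity>"
proof -
  have "(\<integral>\<^sup>+r. ennreal (exp (- (c * r powr \<alpha>\<^sub>1)) * r) * indicator {0..} r \<partial>lborel)
      \<le> (\<integral>\<^sup>+r. ennreal (exp c) * (ennreal (r powr (2 - 1) * exp (- (c * r))) * indicator {0..} r) \<partial>lborel)"
  proof (intro nn_integral_mono)
    fix r :: real
    show "ennreal (exp (- (c * r powr \<alpha>\<^sub>1)) * r) * indicator {0..} r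
        \<le> ennreal (exp c) * (ennreal (r powr (2 - 1) * exp (- (c * r))) * indicator {0..} r)"
    proof (cases "r \<ge> 0")
      case True
      have "r \<le> r powr \<alpha>\<^sub>1 + 1"
      proof (cases "r \<le> 1")
        case True
        then show ?thesis using powr_ge_zero[of r "\<alpha>\<^sub>1"] by linarith
      next
        case False
        then have "r powr 1 \<le> r powr \<alpha>\<^sub>1" using path_loss_exponents by (intro powr_mono) auto
        then show ?thesis using False by simp
      qed
      then have "c * r \<le> c * (r powr \<alpha>\<^sub>1 + 1)" using c by (intro mult_left_mono) auto
      then have "exp (- (c * r powr \<alpha>\<^sub>1)) \<le> exp c * exp (- (c * r))"
        by (simp add: algebra_simps flip: exp_add)
      then have "exp (- (c * r powr \<alpha>\<^sub>1)) * r \<le> exp c * exp (- (c * r)) * r"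
        using True by (intro mult_right_mono)
      then show ?thesis
        using True by (simp add: mult_ac flip: ennreal_mult)
    qed simp
  qed
  also have "\<dots> = ennreal (exp c) * ennreal (Gamma 2 * c powr (- 2))"
    by (subst nn_integral_cmult, measurable, subst nn_integral_powr_exp[OF _ c]) auto
  also have "\<dots> < \<infinity>" by (simp add: ennreal_mult_less_top)
  finally show ?thesis .
qed

lemma tendsto_eve_integral:
  assumes \<gamma>\<^sub>0: "0 < \<gamma>\<^sub>0" and \<gamma>: "\<And>n. \<gamma>\<^sub>0 \<le> \<gamma> n"
    and lim: "\<And>r. 0 < r \<Longrightarrow> (\<lambda>n. eve_ccdf (\<gamma> n) r) \<longlonglongrightarrow> L r" and [measurable]: "L \<in> borel_measurable borel"
  shows "(\<lambda>n. \<integral>\<^sup>+r\<in>{0..}. ennreal (eve_ccdf (\<gamma> n) r * r) \<partial>lborel) \<longlonglongrightarrow> (\<integral>\<^sup>+r\<in>{0..}. ennreal (L r * r) \<partial>lborel)"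
proof (rule nn_integral_dominated_convergence[where w = "\<lambda>r. ennreal (exp (- (\<gamma>\<^sub>0 * eve_noise_rate * r powr \<alpha>\<^sub>1)) * r) * indicator {0..} r"])
  show "AE r in lborel. ennreal (eve_ccdf (\<gamma> n) r * r) * indicator {0..} r
      \<le> ennreal (exp (- (\<gamma>\<^sub>0 * eve_noise_rate * r powr \<alpha>\<^sub>1)) * r) * indicator {0..} r" for n
    using eve_ccdf_le_noise[OF less_imp_le[OF \<gamma>\<^sub>0] \<gamma>]
    by (intro AE_I2) (auto simp: indicator_def intro!: ennreal_leI mult_right_mono)
  show "(\<integral>\<^sup>+r. ennreal (exp (- (\<gamma>\<^sub>0 * eve_noise_rate * r powr \<alpha>\<^sub>1)) * r) * indicator {0..} r \<partial>lborel) < \<infinity>"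
    using \<gamma>\<^sub>0 eve_noise_rate_pos by (intro nn_integral_noise_finite) auto
  show "AE r in lborel. (\<lambda>n. ennreal (eve_ccdf (\<gamma> n) r * r) * indicator {0..} r) \<longlonglongrightarrow> ennreal (L r * r) * indicator {0..} r"
  proof (rule AE_I2)
    fix r :: real
    consider "r < 0" | "r = 0" | "r > 0" by linarith
    then show "(\<lambda>n. ennreal (eve_ccdf (\<gamma> n) r * r) * indicator {0..} r) \<longlonglongrightarrow> ennreal (L r * r) * indicator {0..} r"
    proof cases
      case 3
      then have "(\<lambda>n. ennreal (eve_ccdf (\<gamma> n) r * r)) \<longlonglongrightarrow> ennreal (L r * r)"
        by (intro tendsto_ennrealI tendsto_intros lim)
      with 3 show ?thesis by simp
    qed auto
  qed
qed measurable

lemma tendsto_eve_cdf: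
  assumes "0 < \<gamma>\<^sub>0" "\<And>n. \<gamma>\<^sub>0 \<le> \<gamma> n"
    and "\<And>r. 0 < r \<Longrightarrow> (\<lambda>n. eve_ccdf (\<gamma> n) r) \<longlonglongrightarrow> L r" "L \<in> borel_measurable borel"
  shows "(\<lambda>n. eve_cdf (\<gamma> n)) \<longlonglongrightarrow> exp_neg (ennreal (2 * pi * lam_E) * (\<integral>\<^sup>+r\<in>{0..}. ennreal (L r * r) \<partial>lborel))"
  unfolding eve_cdf_def using assms
  by (intro tendsto_exp_neg ennreal_tendsto_cmult tendsto_eve_integral) auto

lemma eve_cdf_at_top: "(\<lambda>n. eve_cdf (real (Suc n))) \<longlonglongrightarrow> 1"
proof -
  have "(\<lambda>n. eve_ccdf (real (Suc n)) r) \<longlonglongrightarrow> 0" if r: "0 < r" for r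
  proof (rule tendsto_sandwich[OF always_eventually always_eventually tendsto_const])
    show "\<forall>n. 0 \<le> eve_ccdf (real (Suc n)) r" using eve_ccdf_bounds by simp
    show "\<forall>n. eve_ccdf (real (Suc n)) r \<le> exp (- (real (Suc n) * (eve_noise_rate * r powr \<alpha>\<^sub>1)))"
      using eve_ccdf_le_noise[of "real (Suc n)" "real (Suc n)" r for n] by (simp add: mult.assoc)
    have "(\<lambda>n. exp (- (real (Suc n) * K))) \<longlonglongrightarrow> 0" if "0 < K" for K
      using that by real_asymp
    then show "(\<lambda>n. exp (- (real (Suc n) * (eve_noise_rate * r powr \<alpha>\<^sub>1)))) \<longlonglongrightarrow> 0"
      using r eve_noise_rate_pos by simp
  qed
  then have "(\<lambda>n. eve_cdf (real (Suc n))) \<longlonglongrightarrow> exp_neg (ennreal (2 * pi * lam_E) * (\<integral>\<^sup>+r\<in>{0..}. ennreal (0 * r) \<partial>lborel))"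
    by (intro tendsto_eve_cdf[where \<gamma>\<^sub>0 = 1]) auto
  then show ?thesis by (simp add: exp_neg_def)
qed

lemma eve_cdf_left_continuous:
  assumes \<gamma>: "0 < \<gamma>"
  shows "(\<lambda>n. eve_cdf (\<gamma> - \<gamma> / real (n + 2))) \<longlonglongrightarrow> eve_cdf \<gamma>"
  unfolding eve_cdf_def[of \<gamma>]
proof (rule tendsto_eve_cdf[where \<gamma>\<^sub>0 = "\<gamma> / 2"])
  show "\<gamma> / 2 \<le> \<gamma> - \<gamma> / real (n + 2)" for n
    using \<gamma> by (simp add: field_simps)
  fix r :: real assume r: "0 < r"
  define g where "g n = \<gamma> - \<gamma> / real (n + 2)" for n :: nat
  have "(\<lambda>n. \<gamma> / real (n + 2)) \<longlonglongrightarrow> 0"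
    by (rule LIMSEQ_ignore_initial_segment[OF lim_const_over_n])
  then have lim: "g \<longlonglongrightarrow> \<gamma>"
    unfolding g_def using tendsto_diff[OF tendsto_const[of \<gamma>]] by fastforce
  have S: "real S > 0" using antennas by simp
  have "(\<lambda>n. ppp_laplace_exponent m \<alpha> (g n * K)) \<longlonglongrightarrow> ppp_laplace_exponent m \<alpha> (\<gamma> * K)" if "0 < K" for m \<alpha> K
    unfolding ppp_laplace_exponent_scale[of m \<alpha> "_ * K"] using \<gamma> that
    by (intro tendsto_mult_right tendsto_powr tendsto_mult lim tendsto_const) auto
  from this[of "r powr \<alpha>\<^sub>1" S "\<alpha>\<^sub>1"] this[of "real S * r powr \<alpha>\<^sub>1 * P_P / P_M" 1 "\<alpha>\<^sub>2"]
  have L: "(\<lambda>n. ppp_laplace_exponent S \<alpha>\<^sub>1 (g n * r powr \<alpha>\<^sub>1)) \<longlonglongrightarrow> ppp_laplace_exponent S \<alpha>\<^sub>1 (\<gamma> * r powr \<alpha>\<^sub>1)"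
    "(\<lambda>n. ppp_laplace_exponent 1 \<alpha>\<^sub>2 (g n * real S * r powr \<alpha>\<^sub>1 * P_P / P_M)) \<longlonglongrightarrow> ppp_laplace_exponent 1 \<alpha>\<^sub>2 (\<gamma> * real S * r powr \<alpha>\<^sub>1 * P_P / P_M)"
    using r params_pos S by (simp_all add: mult.assoc)
  have "(\<lambda>n. eve_exponent (g n) r) \<longlonglongrightarrow> eve_exponent \<gamma> r"
    unfolding eve_exponent_def using params_pos
    by (intro tendsto_add tendsto_mult tendsto_divide tendsto_const lim L) auto
  then show "(\<lambda>n. eve_ccdf (\<gamma> - \<gamma> / real (n + 2)) r) \<longlonglongrightarrow> eve_ccdf \<gamma> r"
    unfolding eve_ccdf_def g_def[symmetric] using \<gamma>
    by (intro tendsto_mult tendsto_exp tendsto_minus tendsto_powr tendsto_add tendsto_const lim) auto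
qed (use \<gamma> in auto)

end

section \<open>Secrecy outage\<close>

lemma ln_one_plus_inverse_ge_tangent:
  fixes y m :: real
  assumes "0 < y" "0 < m"
  shows "ln (1 + 1 / m) - (y - m) / ((1 + m) * m) \<le> ln (1 + 1 / y)"
proof -
  have pos: "0 < y * (1 + m) / ((1 + y) * m)" using assms by simp
  have "ln (1 + 1 / m) - ln (1 + 1 / y) = ln (y * (1 + m) / ((1 + y) * m))"
  proof -
    have "1 + 1 / m = (1 + m) / m" "1 + 1 / y = (1 + y) / y" using assms by (simp_all add: field_simps)
    then show ?thesis using assms by (simp add: ln_div ln_mult)
  qed
  also have "\<dots> \<le> y * (1 + m) / ((1 + y) * m) - 1"
    using pos by (rule ln_le_minus_one)
  also have "\<dots> = (y * (1 + m) - (1 + y) * m) / ((1 + y) * m)"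
    using assms by (simp add: diff_divide_distrib)
  also have "\<dots> = (y - m) / ((1 + y) * m)"
    by (simp add: algebra_simps)
  also have "\<dots> \<le> (y - m) / ((1 + m) * m)"
  proof (cases "y \<ge> m")
    case True
    then show ?thesis using assms by (intro divide_left_mono mult_right_mono) auto
  next
    case False
    then have "(m - y) / ((1 + m) * m) \<le> (m - y) / ((1 + y) * m)"
      using assms by (intro divide_left_mono mult_right_mono) auto
    then show ?thesis by (simp add: diff_divide_distrib)
  qed
  finally show ?thesis by simp
qed

lemma one_plus_powr_le:
  fixes y a :: real
  assumes "0 \<le> y" "1 \<le> a"
  shows "1 + y powr a \<le> (1 + y) powr a"
proof -
  have "1 + y powr a = 1 * 1 powr (a - 1) + y * y powr (a - 1)"
    using assms by (cases "y = 0") (auto simp: powr_diff)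
  also have "\<dots> \<le> 1 * (1 + y) powr (a - 1) + y * (1 + y) powr (a - 1)"
    using assms by (intro add_mono mult_left_mono powr_mono2) auto
  also have "\<dots> = (1 + y) powr a"
    using assms powr_add[of "1 + y" "a - 1" 1] by (simp add: algebra_simps)
  finally show ?thesis .
qed

lemma (in prob_space) log_inverse_expectation_le:
  fixes Y :: "'a \<Rightarrow> real"
  assumes pos: "AE \<omega> in M. 0 < Y \<omega>" and int: "integrable M (\<lambda>\<omega>. log 2 (1 + Y \<omega>))"
  shows "log 2 (1 + inverse (\<integral>\<omega>. inverse (Y \<omega>) \<partial>M)) \<le> (\<integral>\<omega>. log 2 (1 + Y \<omega>) \<partial>M)"
proof -
  define m where "m = (\<integral>\<omega>. inverse (Y \<omega>) \<partial>M)"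
  have m0: "0 \<le> m"
    unfolding m_def using pos by (intro integral_nonneg_AE) (auto elim: eventually_mono)
  show ?thesis
  proof (cases "m = 0")
    case True
    have "0 \<le> (\<integral>\<omega>. log 2 (1 + Y \<omega>) \<partial>M)"
      using pos by (intro integral_nonneg_AE) (auto elim!: eventually_mono)
    then show ?thesis using True by (simp add: m_def)
  next
    case False
    then have m: "0 < m" and inv_int: "integrable M (\<lambda>\<omega>. inverse (Y \<omega>))"
      using m0 not_integrable_integral_eq[of M "\<lambda>\<omega>. inverse (Y \<omega>)"] by (auto simp: m_def)
    have "log 2 (1 + inverse m) = (\<integral>\<omega>. log 2 (1 + inverse m) - (inverse (Y \<omega>) - m) / ((1 + m) * m * ln 2) \<partial>M)"
      using inv_int by (simp add: prob_space m_def[symmetric])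
    also have "\<dots> \<le> (\<integral>\<omega>. log 2 (1 + Y \<omega>) \<partial>M)"
    proof (rule integral_mono_AE)
      show "AE \<omega> in M. log 2 (1 + inverse m) - (inverse (Y \<omega>) - m) / ((1 + m) * m * ln 2) \<le> log 2 (1 + Y \<omega>)"
        using pos
      proof eventually_elim
        case (elim \<omega>)
        have "ln (1 + 1 / m) - (inverse (Y \<omega>) - m) / ((1 + m) * m) \<le> ln (1 + 1 / inverse (Y \<omega>))"
          using elim m by (intro ln_one_plus_inverse_ge_tangent) auto
        then have "(ln (1 + inverse m) - (inverse (Y \<omega>) - m) / ((1 + m) * m)) / ln 2 \<le> ln (1 + Y \<omega>) / ln 2"
          by (intro divide_right_mono) (auto simp: divide_inverse)
        then show ?case
          unfolding log_def diff_divide_distrib[of _ _ "ln 2"] divide_divide_eq_left .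
      qed
    qed (use inv_int int in auto)
    finally show ?thesis by (simp add: m_def)
  qed
qed

context massive_mimo_hetnet begin

lemma measurable_SINR_max [measurable]: "SINR_max \<in> borel_measurable \<Omega>"
proof -
  \<comment> \<open>The supremum of an unbounded set of reals is an unspecified constant.\<close>
  define bdd where "bdd \<omega> \<longleftrightarrow> (\<exists>n :: nat. \<forall>k. SINR_eve k \<omega> \<le> real n)" for \<omega>
  define T where "T k \<omega> = (if bdd \<omega> then SINR_eve k \<omega> else 0)" for k \<omega>
  have [measurable]: "Measurable.pred \<Omega> bdd" unfolding bdd_def by measurable
  have [measurable]: "T k \<in> borel_measurable \<Omega>" for k unfolding T_def by measurable
  have "bdd_above (range (\<lambda>k. T k \<omega>))" for \<omega>
    by (auto simp: T_def bdd_def bdd_above_def)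
  then have [measurable]: "(\<lambda>\<omega>. SUP k. T k \<omega>) \<in> borel_measurable \<Omega>"
    by (intro borel_measurable_cSUP) auto
  have "SINR_max \<omega> = (if bdd \<omega> then (SUP k. T k \<omega>) else (LEAST z :: real. False))" for \<omega>
  proof (cases "bdd \<omega>")
    case False
    have "\<not> (\<forall>x \<in> range (\<lambda>k. SINR_eve k \<omega>). x \<le> z)" for z
    proof
      assume *: "\<forall>x \<in> range (\<lambda>k. SINR_eve k \<omega>). x \<le> z"
      obtain n :: nat where "z \<le> real n" using real_arch_simple by blast
      with * have "bdd \<omega>" unfolding bdd_def by (auto intro: order_trans)
      with False show False by simp
    qed
    then have "(\<lambda>z. \<forall>x \<in> range (\<lambda>k. SINR_eve k \<omega>). x \<le> z) = (\<lambda>z. False)"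
      by (simp only: fun_eq_iff not_False_eq_True simp_thms)
    then show ?thesis unfolding SINR_max_def Sup_real_def using False by (simp only: if_False)
  qed (simp add: SINR_max_def T_def)
  then show ?thesis by (simp add: measurable_If cong: measurable_cong)
qed

lemma AE_eve_bounded: "AE \<omega> in cond_space. bdd_above (range (\<lambda>k. SINR_eve k \<omega>))"
proof -
  interpret Q: prob_space cond_space by (rule prob_space_cond_space)
  let ?A = "{\<omega> \<in> space \<Omega>. \<exists>n :: nat. \<forall>k. SINR_eve k \<omega> \<le> real n}"
  have [measurable]: "?A \<in> sets \<Omega>" by measurable
  have "eve_cdf (real (Suc n)) \<le> Q.prob ?A" for n
    unfolding cond_prob_all_eve_le[OF of_nat_0_le_iff, symmetric]
    by (intro Q.finite_measure_mono) (auto simp del: of_nat_Suc)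
  then have "1 \<le> Q.prob ?A"
    by (intro LIMSEQ_le_const2[OF eve_cdf_at_top]) auto
  then have "Q.prob ?A = 1"
    using Q.prob_le_1[of ?A] by simp
  then have "AE \<omega> in cond_space. \<omega> \<in> ?A"
    by (subst (asm) Q.prob_eq_1) auto
  then show ?thesis
    by eventually_elim (auto simp: bdd_above_def)
qed

lemma cond_prob_SINR_max_le:
  assumes "0 \<le> \<gamma>"
  shows "measure cond_space {\<omega> \<in> space \<Omega>. SINR_max \<omega> \<le> \<gamma>} = eve_cdf \<gamma>"
proof -
  interpret Q: prob_space cond_space by (rule prob_space_cond_space)
  have "Q.prob {\<omega> \<in> space \<Omega>. SINR_max \<omega> \<le> \<gamma>} = Q.prob {\<omega> \<in> space \<Omega>. \<forall>k. SINR_eve k \<omega> \<le> \<gamma>}"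
  proof (rule Q.finite_measure_eq_AE)
    show "AE \<omega> in cond_space. \<omega> \<in> {\<omega> \<in> space \<Omega>. SINR_max \<omega> \<le> \<gamma>} \<longleftrightarrow> \<omega> \<in> {\<omega> \<in> space \<Omega>. \<forall>k. SINR_eve k \<omega> \<le> \<gamma>}"
      using AE_eve_bounded by eventually_elim (auto simp: SINR_max_def cSUP_le_iff)
  qed measurable
  then show ?thesis using cond_prob_all_eve_le[OF assms] by simp
qed

lemma AE_SINR_max_pos: "AE \<omega> in cond_space. 0 < SINR_max \<omega>"
proof -
  interpret Q: prob_space cond_space by (rule prob_space_cond_space)
  have "Q.prob {\<omega> \<in> space cond_space. \<not> 0 < SINR_max \<omega>} = 0"
    using cond_prob_SINR_max_le[of 0] by (simp add: eve_cdf_0 not_less)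
  then show ?thesis by (subst AE_iff_measurable[OF _ refl]) (auto simp: Q.emeasure_eq_measure)
qed

lemma cond_prob_SINR_max_less:
  assumes "0 \<le> \<gamma>"
  shows "measure cond_space {\<omega> \<in> space \<Omega>. SINR_max \<omega> < \<gamma>} = eve_cdf \<gamma>"
proof -
  interpret Q: prob_space cond_space by (rule prob_space_cond_space)
  have le: "Q.prob {\<omega> \<in> space \<Omega>. SINR_max \<omega> < \<gamma>} \<le> eve_cdf \<gamma>"
    unfolding cond_prob_SINR_max_le[OF assms, symmetric] by (intro Q.finite_measure_mono) auto
  show ?thesis
  proof (cases "\<gamma> = 0")
    case True
    then show ?thesis using le by (intro antisym) (auto simp: eve_cdf_0)
  next
    case False
    then have \<gamma>: "0 < \<gamma>" using assms by simp
    have "eve_cdf (\<gamma> - \<gamma> / real (n + 2)) \<le> Q.prob {\<omega> \<in> space \<Omega>. SINR_max \<omega> < \<gamma>}" for n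
    proof -
      have "0 \<le> \<gamma> - \<gamma> / real (n + 2)" "\<gamma> - \<gamma> / real (n + 2) < \<gamma>" using \<gamma> by (simp_all add: field_simps)
      then show ?thesis
        by (subst cond_prob_SINR_max_le[symmetric]) (auto intro!: Q.finite_measure_mono)
    qed
    then have "eve_cdf \<gamma> \<le> Q.prob {\<omega> \<in> space \<Omega>. SINR_max \<omega> < \<gamma>}"
      by (intro LIMSEQ_le_const2[OF eve_cdf_left_continuous[OF \<gamma>]]) auto
    with le show ?thesis by simp
  qed
qed

lemma cdf_SINR_max: "cdf (distr cond_space borel SINR_max) \<gamma> = measure cond_space {\<omega> \<in> space \<Omega>. SINR_max \<omega> \<le> \<gamma>}"
  unfolding cdf_def by (subst measure_distr) (auto intro!: arg_cong[where f = "measure cond_space"])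

lemma secrecy_outage_eq:
  "measure cond_space {\<omega> \<in> space cond_space. R - log 2 (1 + SINR_max \<omega>) \<le> R\<^sub>s}
     = 1 - cdf (distr cond_space borel SINR_max) (2 powr (R - R\<^sub>s) - 1)"
proof -
  interpret Q: prob_space cond_space by (rule prob_space_cond_space)
  define \<gamma> where "\<gamma> = 2 powr (R - R\<^sub>s) - 1"
  have "Q.prob {\<omega> \<in> space cond_space. R - log 2 (1 + SINR_max \<omega>) \<le> R\<^sub>s}
      = Q.prob (space cond_space - {\<omega> \<in> space \<Omega>. SINR_max \<omega> < \<gamma>})"
  proof (rule Q.finite_measure_eq_AE)
    show "AE \<omega> in cond_space. \<omega> \<in> {\<omega> \<in> space cond_space. R - log 2 (1 + SINR_max \<omega>) \<le> R\<^sub>s}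
       \<longleftrightarrow> \<omega> \<in> space cond_space - {\<omega> \<in> space \<Omega>. SINR_max \<omega> < \<gamma>}"
      using AE_SINR_max_pos
    proof eventually_elim
      case (elim \<omega>)
      have "R - log 2 (1 + SINR_max \<omega>) \<le> R\<^sub>s \<longleftrightarrow> R - R\<^sub>s \<le> log 2 (1 + SINR_max \<omega>)" by auto
      also have "\<dots> \<longleftrightarrow> \<gamma> \<le> SINR_max \<omega>"
        using elim by (subst le_log_iff) (auto simp: \<gamma>_def)
      finally show ?case by auto
    qed
  qed measurable
  also have "\<dots> = 1 - Q.prob {\<omega> \<in> space \<Omega>. SINR_max \<omega> < \<gamma>}"
    by (rule Q.prob_compl) measurable
  also have "Q.prob {\<omega> \<in> space \<Omega>. SINR_max \<omega> < \<gamma>} = Q.prob {\<omega> \<in> space \<Omega>. SINR_max \<omega> \<le> \<gamma>}"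
  proof (cases "0 \<le> \<gamma>")
    case True
    then show ?thesis by (simp add: cond_prob_SINR_max_less cond_prob_SINR_max_le)
  next
    case False
    then show ?thesis
      using AE_SINR_max_pos by (intro Q.finite_measure_eq_AE) (auto elim!: eventually_mono)
  qed
  finally show ?thesis by (simp add: cdf_SINR_max \<gamma>_def)
qed

lemma measurable_SINR_M [measurable]: "SINR_M \<in> borel_measurable \<Omega>"
proof -
  have [measurable]: "(\<lambda>\<omega>. X MBS (serving \<omega>) \<omega>) \<in> borel_measurable \<Omega>"
    by (rule measurable_compose_countable) measurable
  show ?thesis
    unfolding SINR_M_def[abs_def] user_interference_def by measurable
qed

lemma AE_user_interference_nonneg: "AE \<omega> in \<Omega>. 0 \<le> user_interference \<omega>"
proof -
  have "AE \<omega> in \<Omega>. (\<forall>l. 0 \<le> P_M / real S * \<beta> * h (User_MBS l) \<omega> * dist 0 (X MBS l \<omega>) powr (- \<alpha>\<^sub>1))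
            \<and> summable (\<lambda>l. P_M / real S * \<beta> * h (User_MBS l) \<omega> * dist 0 (X MBS l \<omega>) powr (- \<alpha>\<^sub>1))"
    using antennas params_pos path_loss_exponents
    by (intro AE_interference_summable[where m = S]) (auto simp: inj_def)
  moreover have "AE \<omega> in \<Omega>. (\<forall>l. 0 \<le> P_P * \<beta> * h (User_PBS l) \<omega> * dist 0 (X PBS l \<omega>) powr (- \<alpha>\<^sub>2))
            \<and> summable (\<lambda>l. P_P * \<beta> * h (User_PBS l) \<omega> * dist 0 (X PBS l \<omega>) powr (- \<alpha>\<^sub>2))"
    using antennas params_pos path_loss_exponents
    by (intro AE_interference_summable[where m = 1]) (auto simp: inj_def exp_law_eq_gamma_law)
  ultimately show ?thesis
  proof eventually_elim
    case (elim \<omega>)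
    let ?I = "\<lambda>l. P_M / real S * h (User_MBS l) \<omega> * loss_M (norm (X MBS l \<omega>))"
    let ?J = "\<lambda>j. P_P * h (User_PBS j) \<omega> * loss_P (norm (X PBS j \<omega>))"
    have "?I l = P_M / real S * \<beta> * h (User_MBS l) \<omega> * dist 0 (X MBS l \<omega>) powr (- \<alpha>\<^sub>1)" for l
      by (simp add: loss_M_def)
    then have I: "0 \<le> ?I l" "summable ?I" for l using elim by (simp_all only:)
    have "?J l = P_P * \<beta> * h (User_PBS l) \<omega> * dist 0 (X PBS l \<omega>) powr (- \<alpha>\<^sub>2)" for l
      by (simp add: loss_P_def)
    then have J: "0 \<le> ?J l" "summable ?J" for l using elim by (simp_all only:)
    have "summable (\<lambda>l. if l = serving \<omega> then 0 else ?I l)"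
      by (rule summable_comparison_test'[OF I(2), of 0]) (use I(1) in auto)
    then have "0 \<le> (\<Sum>l. if l = serving \<omega> then 0 else ?I l)"
      using I(1) by (intro suminf_nonneg) auto
    moreover have "0 \<le> suminf ?J" using J by (intro suminf_nonneg)
    ultimately show ?case by (simp add: user_interference_def)
  qed
qed

lemma AE_serving_gain_pos: "AE \<omega> in \<Omega>. 0 < h User_serving \<omega>"
proof -
  have "gain_law N S User_serving = density lborel (\<lambda>x. ennreal (erlang_density (N - S) 1 x))"
    by (simp add: gamma_law_def)
  moreover have "AE x in density lborel (\<lambda>x. ennreal (erlang_density (N - S) 1 x)). 0 < x"
  proof (subst AE_density, simp)
    show "AE x in lborel. 0 < ennreal (erlang_density (N - S) 1 x) \<longrightarrow> 0 < x"
      using AE_lborel_singleton[of "0 :: real"] by eventually_elim (auto simp: erlang_density_def split: if_splits)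
  qed
  ultimately have "AE x in distr \<Omega> borel (h User_serving). 0 < x" unfolding gains by (simp only:)
  then show ?thesis by (subst (asm) AE_distr_iff) auto
qed

lemma AE_SINR_M_pos: "AE \<omega> in \<Omega>. 0 < SINR_M \<omega>"
  using AE_user_interference_nonneg AE_serving_gain_pos AE_points_nonzero[of MBS]
proof eventually_elim
  case (elim \<omega>)
  have "0 < user_interference \<omega> + \<delta>\<^sup>2" using elim params_pos by (intro add_nonneg_pos) auto
  then show ?case
    using elim params_pos antennas unfolding SINR_M_def loss_M_def
    by (intro divide_pos_pos mult_pos_pos) auto
qed

lemma nn_integral_serving_gain_finite: "(\<integral>\<^sup>+\<omega>. ennreal (h User_serving \<omega>) \<partial>\<Omega>) < \<infinity>"
proof -
  have "(\<integral>\<^sup>+\<omega>. ennreal (h User_serving \<omega>) \<partial>\<Omega>) = (\<integral>\<^sup>+x. ennreal x \<partial>gain_law N S User_serving)"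
    by (rule nn_integral_gain) simp
  also have "\<dots> = (\<integral>\<^sup>+x. ennreal (erlang_density (N - S) 1 x * x ^ 1) \<partial>lborel)"
    by (auto simp: gamma_law_def nn_integral_density ennreal_mult' intro!: nn_integral_cong)
  also have "\<dots> = ennreal (fact (N - S + 1) / (fact (N - S) * 1 ^ 1))"
    by (rule nn_integral_erlang_ith_moment) simp
  finally show ?thesis by simp
qed

lemma nn_integral_inverse_serving_distance_finite:
  "(\<integral>\<^sup>+\<omega>. ennreal (1 / norm (X MBS (serving \<omega>) \<omega>)) \<partial>\<Omega>) < \<infinity>"
proof -
  have [measurable]: "(\<lambda>\<omega>. X MBS (serving \<omega>) \<omega>) \<in> borel_measurable \<Omega>"
    by (rule measurable_compose_countable) measurable
  \<comment> \<open>The serving station is never closer than the nearest point of its process, whatever index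
    \<open>serving\<close> picks.\<close>
  define Y where "Y \<omega> = nat \<lceil>1 / norm (X MBS (serving \<omega>) \<omega>)\<rceil>" for \<omega>
  have [measurable]: "Y \<in> measurable \<Omega> (count_space UNIV)"
    unfolding Y_def by measurable
  have "(\<integral>\<^sup>+\<omega>. ennreal (1 / norm (X MBS (serving \<omega>) \<omega>)) \<partial>\<Omega>) \<le> (\<integral>\<^sup>+\<omega>. of_nat (Y \<omega>) \<partial>\<Omega>)"
    by (intro nn_integral_mono) (auto simp: Y_def ennreal_of_nat_eq_real_of_nat intro!: ennreal_leI real_nat_ceiling_ge)
  also have "\<dots> = (\<Sum>n. emeasure \<Omega> {\<omega> \<in> space \<Omega>. n < Y \<omega>})"
    by (rule nn_integral_nat_function) measurable
  also have "\<dots> = emeasure \<Omega> {\<omega> \<in> space \<Omega>. 0 < Y \<omega>} + (\<Sum>n. emeasure \<Omega> {\<omega> \<in> space \<Omega>. Suc n < Y \<omega>})"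
    using suminf_offset[of "\<lambda>n. emeasure \<Omega> {\<omega> \<in> space \<Omega>. n < Y \<omega>}" 1] by (simp add: summableI add.commute)
  also have "\<dots> \<le> 1 + (\<Sum>n. ennreal (lam_M * pi * (1 / (real n + 1)\<^sup>2)))"
  proof (intro add_mono suminf_le summableI)
    show "emeasure \<Omega> {\<omega> \<in> space \<Omega>. 0 < Y \<omega>} \<le> 1" by (simp add: emeasure_eq_measure flip: ennreal_1)
    fix n
    let ?r = "1 / (real n + 1)"
    have "emeasure \<Omega> {\<omega> \<in> space \<Omega>. Suc n < Y \<omega>} \<le> emeasure \<Omega> (space \<Omega> - {\<omega> \<in> space \<Omega>. \<forall>i. X MBS i \<omega> \<notin> cball 0 ?r})"
    proof (intro emeasure_mono)
      show "{\<omega> \<in> space \<Omega>. Suc n < Y \<omega>} \<subseteq> space \<Omega> - {\<omega> \<in> space \<Omega>. \<forall>i. X MBS i \<omega> \<notin> cball 0 ?r}"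
      proof safe
        fix \<omega> assume "Suc n < Y \<omega>" and far: "\<forall>i. X MBS i \<omega> \<notin> cball 0 ?r"
        then have less: "real n + 1 < 1 / norm (X MBS (serving \<omega>) \<omega>)"
          by (auto simp: Y_def less_ceiling_iff zless_nat_eq_int_zless)
        then have "X MBS (serving \<omega>) \<omega> \<noteq> 0" by (intro notI) simp
        with less have "norm (X MBS (serving \<omega>) \<omega>) \<le> ?r"
          by (simp add: field_simps)
        then show False using far by simp
      qed
    qed (simp only: mem_cball, measurable)
    also have "\<dots> = ennreal (1 - exp (- (lam_M * (pi * ?r\<^sup>2))))"
      unfolding emeasure_eq_measure
    proof (subst prob_compl)
      show "{\<omega> \<in> space \<Omega>. \<forall>i. X MBS i \<omega> \<notin> cball 0 ?r} \<in> events"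
        by (simp only: mem_cball) measurable
      show "ennreal (1 - prob {\<omega> \<in> space \<Omega>. \<forall>i. X MBS i \<omega> \<notin> cball 0 ?r}) = ennreal (1 - exp (- (lam_M * (pi * ?r\<^sup>2))))"
        by (subst prob_no_points) (auto simp: content_cball eval_unit_ball_vol)
    qed
    also have "\<dots> \<le> ennreal (lam_M * (pi * ?r\<^sup>2))"
      using exp_ge_add_one_self[of "- (lam_M * (pi * ?r\<^sup>2))"] by (intro ennreal_leI) linarith
    finally show "emeasure \<Omega> {\<omega> \<in> space \<Omega>. Suc n < Y \<omega>} \<le> ennreal (lam_M * pi * (1 / (real n + 1)\<^sup>2))"
      by (simp add: power_divide mult.assoc)
  qed
  also have "(\<Sum>n. ennreal (lam_M * pi * (1 / (real n + 1)\<^sup>2))) = ennreal (\<Sum>n. lam_M * pi * (1 / (real n + 1)\<^sup>2))"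
    using params_pos sums_summable[OF inverse_squares_sums]
    by (intro suminf_ennreal2 summable_mult) (auto simp: add.commute)
  finally show ?thesis
    by (rule le_less_trans) simp
qed

lemma integrable_log_SINR_M: "integrable cond_space (\<lambda>\<omega>. log 2 (1 + SINR_M \<omega>))"
proof -
  define A where "A = P_M / real S * \<beta> / \<delta>\<^sup>2"
  have A: "0 \<le> A" using params_pos by (simp add: A_def)
  let ?r = "\<lambda>\<omega>. norm (X MBS (serving \<omega>) \<omega>)"
  have [measurable]: "(\<lambda>\<omega>. X MBS (serving \<omega>) \<omega>) \<in> borel_measurable \<Omega>"
    by (rule measurable_compose_countable) measurable
  have bound: "AE \<omega> in \<Omega>. 0 \<le> ln (1 + SINR_M \<omega>) \<and> ln (1 + SINR_M \<omega>) \<le> A * h User_serving \<omega> + \<alpha>\<^sub>1 * (1 / ?r \<omega>) \<and> 0 < h User_serving \<omega>"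
    using AE_SINR_M_pos AE_user_interference_nonneg AE_serving_gain_pos
  proof eventually_elim
    case (elim \<omega>)
    let ?y = "1 / ?r \<omega>"
    have y: "?r \<omega> powr (- \<alpha>\<^sub>1) = ?y powr \<alpha>\<^sub>1"
      by (simp add: powr_minus_divide powr_divide)
    have "SINR_M \<omega> \<le> P_M / real S * h User_serving \<omega> * loss_M (?r \<omega>) / \<delta>\<^sup>2"
      unfolding SINR_M_def using elim params_pos
      by (intro divide_left_mono mult_pos_pos add_nonneg_pos) (auto simp: loss_M_def)
    also have "\<dots> = A * h User_serving \<omega> * ?y powr \<alpha>\<^sub>1"
      unfolding loss_M_def y by (simp add: A_def)
    also have "1 + \<dots> \<le> (1 + A * h User_serving \<omega>) * (1 + ?y powr \<alpha>\<^sub>1)"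
      using A elim by (simp add: algebra_simps)
    finally have "1 + SINR_M \<omega> \<le> (1 + A * h User_serving \<omega>) * (1 + ?y powr \<alpha>\<^sub>1)" by simp
    also have "\<dots> \<le> (1 + A * h User_serving \<omega>) * (1 + ?y) powr \<alpha>\<^sub>1"
      using A elim path_loss_exponents by (intro mult_left_mono one_plus_powr_le) auto
    finally have "ln (1 + SINR_M \<omega>) \<le> ln ((1 + A * h User_serving \<omega>) * (1 + ?y) powr \<alpha>\<^sub>1)"
      using elim by (intro ln_mono) auto
    also have "\<dots> = ln (1 + A * h User_serving \<omega>) + \<alpha>\<^sub>1 * ln (1 + ?y)"
    proof -
      have "0 < 1 + A * h User_serving \<omega>" "0 < 1 + ?y" using A elim by (auto intro!: add_pos_nonneg)
      then show ?thesis by (simp add: ln_mult ln_powr)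
    qed
    also have "\<dots> \<le> A * h User_serving \<omega> + \<alpha>\<^sub>1 * ?y"
      using A elim path_loss_exponents
      by (intro add_mono mult_left_mono ln_add_one_self_le_self) auto
    finally show ?case using elim by simp
  qed
  have "(\<integral>\<^sup>+\<omega>. ennreal (ln (1 + SINR_M \<omega>)) \<partial>\<Omega>)
      \<le> (\<integral>\<^sup>+\<omega>. ennreal A * ennreal (h User_serving \<omega>) + ennreal \<alpha>\<^sub>1 * ennreal (1 / ?r \<omega>) \<partial>\<Omega>)"
  proof (rule nn_integral_mono_AE)
    show "AE \<omega> in \<Omega>. ennreal (ln (1 + SINR_M \<omega>)) \<le> ennreal A * ennreal (h User_serving \<omega>) + ennreal \<alpha>\<^sub>1 * ennreal (1 / ?r \<omega>)"
      using bound
    proof eventually_elim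
      case (elim \<omega>)
      then have "ennreal (ln (1 + SINR_M \<omega>)) \<le> ennreal (A * h User_serving \<omega> + \<alpha>\<^sub>1 * (1 / ?r \<omega>))"
        by (intro ennreal_leI) auto
      also have "\<dots> = ennreal A * ennreal (h User_serving \<omega>) + ennreal \<alpha>\<^sub>1 * ennreal (1 / ?r \<omega>)"
        using A elim path_loss_exponents by (subst ennreal_plus) (auto simp: ennreal_mult' simp del: times_divide_eq_right)
      finally show ?case .
    qed
  qed
  also have "\<dots> = ennreal A * (\<integral>\<^sup>+\<omega>. ennreal (h User_serving \<omega>) \<partial>\<Omega>) + ennreal \<alpha>\<^sub>1 * (\<integral>\<^sup>+\<omega>. ennreal (1 / ?r \<omega>) \<partial>\<Omega>)"
    by (subst nn_integral_add, measurable, subst (1 2) nn_integral_cmult, measurable)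
  also have "\<dots> < \<infinity>"
    using nn_integral_serving_gain_finite nn_integral_inverse_serving_distance_finite
    by (simp add: ennreal_mult_less_top)
  finally have fin: "(\<integral>\<^sup>+\<omega>. ennreal (ln (1 + SINR_M \<omega>)) \<partial>\<Omega>) < \<infinity>" .
  have "integrable \<Omega> (\<lambda>\<omega>. ln (1 + SINR_M \<omega>))"
    using bound fin by (intro integrableI_nonneg) (auto elim: eventually_mono)
  then have "integrable \<Omega> (\<lambda>\<omega>. (indicator mbs_association \<omega> *\<^sub>R ln (1 + SINR_M \<omega>)) / (prob mbs_association * ln 2))"
    by (intro integrable_divide_zero integrable_mult_indicator) auto
  then have "integrable \<Omega> (\<lambda>\<omega>. (indicator mbs_association \<omega> / prob mbs_association) *\<^sub>R log 2 (1 + SINR_M \<omega>))"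
    by (simp add: log_def)
  moreover have "cond_space = density \<Omega> (\<lambda>\<omega>. ennreal (indicator mbs_association \<omega> / prob mbs_association))"
    unfolding cond_space_def uniform_measure_def using prob_mbs_association_pos
    by (intro density_cong) (auto simp: emeasure_eq_measure indicator_def divide_ennreal simp flip: ennreal_1)
  ultimately show ?thesis
    by (simp add: integrable_density)
qed

lemma R_M_le_ergodic_rate: "R_M \<le> ergodic_rate"
proof -
  interpret Q: prob_space cond_space by (rule prob_space_cond_space)
  show ?thesis
    unfolding R_M_def ergodic_rate_def
    by (rule Q.log_inverse_expectation_le[OF AE_cond_space[OF AE_SINR_M_pos] integrable_log_SINR_M])
qed

end

theorem theorem1:
  fixes \<Omega> :: "'a measure"
    and X :: "tier \<Rightarrow> nat \<Rightarrow> 'a \<Rightarrow> real^2"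
    and h :: "link \<Rightarrow> 'a \<Rightarrow> real"
    and N S :: nat
    and P_M P_P \<beta> \<alpha>\<^sub>1 \<alpha>\<^sub>2 \<delta> lam_M lam_P lam_E R\<^sub>s :: real
  assumes "massive_mimo_hetnet \<Omega> X h N S P_M P_P \<beta> \<alpha>\<^sub>1 \<alpha>\<^sub>2 \<delta> lam_M lam_P lam_E"
  shows
    "let Q = massive_mimo_hetnet.cond_space \<Omega> X N S P_M P_P \<beta> \<alpha>\<^sub>1 \<alpha>\<^sub>2;
         C_M = massive_mimo_hetnet.ergodic_rate \<Omega> X h N S P_M P_P \<beta> \<alpha>\<^sub>1 \<alpha>\<^sub>2 \<delta>;
         R_M = massive_mimo_hetnet.R_M \<Omega> X h N S P_M P_P \<beta> \<alpha>\<^sub>1 \<alpha>\<^sub>2 \<delta>;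
         Z = massive_mimo_hetnet.SINR_max X h N S P_M P_P \<beta> \<alpha>\<^sub>1 \<alpha>\<^sub>2 \<delta>;
         F = cdf (distr Q borel Z);
         P_out = measure Q {\<omega> \<in> space Q. R_M - log 2 (1 + Z \<omega>) \<le> R\<^sub>s};
         E = (\<lambda>\<gamma> x.
           \<gamma> * real S * \<delta>\<^sup>2 * x powr \<alpha>\<^sub>1 / (\<beta> * P_M)
           + 2 * pi * lam_M * (\<Sum>k=1..S. real (S choose k) *
               ((\<gamma> * x powr \<alpha>\<^sub>1) powr (2 / \<alpha>\<^sub>1) * Gamma (real k - 2 / \<alpha>\<^sub>1)
                  * Gamma (- real k + 2 / \<alpha>\<^sub>1 + real S) / (\<alpha>\<^sub>1 * Gamma (real S))))
           + 2 * pi\<^sup>2 * lam_P / \<alpha>\<^sub>2 * (\<gamma> * real S * x powr \<alpha>\<^sub>1 * P_P / P_M) powr (2 / \<alpha>\<^sub>2)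
               * (1 / sin (2 * pi / \<alpha>\<^sub>2)))
     in measure Q {\<omega> \<in> space Q. C_M - log 2 (1 + Z \<omega>) < R\<^sub>s} \<le> P_out
        \<and> P_out = 1 - F (2 powr (R_M - R\<^sub>s) - 1)
        \<and> (\<forall>\<gamma>\<ge>0. F \<gamma> = exp_neg (ennreal (2 * pi * lam_E) *
              (\<integral>\<^sup>+x\<in>{0..}. ennreal (exp (- E \<gamma> x) * (\<gamma> + 1) powr (- (real S - 1)) * x) \<partial>lborel)))"
proof -
  interpret massive_mimo_hetnet \<Omega> X h N S P_M P_P \<beta> \<alpha>\<^sub>1 \<alpha>\<^sub>2 \<delta> lam_M lam_P lam_E
    by (rule assms)
  interpret Q: prob_space cond_space by (rule prob_space_cond_space)
  let ?E = "\<lambda>\<gamma> x.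
           \<gamma> * real S * \<delta>\<^sup>2 * x powr \<alpha>\<^sub>1 / (\<beta> * P_M)
           + 2 * pi * lam_M * (\<Sum>k=1..S. real (S choose k) *
               ((\<gamma> * x powr \<alpha>\<^sub>1) powr (2 / \<alpha>\<^sub>1) * Gamma (real k - 2 / \<alpha>\<^sub>1)
                  * Gamma (- real k + 2 / \<alpha>\<^sub>1 + real S) / (\<alpha>\<^sub>1 * Gamma (real S))))
           + 2 * pi\<^sup>2 * lam_P / \<alpha>\<^sub>2 * (\<gamma> * real S * x powr \<alpha>\<^sub>1 * P_P / P_M) powr (2 / \<alpha>\<^sub>2)
               * (1 / sin (2 * pi / \<alpha>\<^sub>2))"
  have "eve_exponent \<gamma> r = ?E \<gamma> r" for \<gamma> r
    unfolding eve_exponent_def ppp_laplace_exponent_1[OF path_loss_exponents(2)]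
    by (simp add: ppp_laplace_exponent_def mult_ac)
  then have "eve_cdf \<gamma> = exp_neg (ennreal (2 * pi * lam_E) *
      (\<integral>\<^sup>+x\<in>{0..}. ennreal (exp (- ?E \<gamma> x) * (\<gamma> + 1) powr (- (real S - 1)) * x) \<partial>lborel))" for \<gamma>
    unfolding eve_cdf_def eve_ccdf_def by (simp only:)
  then have "cdf (distr cond_space borel SINR_max) \<gamma> = exp_neg (ennreal (2 * pi * lam_E) *
      (\<integral>\<^sup>+x\<in>{0..}. ennreal (exp (- ?E \<gamma> x) * (\<gamma> + 1) powr (- (real S - 1)) * x) \<partial>lborel))" if "0 \<le> \<gamma>" for \<gamma>
    using that by (simp only: cdf_SINR_max cond_prob_SINR_max_le)
  moreover have "Q.prob {\<omega> \<in> space cond_space. ergodic_rate - log 2 (1 + SINR_max \<omega>) < R\<^sub>s}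
      \<le> Q.prob {\<omega> \<in> space cond_space. R_M - log 2 (1 + SINR_max \<omega>) \<le> R\<^sub>s}"
    using R_M_le_ergodic_rate by (intro Q.finite_measure_mono) auto
  ultimately show ?thesis
    unfolding Let_def using secrecy_outage_eq by blast
qed

end
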